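(* Let $A$ be a finite-dimensional algebra over an algebraically closed field and let $M$ be a non-zero, basic, $\tau$-rigid $A$-module with a torsion-free admissible decomposition $M=\bigoplus_{j=1}^{t}M_j$. 1. Let $1\le r\le t$ and let $\{k_2,\dots,k_r\}\subseteq\{1,\dots,t-1\}$ with $k_2<\cdots<k_r$; put $k_1=0$. Define $L_j=\bigoplus_{i=k_j+1}^{k_{j+1}}M_i$ for $1\le j<r$ and $L_r=\bigoplus_{i=k_r+1}^{t}M_i$, so that $M=\bigoplus_{j=1}^{r}L_j$. Then the object $L_\bullet=(L_k)_{k\in\mathbb{I}_r}$ T-induces the nested family $$\Gamma=\Big\{\Big(\mathrm{Fac}\big(\textstyle\bigoplus_{j\ge k}L_j\big),\ \big(\bigoplus_{j\ge k}L_j\big)^{\bot}\Big)\Big\}_{k\in\mathbb{I}_r},$$ $L_\bullet\in\mathcal{M}^{\dagger}(\Gamma)$, and $\Omega=\{\Omega_k:=f_{k+1}(L_k)\}_{k\in\mathbb{I}_r}$ is a pre-stratifying system of size $r$, where $f_k$ is the torsion-free functor associated to the pair $(\mathrm{Fac}(\bigoplus_{j\ge k}L_j),(\bigoplus_{j\ge k}L_j)^{\bot})$ and $f_{r+1}(L_r):=L_r$. 2. If $f_k$ denotes the torsion-free functor associated to the pair $(\mathrm{Fac}(\bigoplus_{j\ge k}M_j),(\bigoplus_{j\ge k}M_j)^{\bot})$, with $f_{t+1}(M_t):=M_t$, then $\Delta=\{\Delta_k:=f_{k+1}(M_k)\}_{k\in\mathbb{I}_t}$ is a stratifying system of size $t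$.
   Context: $\mathrm{mod}\,A$ is the category of finitely generated right $A$-modules; $\tau$ is the Auslander–Reiten translation. $M$ is $\tau$-rigid if $\mathrm{Hom}_A(M,\tau M)=0$, and basic if no two of its indecomposable direct summands in a decomposition are isomorphic. $\mathrm{Fac}(X)$ is the class of modules that are epimorphic images of $X^{\oplus n}$ for some $n\in\mathbb{N}$. A torsion-free admissible decomposition of $M$ is a decomposition $M=\bigoplus_{j=1}^tM_j$ into indecomposable modules with $M_i\notin\mathrm{Fac}(\bigoplus_{j>i}M_j)$ for all $i$. $\mathbb{I}_n=\{1,\dots,n\}$ with the natural order. For a class $\mathcal{C}$ of modules (or a single module), $\mathcal{C}^{\bot}=\{X\mid \mathrm{Hom}_A(C,X)=0\ \forall C\in\mathcal{C}\}$, ${}^{\bot}\mathcal{C}=\{X\mid \mathrm{Hom}_A(X,C)=0\ \forall C\in\mathcal{C}\}$, and $\mathsf{T}(\mathcal{C})={}^{\bot}(\mathcal{C}^{\bot})$ is the smallest torsion class containing $\mathcal{C}$. A torsion pair $(\mathcal{T},\mathcal{F})$ is a pair of full subcategories with no non-zero morphisms from $\mathcal{T}$ to $\mathcal{F}$ such that each module $X$ has a (unique up to isomorphism) short exact sequence $0\to t(X)\to X\to f(X)\to0$ with $t(X)\in\mathcal{T}$, $f(X)\in\mathcal{F}$; $f$ is the torsion-free functor. A nested family of torsion pairs indexed by a totally ordered set $G$ is a family $\{(\mathcal{T}_k,\mathcal{F}_k)\}_{k\in G}$ of torsion pairs with $\mathcal{T}_k\supsetneq\mathcal{T}_l$ whenever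 $k<l$. An object $L_\bullet=(L_k)_{k\in G}$ of $\mathrm{Gr}_G(\mathrm{mod}\,A)$ (families of modules indexed by $G$, componentwise morphisms) T-induces a nested family if that family is $\{(\mathsf{T}(\{L_j\mid j\ge k\}),(\{L_j\mid j\ge k\})^{\bot})\}_{k\in G}$. For a nested family $\Gamma=\{(\mathcal{T}_k,\mathcal{F}_k)\}_{k\in G}$, $\mathcal{M}(\Gamma)$ is the full subcategory of $\mathrm{Gr}_G(\mathrm{mod}\,A)$ consisting of zero and the $(M_k)$ such that for all $k$: $M_k\ne0$, $M_k\in\mathcal{T}_k$, and $M_k\notin\mathcal{T}_j$ whenever $j>k$. For $M_\bullet\in\mathcal{M}(\Gamma)$, $\mathfrak{F}_k(M_\bullet)$ is the torsion-free part of $M_k$ with respect to the torsion pair $({}^{\bot}(\bigcap_{j>k}\mathcal{F}_j),\bigcap_{j>k}\mathcal{F}_j)$, where the intersection is $\mathrm{mod}\,A$ if $k$ is the maximum of $G$; for $G=\mathbb{I}_n$ this is $f_{k+1}(M_k)$, with $f_{n+1}(M_n):=M_n$. $\mathcal{M}^{\dagger}(\Gamma)$ is the full subcategory of all non-zero $M_\bullet\in\mathcal{M}(\Gamma)$ with $\mathrm{Ext}^1_A(M_k,\mathfrak{F}_j(M_\bullet))=0$ for all $k\ge j$. A pre-stratifying system indexed by $G$ is a family $\{\Omega_k\}_{k\in G}$ of non-zero modules with $\mathrm{Hom}_A(\Omega_k,\Omega_j)=0$ whenever $k>j$ and $\mathrm{Ext}^1_A(\Omega_k,\Omega_j)=0$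 whenever $k\ge j$; it is a stratifying system if moreover each $\Omega_k$ is indecomposable. Its size is the cardinality of $G$. *)

theory Defs
  imports
    "HOL-Computational_Algebra.Polynomial"
    "HOL-Algebra.AbelCoset"
    "HOL-Algebra.Module"
begin

section \<open>Finite-dimensional algebras and finitely generated right modules\<close>

text \<open>The algebra is the whole type \<open>'a\<close>; \<open>scale\<close> is its structure of a vector space over the
  field \<open>'k\<close>. (The class \<open>ring_1\<close> excludes the zero algebra, over which every module is zero.)\<close>

definition fd_algebra :: "('k::field \<Rightarrow> 'a::ring_1 \<Rightarrow> 'a) \<Rightarrow> bool" where
  "fd_algebra scale \<longleftrightarrow>
     vector_space scale \<and>
     (\<exists>B. finite B \<and> module.span scale B = UNIV) \<and>
     (\<forall>c x y. scale c x * y = scale c (x * y) \<and> x * scale c y = scale c (x * y))"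

text \<open>We reuse the record of HOL-Algebra's modules; its fields \<open>mult\<close> and \<open>one\<close> are junk, as they
  are there. In a right module \<open>a \<odot> x\<close> stands for \<open>x a\<close>, hence the order of the
  factors in \<open>smult_assoc\<close>.\<close>

locale right_module = abelian_group M
  for M :: "('a::ring_1, 'm) module" (structure) +
  assumes smult_closed: "x \<in> carrier M \<Longrightarrow> a \<odot> x \<in> carrier M"
    and smult_l_distr: "x \<in> carrier M \<Longrightarrow> (a + b) \<odot> x = a \<odot> x \<oplus> b \<odot> x"
    and smult_r_distr:
      "\<lbrakk>x \<in> carrier M; y \<in> carrier M\<rbrakk> \<Longrightarrow> a \<odot> (x \<oplus> y) = a \<odot> x \<oplus> a \<odot> y"
    and smult_assoc: "x \<in> carrier M \<Longrightarrow> (a * b) \<odot> x = b \<odot> (a \<odot> x)"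
    and smult_one: "x \<in> carrier M \<Longrightarrow> 1 \<odot> x = x"

definition rsubmodule :: "'m set \<Rightarrow> ('a, 'm) module \<Rightarrow> bool" where
  "rsubmodule U M \<longleftrightarrow>
     subgroup U (add_monoid M) \<and> (\<forall>a. \<forall>x\<in>U. a \<odot>\<^bsub>M\<^esub> x \<in> U)"

definition fin_gen :: "('a, 'm) module \<Rightarrow> bool" where
  "fin_gen M \<longleftrightarrow>
     (\<exists>S. finite S \<and> S \<subseteq> carrier M \<and> (\<forall>U. rsubmodule U M \<and> S \<subseteq> U \<longrightarrow> U = carrier M))"

text \<open>The modules of \<open>mod A\<close> are realised on subsets of a fixed but arbitrary type \<open>'m\<close>. This loses
  nothing as soon as \<open>'m\<close> carries one non-zero module: the algebraically closed field \<open>'k\<close> is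
  infinite, a non-zero module contains a copy of \<open>'k\<close>, and every finitely generated module has
  finite dimension, hence at most as many elements as \<open>'k\<close>. So every finitely generated module is
  isomorphic to one in this class.\<close>

definition modA :: "('a::ring_1, 'm) module set" where
  "modA = {M. right_module M \<and> fin_gen M}"

definition rhom :: "('a, 'm) module \<Rightarrow> ('a, 'n) module \<Rightarrow> ('m \<Rightarrow> 'n) set" where
  "rhom X Y = {h. h \<in> carrier X \<rightarrow> carrier Y \<and>
     (\<forall>x\<in>carrier X. \<forall>y\<in>carrier X. h (x \<oplus>\<^bsub>X\<^esub> y) = h x \<oplus>\<^bsub>Y\<^esub> h y) \<and>
     (\<forall>a. \<forall>x\<in>carrier X. h (a \<odot>\<^bsub>X\<^esub> x) = a \<odot>\<^bsub>Y\<^esub> h x)}"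

definition rker :: "('a, 'm) module \<Rightarrow> ('a, 'n) module \<Rightarrow> ('m \<Rightarrow> 'n) \<Rightarrow> 'm set" where
  "rker X Y h = {x \<in> carrier X. h x = \<zero>\<^bsub>Y\<^esub>}"

definition Hom_zero :: "('a, 'm) module \<Rightarrow> ('a, 'n) module \<Rightarrow> bool" where
  "Hom_zero X Y \<longleftrightarrow> (\<forall>h\<in>rhom X Y. \<forall>x\<in>carrier X. h x = \<zero>\<^bsub>Y\<^esub>)"

definition rmod_iso :: "('a, 'm) module \<Rightarrow> ('a, 'n) module \<Rightarrow> bool" (infix \<open>\<cong>\<^sub>m\<close> 50) where
  "X \<cong>\<^sub>m Y \<longleftrightarrow> (\<exists>h\<in>rhom X Y. bij_betw h (carrier X) (carrier Y))"

definition zero_module :: "('a, 'm) module \<Rightarrow> bool" where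
  "zero_module X \<longleftrightarrow> carrier X = {\<zero>\<^bsub>X\<^esub>}"

text \<open>External direct sum; only used for finite \<open>I\<close>.\<close>

definition dsum :: "'i set \<Rightarrow> ('i \<Rightarrow> ('a, 'm) module) \<Rightarrow> ('a, 'i \<Rightarrow> 'm) module" where
  "dsum I N = \<lparr>
     carrier = (\<Pi>\<^sub>E i\<in>I. carrier (N i)),
     mult = undefined, one = undefined,
     zero = (\<lambda>i\<in>I. \<zero>\<^bsub>N i\<^esub>),
     add = (\<lambda>x y. \<lambda>i\<in>I. x i \<oplus>\<^bsub>N i\<^esub> y i),
     smult = (\<lambda>a x. \<lambda>i\<in>I. a \<odot>\<^bsub>N i\<^esub> x i)\<rparr>"

definition indecomposable :: "('a::ring_1, 'm) module \<Rightarrow> bool" where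
  "indecomposable X \<longleftrightarrow>
     \<not> zero_module X \<and>
     (\<forall>N :: nat \<Rightarrow> ('a, 'm) module.
        N 1 \<in> modA \<and> N 2 \<in> modA \<and> X \<cong>\<^sub>m dsum {1..2} N \<longrightarrow> zero_module (N 1) \<or> zero_module (N 2))"

definition indec_decomposition ::
    "nat \<Rightarrow> (nat \<Rightarrow> ('a::ring_1, 'm) module) \<Rightarrow> ('a, 'm) module \<Rightarrow> bool" where
  "indec_decomposition t N M \<longleftrightarrow>
     (\<forall>j\<in>{1..t}. N j \<in> modA \<and> indecomposable (N j)) \<and> M \<cong>\<^sub>m dsum {1..t} N"

definition basic :: "('a::ring_1, 'm) module \<Rightarrow> bool" where
  "basic M \<longleftrightarrow>
     (\<forall>t (N :: nat \<Rightarrow> ('a, 'm) module). indec_decomposition t N M \<longrightarrow>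
        (\<forall>i\<in>{1..t}. \<forall>j\<in>{1..t}. i \<noteq> j \<longrightarrow> \<not> N i \<cong>\<^sub>m N j))"

definition Fac :: "('a::ring_1, 'x) module \<Rightarrow> ('a, 'm) module set" where
  "Fac X = {Y \<in> modA. \<exists>n::nat. \<exists>p\<in>rhom (dsum {..<n} (\<lambda>_. X)) Y.
              p ` carrier (dsum {..<n} (\<lambda>_. X)) = carrier Y}"

definition tf_admissible_decomposition ::
    "nat \<Rightarrow> (nat \<Rightarrow> ('a::ring_1, 'm) module) \<Rightarrow> ('a, 'm) module \<Rightarrow> bool" where
  "tf_admissible_decomposition t N M \<longleftrightarrow>
     indec_decomposition t N M \<and> (\<forall>i\<in>{1..t}. N i \<notin> Fac (dsum {i<..t} N))"


section \<open>Short exact sequences and vanishing of \<open>Ext\<^sup>1\<close>\<close>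

definition short_exact ::
    "('a, 'm) module \<Rightarrow> ('m \<Rightarrow> 'n) \<Rightarrow> ('a, 'n) module \<Rightarrow> ('n \<Rightarrow> 'p) \<Rightarrow> ('a, 'p) module \<Rightarrow> bool" where
  "short_exact X i E p Y \<longleftrightarrow>
     i \<in> rhom X E \<and> p \<in> rhom E Y \<and> inj_on i (carrier X) \<and>
     i ` carrier X = rker E Y p \<and> p ` carrier E = carrier Y"

text \<open>Yoneda \<open>Ext\<^sup>1(Y,X)\<close> vanishes: every extension of \<open>Y\<close> by \<open>X\<close> is
  equivalent to the split one.\<close>

definition Ext1_zero :: "('a::ring_1, 'm) module \<Rightarrow> ('a, 'm) module \<Rightarrow> bool" where
  "Ext1_zero Y X \<longleftrightarrow>
     (\<forall>(E :: ('a, 'm) module) i p. E \<in> modA \<and> short_exact X i E p Y \<longrightarrow>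
        (\<exists>s\<in>rhom Y E. \<forall>y\<in>carrier Y. p (s y) = y))"


section \<open>The Auslander--Reiten translation\<close>

definition projective :: "('a::ring_1, 'm) module \<Rightarrow> bool" where
  "projective P \<longleftrightarrow> P \<in> modA \<and>
     (\<forall>(X :: ('a, 'm) module) (Y :: ('a, 'm) module). X \<in> modA \<and> Y \<in> modA \<longrightarrow>
        (\<forall>p\<in>rhom X Y. \<forall>h\<in>rhom P Y. p ` carrier X = carrier Y \<longrightarrow>
           (\<exists>h'\<in>rhom P X. \<forall>x\<in>carrier P. p (h' x) = h x)))"

definition superfluous :: "'m set \<Rightarrow> ('a, 'm) module \<Rightarrow> bool" where
  "superfluous K P \<longleftrightarrow> rsubmodule K P \<and>
     (\<forall>U. rsubmodule U P \<and> U <+>\<^bsub>P\<^esub> K = carrier P \<longrightarrow> U = carrier P)"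

text \<open>\<open>P1 \<rightarrow> P0 \<rightarrow> M \<rightarrow> 0\<close> exact, where \<open>P0 \<rightarrow> M\<close> and \<open>P1 \<rightarrow> Ker g\<close> are projective covers.\<close>

definition minimal_projective_presentation ::
    "('a::ring_1, 'm) module \<Rightarrow> ('m \<Rightarrow> 'm) \<Rightarrow> ('a, 'm) module \<Rightarrow> ('m \<Rightarrow> 'm) \<Rightarrow> ('a, 'm) module \<Rightarrow> bool"
  where
  "minimal_projective_presentation P1 f P0 g M \<longleftrightarrow>
     projective P1 \<and> projective P0 \<and> f \<in> rhom P1 P0 \<and> g \<in> rhom P0 M \<and>
     g ` carrier P0 = carrier M \<and> f ` carrier P1 = rker P0 M g \<and>
     superfluous (rker P0 M g) P0 \<and> superfluous (rker P1 P0 f) P1"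

definition regular_module :: "('a::ring_1, 'a) module" where
  "regular_module = \<lparr>
     carrier = UNIV, mult = undefined, one = undefined, zero = 0, add = (+),
     smult = (\<lambda>a x. x * a)\<rparr>"

text \<open>\<open>Hom\<^sub>A(P,A)\<close>, a left module: here \<open>a \<odot> h\<close> is \<open>a h\<close>.\<close>

definition A_dual :: "('a::ring_1, 'm) module \<Rightarrow> ('a, 'm \<Rightarrow> 'a) module" where
  "A_dual P = \<lparr>
     carrier = rhom P regular_module \<inter> extensional (carrier P),
     mult = undefined, one = undefined,
     zero = (\<lambda>x\<in>carrier P. 0),
     add = (\<lambda>h h'. \<lambda>x\<in>carrier P. h x + h' x),
     smult = (\<lambda>a h. \<lambda>x\<in>carrier P. a * h x)\<rparr>"

definition quot_module :: "('a, 'm) module \<Rightarrow> 'm set \<Rightarrow> ('a, 'm set) module" where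
  "quot_module X U = \<lparr>
     carrier = a_rcosets\<^bsub>X\<^esub> U,
     mult = undefined, one = undefined,
     zero = U,
     add = (<+>\<^bsub>X\<^esub>),
     smult = (\<lambda>a C. \<Union>x\<in>C. U +>\<^bsub>X\<^esub> (a \<odot>\<^bsub>X\<^esub> x))\<rparr>"

text \<open>The cokernel of \<open>Hom(f,A) : Hom(P0,A) \<rightarrow> Hom(P1,A)\<close>, again a left module.\<close>

definition transpose_module ::
    "('a::ring_1, 'm) module \<Rightarrow> ('m \<Rightarrow> 'm) \<Rightarrow> ('a, 'm) module \<Rightarrow> ('a, ('m \<Rightarrow> 'a) set) module" where
  "transpose_module P1 f P0 =
     quot_module (A_dual P1) ((\<lambda>h. compose (carrier P1) h f) ` carrier (A_dual P0))"

text \<open>The dual \<open>D X = Hom\<^sub>k(X,k)\<close> of a left module \<open>X\<close>, with right action \<open>(\<phi> a) x = \<phi> (a x)\<close>.\<close>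

definition k_dual ::
    "('k::field \<Rightarrow> 'a::ring_1 \<Rightarrow> 'a) \<Rightarrow> ('a, 'x) module \<Rightarrow> ('a, 'x \<Rightarrow> 'k) module" where
  "k_dual scale X = \<lparr>
     carrier = {\<phi> \<in> extensional (carrier X).
       (\<forall>x\<in>carrier X. \<forall>y\<in>carrier X. \<phi> (x \<oplus>\<^bsub>X\<^esub> y) = \<phi> x + \<phi> y) \<and>
       (\<forall>c. \<forall>x\<in>carrier X. \<phi> (scale c 1 \<odot>\<^bsub>X\<^esub> x) = c * \<phi> x)},
     mult = undefined, one = undefined,
     zero = (\<lambda>x\<in>carrier X. 0),
     add = (\<lambda>\<phi> \<psi>. \<lambda>x\<in>carrier X. \<phi> x + \<psi> x),
     smult = (\<lambda>a \<phi>. \<lambda>x\<in>carrier X. \<phi> (a \<odot>\<^bsub>X\<^esub> x))\<rparr>"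

text \<open>\<open>N\<close> is a realisation of \<open>\<tau> M = D Tr M\<close>, which is only determined up to isomorphism, since
  it depends on the choice of the minimal projective presentation.\<close>

definition is_AR_translate ::
    "('k::field \<Rightarrow> 'a::ring_1 \<Rightarrow> 'a) \<Rightarrow> ('a, 'm) module \<Rightarrow>
     ('a, ('m \<Rightarrow> 'a) set \<Rightarrow> 'k) module \<Rightarrow> bool" where
  "is_AR_translate scale M N \<longleftrightarrow>
     (\<exists>P1 f P0 g. minimal_projective_presentation P1 f P0 g M \<and>
        N = k_dual scale (transpose_module P1 f P0))"

definition tau_rigid :: "('k::field \<Rightarrow> 'a::ring_1 \<Rightarrow> 'a) \<Rightarrow> ('a, 'm) module \<Rightarrow> bool" where
  "tau_rigid scale M \<longleftrightarrow> (\<exists>N. is_AR_translate scale M N \<and> Hom_zero M N)"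


section \<open>Torsion pairs\<close>

definition rperp :: "('a::ring_1, 'x) module set \<Rightarrow> ('a, 'm) module set" where
  "rperp C = {X \<in> modA. \<forall>Y\<in>C. Hom_zero Y X}"

definition lperp :: "('a::ring_1, 'x) module set \<Rightarrow> ('a, 'm) module set" where
  "lperp C = {X \<in> modA. \<forall>Y\<in>C. Hom_zero X Y}"

definition Tors :: "('a::ring_1, 'm) module set \<Rightarrow> ('a, 'm) module set" where
  "Tors C = lperp (rperp C :: ('a, 'm) module set)"

type_synonym ('a, 'm) mod_class_pair = "('a, 'm) module set \<times> ('a, 'm) module set"

definition replete :: "('a::ring_1, 'm) module set \<Rightarrow> bool" where
  "replete C \<longleftrightarrow> C \<subseteq> modA \<and> (\<forall>X\<in>C. \<forall>Y\<in>modA. X \<cong>\<^sub>m Y \<longrightarrow> Y \<in> C)"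

definition canonical_seq ::
    "('a, 'm) mod_class_pair \<Rightarrow> ('a, 'm) module \<Rightarrow>
     ('a, 'm) module \<Rightarrow> ('m \<Rightarrow> 'm) \<Rightarrow> ('m \<Rightarrow> 'm) \<Rightarrow> ('a, 'm) module \<Rightarrow> bool" where
  "canonical_seq TF X S i p Q \<longleftrightarrow> S \<in> fst TF \<and> Q \<in> snd TF \<and> short_exact S i X p Q"

definition torsion_pair :: "('a::ring_1, 'm) mod_class_pair \<Rightarrow> bool" where
  "torsion_pair TF \<longleftrightarrow>
     replete (fst TF) \<and> replete (snd TF) \<and>
     (\<forall>X\<in>fst TF. \<forall>Y\<in>snd TF. Hom_zero X Y) \<and>
     (\<forall>X\<in>modA. \<exists>S i p Q. canonical_seq TF X S i p Q) \<and>
     (\<forall>X\<in>modA. \<forall>S i p Q S' i' p' Q'.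
        canonical_seq TF X S i p Q \<and> canonical_seq TF X S' i' p' Q' \<longrightarrow>
        (\<exists>\<alpha>\<in>rhom S S'. \<exists>\<beta>\<in>rhom Q Q'.
           bij_betw \<alpha> (carrier S) (carrier S') \<and> bij_betw \<beta> (carrier Q) (carrier Q') \<and>
           (\<forall>x\<in>carrier S. i' (\<alpha> x) = i x) \<and> (\<forall>x\<in>carrier X. \<beta> (p x) = p' x)))"

text \<open>The value \<open>f(X)\<close> of the torsion-free functor; it is determined up to isomorphism only,
  whence the choice.\<close>

definition tfree :: "('a, 'm) mod_class_pair \<Rightarrow> ('a, 'm) module \<Rightarrow> ('a, 'm) module" where
  "tfree TF X = (SOME Q. \<exists>S i p. canonical_seq TF X S i p Q)"


section \<open>Nested families and stratifying systems\<close>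

text \<open>The totally ordered index set \<open>G\<close> is a subset of a linearly ordered type. Families indexed by
  \<open>G\<close> are functions on that type whose values outside \<open>G\<close> are irrelevant.\<close>

definition Gr :: "'i set \<Rightarrow> ('i \<Rightarrow> ('a::ring_1, 'm) module) set" where
  "Gr G = {L. \<forall>k\<in>G. L k \<in> modA}"

definition nested_family ::
    "'i::linorder set \<Rightarrow> ('i \<Rightarrow> ('a::ring_1, 'm) mod_class_pair) \<Rightarrow> bool" where
  "nested_family G \<Gamma> \<longleftrightarrow>
     (\<forall>k\<in>G. torsion_pair (\<Gamma> k)) \<and>
     (\<forall>k\<in>G. \<forall>l\<in>G. k < l \<longrightarrow> fst (\<Gamma> l) \<subset> fst (\<Gamma> k))"

definition T_induces ::
    "'i::linorder set \<Rightarrow> ('i \<Rightarrow> ('a::ring_1, 'm) module) \<Rightarrow>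
     ('i \<Rightarrow> ('a, 'm) mod_class_pair) \<Rightarrow> bool" where
  "T_induces G L \<Gamma> \<longleftrightarrow>
     L \<in> Gr G \<and> nested_family G \<Gamma> \<and>
     (\<forall>k\<in>G. \<Gamma> k = (Tors {L j | j. j \<in> G \<and> k \<le> j}, rperp {L j | j. j \<in> G \<and> k \<le> j}))"

definition calM ::
    "'i::linorder set \<Rightarrow> ('i \<Rightarrow> ('a::ring_1, 'm) mod_class_pair) \<Rightarrow>
     ('i \<Rightarrow> ('a, 'm) module) set" where
  "calM G \<Gamma> = {L \<in> Gr G.
     (\<forall>k\<in>G. zero_module (L k)) \<or>
     (\<forall>k\<in>G. \<not> zero_module (L k) \<and> L k \<in> fst (\<Gamma> k) \<and>
        (\<forall>j\<in>G. k < j \<longrightarrow> L k \<notin> fst (\<Gamma> j)))}"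

definition tf_above ::
    "'i::linorder set \<Rightarrow> ('i \<Rightarrow> ('a::ring_1, 'm) mod_class_pair) \<Rightarrow> 'i \<Rightarrow> ('a, 'm) module set" where
  "tf_above G \<Gamma> k = modA \<inter> (\<Inter>j\<in>{j\<in>G. k < j}. snd (\<Gamma> j))"

definition frakF ::
    "'i::linorder set \<Rightarrow> ('i \<Rightarrow> ('a::ring_1, 'm) mod_class_pair) \<Rightarrow>
     ('i \<Rightarrow> ('a, 'm) module) \<Rightarrow> 'i \<Rightarrow> ('a, 'm) module" where
  "frakF G \<Gamma> L k = tfree (lperp (tf_above G \<Gamma> k), tf_above G \<Gamma> k) (L k)"

definition calM_dagger ::
    "'i::linorder set \<Rightarrow> ('i \<Rightarrow> ('a::ring_1, 'm) mod_class_pair) \<Rightarrow>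
     ('i \<Rightarrow> ('a, 'm) module) set" where
  "calM_dagger G \<Gamma> = {L \<in> calM G \<Gamma>.
     \<not> (\<forall>k\<in>G. zero_module (L k)) \<and>
     (\<forall>k\<in>G. \<forall>j\<in>G. j \<le> k \<longrightarrow> Ext1_zero (L k) (frakF G \<Gamma> L j))}"

definition pre_stratifying_system ::
    "'i::linorder set \<Rightarrow> ('i \<Rightarrow> ('a::ring_1, 'm) module) \<Rightarrow> bool" where
  "pre_stratifying_system G \<Omega> \<longleftrightarrow>
     (\<forall>k\<in>G. \<Omega> k \<in> modA \<and> \<not> zero_module (\<Omega> k)) \<and>
     (\<forall>k\<in>G. \<forall>j\<in>G. j < k \<longrightarrow> Hom_zero (\<Omega> k) (\<Omega> j)) \<and>
     (\<forall>k\<in>G. \<forall>j\<in>G. j \<le> k \<longrightarrow> Ext1_zero (\<Omega> k) (\<Omega> j))"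

definition stratifying_system ::
    "'i::linorder set \<Rightarrow> ('i \<Rightarrow> ('a::ring_1, 'm) module) \<Rightarrow> bool" where
  "stratifying_system G \<Omega> \<longleftrightarrow>
     pre_stratifying_system G \<Omega> \<and> (\<forall>k\<in>G. indecomposable (\<Omega> k))"

text \<open>For \<open>L\<close> indexed by \<open>{1..r}\<close>: the pairs \<open>(Fac(\<Oplus>\<^sub>j\<^sub>\<ge>\<^sub>k L\<^sub>j), (\<Oplus>\<^sub>j\<^sub>\<ge>\<^sub>k L\<^sub>j)\<^sup>\<bottom>)\<close> and the modules
  \<open>f\<^sub>k\<^sub>+\<^sub>1(L\<^sub>k)\<close> with \<open>f\<^sub>r\<^sub>+\<^sub>1(L\<^sub>r) = L\<^sub>r\<close>.\<close>

definition Fac_family ::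
    "nat \<Rightarrow> (nat \<Rightarrow> ('a::ring_1, 'm) module) \<Rightarrow> nat \<Rightarrow> ('a, 'm) mod_class_pair" where
  "Fac_family r L k = (Fac (dsum {k..r} L), rperp {dsum {k..r} L})"

definition tf_parts ::
    "nat \<Rightarrow> (nat \<Rightarrow> ('a::ring_1, 'm) module) \<Rightarrow> nat \<Rightarrow> ('a, 'm) module" where
  "tf_parts r L k = (if k = r then L r else tfree (Fac_family r L (k + 1)) (L k))"

end

theory Submission
  imports Defs "HOL-Library.Function_Algebras"
begin

text \<open>Let \<open>P1 \<rightarrow> P0 \<rightarrow> M \<rightarrow> 0\<close> be the minimal presentation. If \<open>Hom(K, \<tau>M) = 0\<close>, then every map
  \<open>P1 \<rightarrow> K\<close> factors through \<open>P1 \<rightarrow> P0\<close>. For \<open>\<tau>\<close>-rigid \<open>M\<close> this applies to every \<open>K\<close> generated by \<open>M\<close>, so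
  maps from \<open>M\<close>, and hence from its summands, lift along every epimorphism whose kernel is generated
  by \<open>M\<close>. The statements follow from this lifting property: lifting maps from a summand \<open>X\<close> along the
  quotient of a module by its trace of \<open>X\<close> gives the torsion pair \<open>(Fac X, X\<^sup>\<bottom>)\<close>, lifting identities
  gives the vanishing of \<open>Ext\<^sup>1\<close>, and lifting endomorphisms of \<open>f(M\<^sub>j)\<close> to \<open>M\<^sub>j\<close>, where Fitting's
  lemma applies, gives indecomposability.\<close>

section \<open>Modules and homomorphisms\<close>

text \<open>The modules of \<open>modA\<close> live on one type \<open>'m\<close>, while direct
  sums, the free modules \<open>A^n\<close> and \<tau>M live on function types. Hence
  \<open>generates\<close> and \<open>Hom_zero\<close> relate modules on different types, and
  \<open>lifting\<close> leaves the type of the lifted module free. Projectivity, however, is tested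
  on modules over \<open>'m\<close> only. To split a free cover of a projective module, the free
  module is copied to \<open>'m\<close>: a non-zero module embeds the field into \<open>'m\<close>,
  an algebraically closed field is infinite, and so \<open>A^n\<close> has no more elements than the
  field. Dimension is replaced by a bounded, strictly increasing rank on submodules, the dimension
  of the preimage in a free cover. It yields the finite generation of submodules, without which the
  torsion part of a module need not lie in \<open>modA\<close>, and the extremal choice behind
  Fitting's lemma.\<close>

lemma right_moduleI:
  fixes M :: "('a::ring_1, 'm) module" (structure)
  assumes "\<And>x y. \<lbrakk>x \<in> carrier M; y \<in> carrier M\<rbrakk> \<Longrightarrow> x \<oplus> y \<in> carrier M"
    and "\<zero> \<in> carrier M"
    and "\<And>x y z. \<lbrakk>x \<in> carrier M; y \<in> carrier M; z \<in> carrier M\<rbrakk> \<Longrightarrow> (x \<oplus> y) \<oplus> z = x \<oplus> (y \<oplus> z)"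
    and "\<And>x y. \<lbrakk>x \<in> carrier M; y \<in> carrier M\<rbrakk> \<Longrightarrow> x \<oplus> y = y \<oplus> x"
    and "\<And>x. x \<in> carrier M \<Longrightarrow> \<zero> \<oplus> x = x"
    and closed: "\<And>a x. x \<in> carrier M \<Longrightarrow> a \<odot> x \<in> carrier M"
    and distr: "\<And>a b x. x \<in> carrier M \<Longrightarrow> (a + b) \<odot> x = a \<odot> x \<oplus> b \<odot> x"
    and "\<And>a x y. \<lbrakk>x \<in> carrier M; y \<in> carrier M\<rbrakk> \<Longrightarrow> a \<odot> (x \<oplus> y) = a \<odot> x \<oplus> a \<odot> y"
    and "\<And>a b x. x \<in> carrier M \<Longrightarrow> (a * b) \<odot> x = b \<odot> (a \<odot> x)"
    and one: "\<And>x. x \<in> carrier M \<Longrightarrow> 1 \<odot> x = x"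
    and nil: "\<And>x. x \<in> carrier M \<Longrightarrow> 0 \<odot> x = \<zero>"
  shows "right_module M"
proof -
  \<comment> \<open>Inverses are not among the assumptions: since \<open>(- 1) + 1 = 0\<close> and
    \<open>0 \<odot> x = \<zero>\<close>, the element \<open>(- 1) \<odot> x\<close> is one.\<close>
  have "\<exists>y\<in>carrier M. y \<oplus> x = \<zero>" if "x \<in> carrier M" for x
    using distr[OF that, of "-1" 1] one[OF that] nil[OF that] closed[OF that, of "-1"] by auto
  then have "abelian_group M"
    by (intro abelian_groupI) (use assms in auto)
  then show ?thesis
    unfolding right_module_def right_module_axioms_def using assms by auto
qed

context right_module
begin

lemma smult_zero_right [simp]: "a \<odot> \<zero> = \<zero>"
  using smult_r_distr[of \<zero> \<zero> a] smult_closed[of \<zero> a] by simp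

lemma smult_zero_left [simp]: "x \<in> carrier M \<Longrightarrow> 0 \<odot> x = \<zero>"
  using smult_l_distr[of x 0 0] smult_closed[of x 0]
  by simp

lemma smult_neg_left: "x \<in> carrier M \<Longrightarrow> (- a) \<odot> x = \<ominus> (a \<odot> x)"
  using smult_l_distr[of x "- a" a] smult_closed[of x] by (metis add.left_inverse minus_equality smult_zero_left)

lemma neg_eq_smult: "x \<in> carrier M \<Longrightarrow> \<ominus> x = (- 1) \<odot> x"
  by (simp add: smult_neg_left smult_one)

lemma diff_add_diff:
  "\<lbrakk>x \<in> carrier M; y \<in> carrier M; z \<in> carrier M\<rbrakk> \<Longrightarrow> (x \<ominus> z) \<oplus> (z \<ominus> y) = x \<ominus> y"
  by (simp add: a_minus_def a_assoc r_neg1)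

lemma neg_diff: "\<lbrakk>x \<in> carrier M; y \<in> carrier M\<rbrakk> \<Longrightarrow> \<ominus> (x \<ominus> y) = y \<ominus> x"
  by (simp add: a_minus_def minus_add a_comm)

lemma diff_zero [simp]: "x \<in> carrier M \<Longrightarrow> x \<ominus> \<zero> = x"
  by (simp add: a_minus_def)

lemma rsubmoduleI:
  assumes "U \<subseteq> carrier M" "\<zero> \<in> U" "\<And>x y. x \<in> U \<Longrightarrow> y \<in> U \<Longrightarrow> x \<oplus> y \<in> U"
    and "\<And>a x. x \<in> U \<Longrightarrow> a \<odot> x \<in> U"
  shows "rsubmodule U M"
  unfolding rsubmodule_def
proof
  show "subgroup U (add_monoid M)"
  proof (rule subgroup.intro)
    fix x assume "x \<in> U"
    then have "\<ominus> x \<in> U" using assms neg_eq_smult by auto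
    then show "inv\<^bsub>add_monoid M\<^esub> x \<in> U" by (simp add: a_inv_def)
  qed (use assms in auto)
qed (use assms in auto)

end

section \<open>Submodules\<close>

lemma rsubmoduleD:
  assumes "rsubmodule U M"
  shows rsubmodule_subset: "U \<subseteq> carrier M"
    and rsubmodule_zero: "\<zero>\<^bsub>M\<^esub> \<in> U"
    and rsubmodule_add: "\<And>x y. x \<in> U \<Longrightarrow> y \<in> U \<Longrightarrow> x \<oplus>\<^bsub>M\<^esub> y \<in> U"
    and rsubmodule_smult: "\<And>a x. x \<in> U \<Longrightarrow> a \<odot>\<^bsub>M\<^esub> x \<in> U"
    and rsubmodule_neg: "\<And>x. x \<in> U \<Longrightarrow> \<ominus>\<^bsub>M\<^esub> x \<in> U"
  using assms subgroup.subset[of U "add_monoid M"] subgroup.one_closed[of U "add_monoid M"]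
    subgroup.m_closed[of U "add_monoid M"] subgroup.m_inv_closed[of U "add_monoid M"]
  by (auto simp: rsubmodule_def a_inv_def)

lemma rsubmodule_minus:
  "\<lbrakk>rsubmodule U M; x \<in> U; y \<in> U\<rbrakk> \<Longrightarrow> x \<ominus>\<^bsub>M\<^esub> y \<in> U"
  by (simp add: a_minus_def rsubmodule_add rsubmodule_neg)

lemma rsubmodule_Inter:
  assumes "right_module M" "\<And>U. U \<in> C \<Longrightarrow> rsubmodule U M" "C \<noteq> {}"
  shows "rsubmodule (\<Inter>C) M"
proof -
  interpret right_module M by fact
  note D = rsubmoduleD[OF assms(2)]
  show ?thesis
  proof (rule rsubmoduleI)
    show "\<Inter>C \<subseteq> carrier M" using assms(3) D(1) by auto
  qed (use D(2-4) in auto)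
qed

text \<open>Shrinking the carrier keeps a submodule on the type of the ambient module, so it can
  itself be a member of \<open>modA\<close> on that type.\<close>

definition rsub :: "('a, 'm) module \<Rightarrow> 'm set \<Rightarrow> ('a, 'm) module" where
  "rsub M U = M\<lparr>carrier := U\<rparr>"

lemma rsub_simps [simp]:
  "carrier (rsub M U) = U" "\<zero>\<^bsub>rsub M U\<^esub> = \<zero>\<^bsub>M\<^esub>"
  "x \<oplus>\<^bsub>rsub M U\<^esub> y = x \<oplus>\<^bsub>M\<^esub> y" "a \<odot>\<^bsub>rsub M U\<^esub> x = a \<odot>\<^bsub>M\<^esub> x"
  by (simp_all add: rsub_def)

lemma right_module_rsub:
  assumes "right_module M" "rsubmodule U M"
  shows "right_module (rsub M U)"
proof -
  interpret right_module M by fact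
  have sub: "\<And>x. x \<in> U \<Longrightarrow> x \<in> carrier M" using rsubmodule_subset[OF assms(2)] by auto
  show ?thesis
    by (intro right_moduleI)
      (auto simp: sub rsubmoduleD[OF assms(2)] a_ac smult_l_distr smult_r_distr smult_assoc smult_one)
qed

lemma rsubmodule_rsub:
  assumes "rsubmodule U M" "right_module M"
  shows "rsubmodule V (rsub M U) \<longleftrightarrow> rsubmodule V M \<and> V \<subseteq> U"
proof -
  interpret right_module M by fact
  interpret U: right_module "rsub M U" using right_module_rsub assms by blast
  show ?thesis
  proof
    assume V: "rsubmodule V (rsub M U)"
    then have "V \<subseteq> U" using rsubmodule_subset by force
    moreover have "rsubmodule V M"
      using rsubmoduleD[OF V] rsubmodule_subset[OF assms(1)] by (intro rsubmoduleI) auto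
    ultimately show "rsubmodule V M \<and> V \<subseteq> U" by auto
  next
    assume "rsubmodule V M \<and> V \<subseteq> U"
    then show "rsubmodule V (rsub M U)"
      using rsubmoduleD[of V M] by (intro U.rsubmoduleI) auto
  qed
qed

section \<open>Homomorphisms, images and kernels\<close>

lemma rhomI:
  assumes "\<And>x. x \<in> carrier X \<Longrightarrow> h x \<in> carrier Y"
    and "\<And>x y. x \<in> carrier X \<Longrightarrow> y \<in> carrier X \<Longrightarrow> h (x \<oplus>\<^bsub>X\<^esub> y) = h x \<oplus>\<^bsub>Y\<^esub> h y"
    and "\<And>a x. x \<in> carrier X \<Longrightarrow> h (a \<odot>\<^bsub>X\<^esub> x) = a \<odot>\<^bsub>Y\<^esub> h x"
  shows "h \<in> rhom X Y"
  using assms by (auto simp: rhom_def)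

lemma rhomD:
  assumes "h \<in> rhom X Y"
  shows rhom_closed: "\<And>x. x \<in> carrier X \<Longrightarrow> h x \<in> carrier Y"
    and rhom_plus: "\<And>x y. x \<in> carrier X \<Longrightarrow> y \<in> carrier X \<Longrightarrow> h (x \<oplus>\<^bsub>X\<^esub> y) = h x \<oplus>\<^bsub>Y\<^esub> h y"
    and rhom_smult: "\<And>a x. x \<in> carrier X \<Longrightarrow> h (a \<odot>\<^bsub>X\<^esub> x) = a \<odot>\<^bsub>Y\<^esub> h x"
  using assms by (auto simp: rhom_def)

lemma rhom_zero:
  assumes "h \<in> rhom X Y" "right_module X" "right_module Y"
  shows "h \<zero>\<^bsub>X\<^esub> = \<zero>\<^bsub>Y\<^esub>"
proof -
  interpret X: right_module X by fact
  interpret Y: right_module Y by fact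
  have "h (0 \<odot>\<^bsub>X\<^esub> \<zero>\<^bsub>X\<^esub>) = 0 \<odot>\<^bsub>Y\<^esub> h \<zero>\<^bsub>X\<^esub>" using rhom_smult[OF assms(1)] by blast
  then show ?thesis using rhom_closed[OF assms(1)] by simp
qed

lemma rhom_neg:
  assumes "h \<in> rhom X Y" "right_module X" "right_module Y" "x \<in> carrier X"
  shows "h (\<ominus>\<^bsub>X\<^esub> x) = \<ominus>\<^bsub>Y\<^esub> h x"
proof -
  interpret X: right_module X by fact
  interpret Y: right_module Y by fact
  show ?thesis using rhomD[OF assms(1)] assms(4) by (simp add: X.neg_eq_smult Y.neg_eq_smult)
qed

lemma rhom_diff:
  assumes "h \<in> rhom X Y" "right_module X" "right_module Y" "x \<in> carrier X" "y \<in> carrier X"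
  shows "h (x \<ominus>\<^bsub>X\<^esub> y) = h x \<ominus>\<^bsub>Y\<^esub> h y"
proof -
  interpret X: right_module X by fact
  show ?thesis using assms rhom_plus[OF assms(1)] rhom_neg[OF assms(1)] by (simp add: a_minus_def)
qed

lemma rhom_comp: "\<lbrakk>g \<in> rhom X Y; h \<in> rhom Y Z\<rbrakk> \<Longrightarrow> (\<lambda>x. h (g x)) \<in> rhom X Z"
  by (intro rhomI) (auto simp: rhomD)

lemma rhom_id: "(\<lambda>x. x) \<in> rhom X X"
  by (auto intro!: rhomI)

lemma rhom_const_zero: "right_module Y \<Longrightarrow> (\<lambda>_. \<zero>\<^bsub>Y\<^esub>) \<in> rhom X Y"
proof -
  assume "right_module Y"
  then interpret right_module Y .
  show ?thesis by (auto intro!: rhomI)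
qed

lemma rhom_add:
  assumes "g \<in> rhom X Y" "h \<in> rhom X Y" "right_module Y"
  shows "(\<lambda>x. g x \<oplus>\<^bsub>Y\<^esub> h x) \<in> rhom X Y"
proof -
  interpret right_module Y by fact
  show ?thesis
    using rhomD[OF assms(1)] rhomD[OF assms(2)]
    by (intro rhomI) (auto simp: smult_r_distr a_ac)
qed

lemma rhom_minus:
  assumes "g \<in> rhom X Y" "h \<in> rhom X Y" "right_module Y"
  shows "(\<lambda>x. g x \<ominus>\<^bsub>Y\<^esub> h x) \<in> rhom X Y"
proof -
  interpret right_module Y by fact
  have "(\<lambda>x. \<ominus>\<^bsub>Y\<^esub> h x) \<in> rhom X Y"
    using rhomD[OF assms(2)]
    by (intro rhomI)
      (auto simp: minus_add neg_eq_smult smult_r_distr smult_closed simp flip: smult_assoc)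
  then show ?thesis using rhom_add[OF assms(1) _ assms(3)] by (simp add: a_minus_def)
qed

lemma rhom_rsub_dom: "\<lbrakk>h \<in> rhom X Y; U \<subseteq> carrier X\<rbrakk> \<Longrightarrow> h \<in> rhom (rsub X U) Y"
  by (intro rhomI) (auto simp: rhomD subset_iff)

lemma rhom_rsub_cod: "\<lbrakk>h \<in> rhom X Y; h ` carrier X \<subseteq> U\<rbrakk> \<Longrightarrow> h \<in> rhom X (rsub Y U)"
  by (intro rhomI) (auto simp: rhomD)

lemma rhom_rsub_codD: "\<lbrakk>h \<in> rhom X (rsub Y U); U \<subseteq> carrier Y\<rbrakk> \<Longrightarrow> h \<in> rhom X Y"
  by (intro rhomI) (use rhomD[of h X "rsub Y U"] in auto)

lemma rsub_inclusion: "U \<subseteq> carrier X \<Longrightarrow> (\<lambda>x. x) \<in> rhom (rsub X U) X"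
  by (intro rhomI) auto

lemma rsubmodule_preimage:
  assumes "h \<in> rhom X Y" "right_module X" "right_module Y" "rsubmodule U Y"
  shows "rsubmodule {x \<in> carrier X. h x \<in> U} X"
proof -
  interpret right_module X by fact
  show ?thesis
    using rhomD[OF assms(1)] rsubmoduleD[OF assms(4)] rhom_zero[OF assms(1-3)]
    by (intro rsubmoduleI) (auto simp: smult_closed)
qed

lemma rsubmodule_image:
  assumes "h \<in> rhom X Y" "right_module X" "right_module Y" "rsubmodule U X"
  shows "rsubmodule (h ` U) Y"
proof -
  interpret right_module Y by fact
  note U = rsubmoduleD[OF assms(4)] and h = rhomD[OF assms(1)]
  show ?thesis
  proof (rule rsubmoduleI)
    show "h ` U \<subseteq> carrier Y" using U(1) h(1) by auto
    show "\<zero>\<^bsub>Y\<^esub> \<in> h ` U" using U(2) rhom_zero[OF assms(1-3)] by (metis image_eqI)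
    fix x y assume "x \<in> h ` U" "y \<in> h ` U"
    then obtain u v where "u \<in> U" "v \<in> U" "x = h u" "y = h v" by auto
    then have "x \<oplus>\<^bsub>Y\<^esub> y = h (u \<oplus>\<^bsub>X\<^esub> v)" "u \<oplus>\<^bsub>X\<^esub> v \<in> U" using U h(2)[of u v] by (auto simp: subset_iff)
    then show "x \<oplus>\<^bsub>Y\<^esub> y \<in> h ` U" by auto
  next
    fix a x assume "x \<in> h ` U"
    then obtain u where "u \<in> U" "x = h u" by auto
    then have "a \<odot>\<^bsub>Y\<^esub> x = h (a \<odot>\<^bsub>X\<^esub> u)" "a \<odot>\<^bsub>X\<^esub> u \<in> U" using U h(3)[of u a] by (auto simp: subset_iff)
    then show "a \<odot>\<^bsub>Y\<^esub> x \<in> h ` U" by auto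
  qed
qed

lemma rsubmodule_zero_set: "right_module X \<Longrightarrow> rsubmodule {\<zero>\<^bsub>X\<^esub>} X"
proof -
  assume "right_module X"
  then interpret right_module X .
  show ?thesis by (intro rsubmoduleI) auto
qed

lemma rsubmodule_carrier: "right_module X \<Longrightarrow> rsubmodule (carrier X) X"
proof -
  assume "right_module X"
  then interpret right_module X .
  show ?thesis by (intro rsubmoduleI) (auto simp: smult_closed)
qed

lemma rsubmodule_rker:
  assumes "h \<in> rhom X Y" "right_module X" "right_module Y"
  shows "rsubmodule (rker X Y h) X"
  using rsubmodule_preimage[OF assms rsubmodule_zero_set[OF assms(3)]] by (simp add: rker_def)

lemma rsubmodule_range:
  assumes "h \<in> rhom X Y" "right_module X" "right_module Y"
  shows "rsubmodule (h ` carrier X) Y"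
  using rsubmodule_image[OF assms rsubmodule_carrier[OF assms(2)]] .

lemma right_module_diff_zero_iff:
  assumes "right_module X" "x \<in> carrier X" "y \<in> carrier X"
  shows "x \<ominus>\<^bsub>X\<^esub> y = \<zero>\<^bsub>X\<^esub> \<longleftrightarrow> x = y"
proof -
  interpret right_module X by fact
  show ?thesis
    using assms(2,3) by (metis a_minus_def add.inv_closed add.r_inv minus_equality minus_minus)
qed

lemma rhom_inj_onI:
  assumes "h \<in> rhom X Y" "right_module X" "right_module Y" "rker X Y h = {\<zero>\<^bsub>X\<^esub>}"
  shows "inj_on h (carrier X)"
proof (rule inj_onI)
  interpret X: right_module X by fact
  fix x y assume xy: "x \<in> carrier X" "y \<in> carrier X" "h x = h y"
  then have "h (x \<ominus>\<^bsub>X\<^esub> y) = \<zero>\<^bsub>Y\<^esub>"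
    using rhom_diff[OF assms(1-3)] right_module_diff_zero_iff[OF assms(3)] rhom_closed[OF assms(1)] by simp
  then have "x \<ominus>\<^bsub>X\<^esub> y \<in> rker X Y h" using xy by (simp add: rker_def)
  then show "x = y" using assms(4) right_module_diff_zero_iff[OF assms(2)] xy by auto
qed

section \<open>Isomorphisms and zero modules\<close>

lemma rhom_inv_into:
  assumes "h \<in> rhom X Y" "bij_betw h (carrier X) (carrier Y)" "right_module X"
  shows "inv_into (carrier X) h \<in> rhom Y X"
proof -
  interpret X: right_module X by fact
  note b = bij_betw_inv_into_right[OF assms(2)] bij_betw_inv_into_left[OF assms(2)]
  have c: "inv_into (carrier X) h y \<in> carrier X" if "y \<in> carrier Y" for y
    using that assms(2) by (metis bij_betw_def inv_into_into)
  show ?thesis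
  proof (rule rhomI)
    fix x y assume xy: "x \<in> carrier Y" "y \<in> carrier Y"
    have "h (inv_into (carrier X) h x \<oplus>\<^bsub>X\<^esub> inv_into (carrier X) h y) = x \<oplus>\<^bsub>Y\<^esub> y"
      using xy c b by (simp add: rhomD[OF assms(1)])
    then show "inv_into (carrier X) h (x \<oplus>\<^bsub>Y\<^esub> y) =
        inv_into (carrier X) h x \<oplus>\<^bsub>X\<^esub> inv_into (carrier X) h y"
      using b(2) c xy by (metis X.add.m_closed)
  next
    fix a x assume x: "x \<in> carrier Y"
    have "h (a \<odot>\<^bsub>X\<^esub> inv_into (carrier X) h x) = a \<odot>\<^bsub>Y\<^esub> x"
      using x c b by (simp add: rhomD[OF assms(1)])
    then show "inv_into (carrier X) h (a \<odot>\<^bsub>Y\<^esub> x) = a \<odot>\<^bsub>X\<^esub> inv_into (carrier X) h x"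
      using b(2) c x by (metis X.smult_closed)
  qed (use c in auto)
qed

lemma rmod_iso_sym: "\<lbrakk>X \<cong>\<^sub>m Y; right_module X\<rbrakk> \<Longrightarrow> Y \<cong>\<^sub>m X"
  unfolding rmod_iso_def using rhom_inv_into bij_betw_inv_into by blast

lemma rmod_iso_trans: "\<lbrakk>X \<cong>\<^sub>m Y; Y \<cong>\<^sub>m Z\<rbrakk> \<Longrightarrow> X \<cong>\<^sub>m Z"
  unfolding rmod_iso_def using rhom_comp bij_betw_trans by (fastforce simp: comp_def)

lemma rmod_iso_surj: "X \<cong>\<^sub>m Y \<Longrightarrow> \<exists>h\<in>rhom X Y. h ` carrier X = carrier Y"
  unfolding rmod_iso_def bij_betw_def by blast

lemma rmod_isoE:
  assumes "X \<cong>\<^sub>m Y" "right_module X"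
  obtains h g where "h \<in> rhom X Y" "g \<in> rhom Y X"
    "\<And>x. x \<in> carrier X \<Longrightarrow> g (h x) = x" "\<And>y. y \<in> carrier Y \<Longrightarrow> h (g y) = y"
    "bij_betw h (carrier X) (carrier Y)"
proof -
  obtain h where h: "h \<in> rhom X Y" "bij_betw h (carrier X) (carrier Y)"
    using assms(1) unfolding rmod_iso_def by auto
  show thesis
    by (rule that[OF h(1) rhom_inv_into[OF h assms(2)]])
      (use h(2) bij_betw_inv_into_right bij_betw_inv_into_left in fastforce)+
qed

lemma rmod_isoI:
  assumes "h \<in> rhom X Y" "g \<in> rhom Y X"
    "\<And>x. x \<in> carrier X \<Longrightarrow> g (h x) = x" "\<And>y. y \<in> carrier Y \<Longrightarrow> h (g y) = y"
  shows "X \<cong>\<^sub>m Y"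
  unfolding rmod_iso_def using assms
  by (intro bexI[of _ h] bij_betw_byWitness[of _ g]) (auto simp: rhom_closed)

lemma zero_moduleI:
  assumes "right_module X" "\<And>x. x \<in> carrier X \<Longrightarrow> x = \<zero>\<^bsub>X\<^esub>"
  shows "zero_module X"
  unfolding zero_module_def
proof (rule subset_antisym)
  show "carrier X \<subseteq> {\<zero>\<^bsub>X\<^esub>}" using assms(2) by blast
  show "{\<zero>\<^bsub>X\<^esub>} \<subseteq> carrier X" using rsubmodule_zero[OF rsubmodule_carrier[OF assms(1)]] by simp
qed

lemma zero_module_iso:
  assumes "X \<cong>\<^sub>m Y" "right_module X" "right_module Y" "zero_module Y"
  shows "zero_module X"
proof -
  interpret X: right_module X by fact
  obtain h g where h: "h \<in> rhom X Y" "g \<in> rhom Y X" "\<And>x. x \<in> carrier X \<Longrightarrow> g (h x) = x"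
    using rmod_isoE[OF assms(1,2)] by metis
  have "x = \<zero>\<^bsub>X\<^esub>" if "x \<in> carrier X" for x
    using h(3)[OF that] rhom_closed[OF h(1) that] assms(4) rhom_zero[OF h(2) assms(3,2)]
    by (auto simp: zero_module_def)
  then show ?thesis by (auto simp: zero_module_def)
qed


section \<open>Direct sums\<close>

lemma dsum_simps [simp]:
  "carrier (dsum I N) = (\<Pi>\<^sub>E i\<in>I. carrier (N i))"
  "\<zero>\<^bsub>dsum I N\<^esub> = (\<lambda>i\<in>I. \<zero>\<^bsub>N i\<^esub>)"
  "x \<oplus>\<^bsub>dsum I N\<^esub> y = (\<lambda>i\<in>I. x i \<oplus>\<^bsub>N i\<^esub> y i)"
  "a \<odot>\<^bsub>dsum I N\<^esub> x = (\<lambda>i\<in>I. a \<odot>\<^bsub>N i\<^esub> x i)"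
  by (simp_all add: dsum_def)

lemma right_module_dsum:
  assumes "\<And>i. i \<in> I \<Longrightarrow> right_module (N i)"
  shows "right_module (dsum I N)"
proof -
  note mon = abelian_group.axioms(1)[OF right_module.axioms(1)[OF assms]]
  note m = abelian_monoid.a_closed[OF mon] abelian_monoid.zero_closed[OF mon]
    abelian_monoid.a_assoc[OF mon] abelian_monoid.l_zero[OF mon]
  note r = right_module.smult_closed[OF assms] right_module.smult_l_distr[OF assms]
    right_module.smult_r_distr[OF assms] right_module.smult_assoc[OF assms]
    right_module.smult_one[OF assms] right_module.smult_zero_left[OF assms]
  have c: "x i \<in> carrier (N i)" if "x \<in> (\<Pi>\<^sub>E i\<in>I. carrier (N i))" "i \<in> I" for x i
    using that by auto
  show ?thesis
  proof (rule right_moduleI)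
    fix x y assume "x \<in> carrier (dsum I N)" "y \<in> carrier (dsum I N)"
    then show "x \<oplus>\<^bsub>dsum I N\<^esub> y = y \<oplus>\<^bsub>dsum I N\<^esub> x"
      by (auto intro!: restrict_ext abelian_monoid.a_comm[OF mon])
  next
    fix x assume x: "x \<in> carrier (dsum I N)"
    then show "\<zero>\<^bsub>dsum I N\<^esub> \<oplus>\<^bsub>dsum I N\<^esub> x = x" "1 \<odot>\<^bsub>dsum I N\<^esub> x = x"
      by (auto intro!: PiE_ext[where k=I and s="\<lambda>i. carrier (N i)"] simp: m r c)
  qed (auto simp: m r c intro!: restrict_ext)
qed

lemma dsum_eqI:
  "\<lbrakk>x \<in> carrier (dsum I N); y \<in> carrier (dsum I N); \<And>i. i \<in> I \<Longrightarrow> x i = y i\<rbrakk> \<Longrightarrow> x = y"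
  by (auto intro: PiE_ext)

lemma dsum_proj: "i \<in> I \<Longrightarrow> (\<lambda>x. x i) \<in> rhom (dsum I N) (N i)"
  by (rule rhomI) auto

lemma dsum_tuple:
  assumes "\<And>i. i \<in> I \<Longrightarrow> h i \<in> rhom X (N i)"
  shows "(\<lambda>x. \<lambda>i\<in>I. h i x) \<in> rhom X (dsum I N)"
  by (rule rhomI) (auto simp: rhomD[OF assms])

definition dinj :: "'i set \<Rightarrow> ('i \<Rightarrow> ('a, 'm) module) \<Rightarrow> 'i \<Rightarrow> 'm \<Rightarrow> 'i \<Rightarrow> 'm" where
  "dinj I N i x = (\<lambda>j\<in>I. if j = i then x else \<zero>\<^bsub>N j\<^esub>)"

lemma dinj_rhom:
  assumes "\<And>i. i \<in> I \<Longrightarrow> right_module (N i)" "i \<in> I"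
  shows "dinj I N i \<in> rhom (N i) (dsum I N)"
proof -
  have "dinj I N i = (\<lambda>x. \<lambda>j\<in>I. (if j = i then \<lambda>x. x else (\<lambda>_. \<zero>\<^bsub>N j\<^esub>)) x)"
    by (intro ext) (auto simp: dinj_def restrict_def)
  moreover have "(if j = i then \<lambda>x. x else (\<lambda>_. \<zero>\<^bsub>N j\<^esub>)) \<in> rhom (N i) (N j)" if "j \<in> I" for j
    using rhom_id rhom_const_zero[OF assms(1)[OF that]] by auto
  ultimately show ?thesis
    using dsum_tuple[of I "\<lambda>j. if j = i then \<lambda>x. x else (\<lambda>_. \<zero>\<^bsub>N j\<^esub>)" "N i" N] by simp
qed

text \<open>Truncating a tuple replaces writing it as a finite sum: enlarging \<open>J\<close> by
  one index adds one embedded component, so claims about all tuples follow by induction on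
  \<open>J\<close>.\<close>

definition dcut :: "'i set \<Rightarrow> ('i \<Rightarrow> ('a, 'm) module) \<Rightarrow> 'i set \<Rightarrow> ('i \<Rightarrow> 'm) \<Rightarrow> 'i \<Rightarrow> 'm" where
  "dcut I N J x = (\<lambda>j\<in>I. if j \<in> J then x j else \<zero>\<^bsub>N j\<^esub>)"

lemma dcut_simps:
  assumes "\<And>i. i \<in> I \<Longrightarrow> right_module (N i)" "x \<in> carrier (dsum I N)"
  shows dcut_closed: "dcut I N J x \<in> carrier (dsum I N)"
    and dcut_empty: "dcut I N {} x = \<zero>\<^bsub>dsum I N\<^esub>"
    and dcut_full: "dcut I N I x = x"
    and dcut_insert: "i \<in> I \<Longrightarrow> i \<notin> J \<Longrightarrow>
          dcut I N (insert i J) x = dcut I N J x \<oplus>\<^bsub>dsum I N\<^esub> dinj I N i (x i)"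
proof -
  have z: "\<zero>\<^bsub>N i\<^esub> \<in> carrier (N i)" if "i \<in> I" for i
    using assms(1)[OF that] abelian_monoid.zero_closed abelian_group.axioms(1) right_module.axioms(1)
    by blast
  have m: "abelian_monoid (N i)" if "i \<in> I" for i
    using assms(1)[OF that] abelian_group.axioms(1) right_module.axioms(1) by blast
  show "dcut I N J x \<in> carrier (dsum I N)" using assms(2) z by (auto simp: dcut_def)
  show "dcut I N {} x = \<zero>\<^bsub>dsum I N\<^esub>" by (simp add: dcut_def)
  show "dcut I N I x = x"
    using assms(2) z by (intro dsum_eqI[where I=I and N=N]) (auto simp: dcut_def)
  show "dcut I N (insert i J) x = dcut I N J x \<oplus>\<^bsub>dsum I N\<^esub> dinj I N i (x i)" if "i \<in> I" "i \<notin> J"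
    using that PiE_mem[OF assms(2)[unfolded dsum_simps]]
    by (auto simp: dcut_def dinj_def abelian_monoid.l_zero[OF m] abelian_monoid.r_zero[OF m] z
        intro!: restrict_ext)
qed

lemma dsum_generated:
  assumes "finite I" "\<And>i. i \<in> I \<Longrightarrow> right_module (N i)" "rsubmodule U (dsum I N)"
    and "\<And>i x. i \<in> I \<Longrightarrow> x \<in> carrier (N i) \<Longrightarrow> dinj I N i x \<in> U"
  shows "U = carrier (dsum I N)"
proof
  show "U \<subseteq> carrier (dsum I N)" using assms(3) rsubmodule_subset by blast
  show "carrier (dsum I N) \<subseteq> U"
  proof
    fix x assume x: "x \<in> carrier (dsum I N)"
    note c = dcut_simps[OF assms(2) x]
    have "finite J \<Longrightarrow> J \<subseteq> I \<Longrightarrow> dcut I N J x \<in> U" for J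
    proof (induction J rule: finite_induct)
      case empty
      then show ?case using c(2) rsubmodule_zero[OF assms(3)] by metis
    next
      case (insert i J)
      then have "x i \<in> carrier (N i)" using x by auto
      then show ?case
        using insert c(4)[of i J] assms(4)[of i "x i"] rsubmodule_add[OF assms(3)]
        by (metis insert_subset)
    qed
    from this[OF assms(1)] show "x \<in> U" using c(3) by auto
  qed
qed

text \<open>Associativity of direct sums over a partition of the index set into the blocks
  \<open>B j\<close>. It cannot be an equality, because the \<open>L j\<close> and the block sums
  have different element types. In the proof \<open>b i\<close> is the block that contains
  \<open>i\<close>.\<close>

lemma dsum_blocks:
  assumes "\<And>i. i \<in> I \<Longrightarrow> right_module (N i)" and L: "\<And>j. j \<in> J \<Longrightarrow> right_module (L j)"
    and iso: "\<And>j. j \<in> J \<Longrightarrow> L j \<cong>\<^sub>m dsum (B j) N"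
    and I: "I = (\<Union>j\<in>J. B j)" and disj: "\<And>i j j'. \<lbrakk>j \<in> J; j' \<in> J; i \<in> B j; i \<in> B j'\<rbrakk> \<Longrightarrow> j = j'"
  shows "dsum J L \<cong>\<^sub>m dsum I N"
proof -
  have "\<forall>i\<in>I. \<exists>j. j \<in> J \<and> i \<in> B j" using I by auto
  then obtain b where b: "\<And>i. i \<in> I \<Longrightarrow> b i \<in> J" "\<And>i. i \<in> I \<Longrightarrow> i \<in> B (b i)" by metis
  have bj: "b i = j" if "j \<in> J" "i \<in> B j" for i j
    using disj[of j "b i" i] that b[of i] I by auto
  have BI: "i \<in> I" if "j \<in> J" "i \<in> B j" for i j using that I by auto
  have "\<forall>j\<in>J. \<exists>h g. h \<in> rhom (L j) (dsum (B j) N) \<and> g \<in> rhom (dsum (B j) N) (L j) \<and>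
      (\<forall>x\<in>carrier (L j). g (h x) = x) \<and> (\<forall>y\<in>carrier (dsum (B j) N). h (g y) = y)"
    using rmod_isoE[OF iso L] by metis
  then obtain h g where h: "\<And>j. j \<in> J \<Longrightarrow> h j \<in> rhom (L j) (dsum (B j) N)"
    and g: "\<And>j. j \<in> J \<Longrightarrow> g j \<in> rhom (dsum (B j) N) (L j)"
    and gh: "\<And>j x. j \<in> J \<Longrightarrow> x \<in> carrier (L j) \<Longrightarrow> g j (h j x) = x"
    and hg: "\<And>j y. j \<in> J \<Longrightarrow> y \<in> carrier (dsum (B j) N) \<Longrightarrow> h j (g j y) = y"
    by metis
  define H where "H = (\<lambda>x. \<lambda>i\<in>I. h (b i) (x (b i)) i)"
  define G where "G = (\<lambda>y. \<lambda>j\<in>J. g j (restrict y (B j)))"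
  have H: "H \<in> rhom (dsum J L) (dsum I N)"
    unfolding H_def
  proof (rule dsum_tuple)
    fix i assume i: "i \<in> I"
    have "(\<lambda>x. h (b i) (x (b i))) \<in> rhom (dsum J L) (dsum (B (b i)) N)"
      by (rule rhom_comp[OF dsum_proj[where I=J and N=L, OF b(1)[OF i]] h[OF b(1)[OF i]]])
    from rhom_comp[OF this dsum_proj[where N=N, OF b(2)[OF i]]]
    show "(\<lambda>x. h (b i) (x (b i)) i) \<in> rhom (dsum J L) (N i)" .
  qed
  have G: "G \<in> rhom (dsum I N) (dsum J L)"
    unfolding G_def
  proof (rule dsum_tuple)
    fix j assume j: "j \<in> J"
    have "(\<lambda>y. \<lambda>i\<in>B j. y i) \<in> rhom (dsum I N) (dsum (B j) N)"
      by (rule dsum_tuple) (rule dsum_proj, rule BI[OF j])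
    from rhom_comp[OF this g[OF j]]
    show "(\<lambda>y. g j (restrict y (B j))) \<in> rhom (dsum I N) (L j)" by (simp add: restrict_def)
  qed
  show ?thesis
  proof (rule rmod_isoI[OF H G])
    fix x assume x: "x \<in> carrier (dsum J L)"
    show "G (H x) = x"
    proof (rule dsum_eqI[OF rhom_closed[OF G rhom_closed[OF H x]] x])
      fix j assume j: "j \<in> J"
      then have xj: "x j \<in> carrier (L j)" using x by auto
      have "restrict (H x) (B j) = h j (x j)"
        using rhom_closed[OF h[OF j] xj] bj[OF j] BI[OF j]
        by (intro dsum_eqI[where I="B j" and N=N]) (auto simp: H_def PiE_mem)
      then show "G (H x) j = x j" using gh[OF j xj] j by (simp add: G_def)
    qed
  next
    fix y assume y: "y \<in> carrier (dsum I N)"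
    show "H (G y) = y"
    proof (rule dsum_eqI[OF rhom_closed[OF H rhom_closed[OF G y]] y])
      fix i assume i: "i \<in> I"
      have "restrict y (B (b i)) \<in> carrier (dsum (B (b i)) N)"
        using y BI[OF b(1)[OF i]] by auto
      from hg[OF b(1)[OF i] this] show "H (G y) i = y i"
        using i b[OF i] by (simp add: H_def G_def)
    qed
  qed
qed


section \<open>Quotients\<close>

text \<open>Quotients are realised on representatives, so that they live on the type of the given module.
  With an injective \<open>q\<close> the construction moves a module to another type.\<close>

definition image_module :: "('y \<Rightarrow> 'm) \<Rightarrow> ('a, 'y) module \<Rightarrow> ('a, 'm) module" where
  "image_module q Y = \<lparr>
     carrier = q ` carrier Y,
     mult = undefined, one = undefined,
     zero = q \<zero>\<^bsub>Y\<^esub>,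
     add = (\<lambda>a b. q (inv_into (carrier Y) q a \<oplus>\<^bsub>Y\<^esub> inv_into (carrier Y) q b)),
     smult = (\<lambda>a b. q (a \<odot>\<^bsub>Y\<^esub> inv_into (carrier Y) q b))\<rparr>"

text \<open>The module axioms are equations and closure conditions, and a surjection compatible with
  the operations carries them over.\<close>

lemma right_module_imageI:
  assumes "right_module Y" "q ` carrier Y = carrier Q" "q \<in> rhom Y Q" "q \<zero>\<^bsub>Y\<^esub> = \<zero>\<^bsub>Q\<^esub>"
  shows "right_module Q"
proof -
  interpret right_module Y by fact
  note q = rhomD[OF assms(3)]
  have ex: "\<exists>u\<in>carrier Y. x = q u" if "x \<in> carrier Q" for x using that assms(2) by auto
  note s = q(2)[symmetric] q(3)[symmetric] assms(4)[symmetric]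
  show ?thesis
  proof (rule right_moduleI)
    show "\<zero>\<^bsub>Q\<^esub> \<in> carrier Q" using assms(2,4) by (metis image_eqI zero_closed)
    fix x assume "x \<in> carrier Q" then obtain u where u: "u \<in> carrier Y" "x = q u" using ex by blast
    fix a b
    show "\<zero>\<^bsub>Q\<^esub> \<oplus>\<^bsub>Q\<^esub> x = x" "1 \<odot>\<^bsub>Q\<^esub> x = x" "0 \<odot>\<^bsub>Q\<^esub> x = \<zero>\<^bsub>Q\<^esub>" "a \<odot>\<^bsub>Q\<^esub> x \<in> carrier Q"
      using u smult_closed by (simp_all add: s smult_one) (simp_all add: q(1))
    show "(a + b) \<odot>\<^bsub>Q\<^esub> x = a \<odot>\<^bsub>Q\<^esub> x \<oplus>\<^bsub>Q\<^esub> b \<odot>\<^bsub>Q\<^esub> x" "(a * b) \<odot>\<^bsub>Q\<^esub> x = b \<odot>\<^bsub>Q\<^esub> (a \<odot>\<^bsub>Q\<^esub> x)"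
      using u smult_closed by (simp_all add: s smult_l_distr smult_assoc)
    fix y assume "y \<in> carrier Q" then obtain v where v: "v \<in> carrier Y" "y = q v" using ex by blast
    show "x \<oplus>\<^bsub>Q\<^esub> y \<in> carrier Q" "x \<oplus>\<^bsub>Q\<^esub> y = y \<oplus>\<^bsub>Q\<^esub> x"
      "a \<odot>\<^bsub>Q\<^esub> (x \<oplus>\<^bsub>Q\<^esub> y) = a \<odot>\<^bsub>Q\<^esub> x \<oplus>\<^bsub>Q\<^esub> a \<odot>\<^bsub>Q\<^esub> y"
      using u v smult_closed by (simp_all add: s smult_r_distr a_comm) (simp_all add: q(1))
    fix z assume "z \<in> carrier Q" then obtain w where w: "w \<in> carrier Y" "z = q w" using ex by blast
    show "x \<oplus>\<^bsub>Q\<^esub> y \<oplus>\<^bsub>Q\<^esub> z = x \<oplus>\<^bsub>Q\<^esub> (y \<oplus>\<^bsub>Q\<^esub> z)"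
      using u v w by (simp add: s a_assoc)
  qed
qed

text \<open>The operations of \<open>image_module\<close> use chosen preimages. By
  \<open>cong\<close> the fibres of \<open>q\<close> are the cosets of \<open>U\<close>, so another
  choice changes an argument only by an element of \<open>U\<close> and leaves the value
  unchanged.\<close>

lemma image_module:
  assumes "right_module Y" "rsubmodule U Y"
    and cong: "\<And>x y. x \<in> carrier Y \<Longrightarrow> y \<in> carrier Y \<Longrightarrow> q x = q y \<longleftrightarrow> x \<ominus>\<^bsub>Y\<^esub> y \<in> U"
  shows image_module_rhom: "q \<in> rhom Y (image_module q Y)"
    and image_module_surj: "q ` carrier Y = carrier (image_module q Y)"
    and right_module_image_module: "right_module (image_module q Y)"
    and image_module_rker: "rker Y (image_module q Y) q = U"
proof -
  interpret right_module Y by fact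
  note U = rsubmoduleD[OF assms(2)]
  let ?r = "\<lambda>x. inv_into (carrier Y) q (q x)"
  have r: "?r x \<in> carrier Y" "q (?r x) = q x" if "x \<in> carrier Y" for x
    using that by (auto simp: inv_into_into f_inv_into_f)
  show surj: "q ` carrier Y = carrier (image_module q Y)" by (simp add: image_module_def)
  show hom: "q \<in> rhom Y (image_module q Y)"
  proof (rule rhomI)
    fix x y assume xy: "x \<in> carrier Y" "y \<in> carrier Y"
    have "x \<oplus>\<^bsub>Y\<^esub> y \<ominus>\<^bsub>Y\<^esub> (?r x \<oplus>\<^bsub>Y\<^esub> ?r y) = (x \<ominus>\<^bsub>Y\<^esub> ?r x) \<oplus>\<^bsub>Y\<^esub> (y \<ominus>\<^bsub>Y\<^esub> ?r y)"
      using xy r by (simp add: a_minus_def minus_add a_ac)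
    moreover have "x \<ominus>\<^bsub>Y\<^esub> ?r x \<in> U" "y \<ominus>\<^bsub>Y\<^esub> ?r y \<in> U" using cong r xy by metis+
    ultimately have "x \<oplus>\<^bsub>Y\<^esub> y \<ominus>\<^bsub>Y\<^esub> (?r x \<oplus>\<^bsub>Y\<^esub> ?r y) \<in> U" using U by simp
    then show "q (x \<oplus>\<^bsub>Y\<^esub> y) = q x \<oplus>\<^bsub>image_module q Y\<^esub> q y"
      using cong[of "x \<oplus>\<^bsub>Y\<^esub> y" "?r x \<oplus>\<^bsub>Y\<^esub> ?r y"] r xy by (simp add: image_module_def)
  next
    fix a x assume x: "x \<in> carrier Y"
    have "a \<odot>\<^bsub>Y\<^esub> x \<ominus>\<^bsub>Y\<^esub> a \<odot>\<^bsub>Y\<^esub> ?r x = a \<odot>\<^bsub>Y\<^esub> (x \<ominus>\<^bsub>Y\<^esub> ?r x)"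
      using x r by (simp add: a_minus_def neg_eq_smult smult_r_distr smult_closed flip: smult_assoc)
    moreover have "x \<ominus>\<^bsub>Y\<^esub> ?r x \<in> U" using cong r x by metis
    ultimately have "a \<odot>\<^bsub>Y\<^esub> x \<ominus>\<^bsub>Y\<^esub> a \<odot>\<^bsub>Y\<^esub> ?r x \<in> U" using U by simp
    then show "q (a \<odot>\<^bsub>Y\<^esub> x) = a \<odot>\<^bsub>image_module q Y\<^esub> q x"
      using cong[of "a \<odot>\<^bsub>Y\<^esub> x" "a \<odot>\<^bsub>Y\<^esub> ?r x"] r x smult_closed by (simp add: image_module_def)
  qed (use surj in auto)
  show "right_module (image_module q Y)"
    by (rule right_module_imageI[OF assms(1) surj hom]) (simp add: image_module_def)
  have "q x = q \<zero>\<^bsub>Y\<^esub> \<longleftrightarrow> x \<in> U" if "x \<in> carrier Y" for x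
    using cong[OF that, of "\<zero>\<^bsub>Y\<^esub>"] that by simp
  then show "rker Y (image_module q Y) q = U"
    using U(1) by (auto simp: rker_def image_module_def)
qed

lemma quotient_exists:
  fixes Y :: "('a::ring_1, 'm) module"
  assumes "right_module Y" "rsubmodule U Y"
  shows "\<exists>(Q :: ('a, 'm) module) q. right_module Q \<and> q \<in> rhom Y Q \<and> q ` carrier Y = carrier Q \<and> rker Y Q q = U"
proof -
  interpret right_module Y by fact
  note U = rsubmoduleD[OF assms(2)] rsubmodule_minus[OF assms(2)]
  let ?S = "\<lambda>x. {z \<in> carrier Y. z \<ominus>\<^bsub>Y\<^esub> x \<in> U}"
  \<comment> \<open>The choice depends only on the set \<open>?S x\<close>, which is the coset of
    \<open>x\<close>; hence congruent elements receive the same representative.\<close>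
  define q where "q = (\<lambda>x. SOME z. z \<in> ?S x)"
  have qS: "q x \<in> ?S x" if "x \<in> carrier Y" for x
  proof -
    have "x \<in> ?S x" using that U(2) right_module_diff_zero_iff[OF assms(1) that that] by simp
    then show ?thesis unfolding q_def by (rule someI)
  qed
  have "q x = q y \<longleftrightarrow> x \<ominus>\<^bsub>Y\<^esub> y \<in> U" if xy: "x \<in> carrier Y" "y \<in> carrier Y" for x y
  proof
    assume "q x = q y"
    then have q: "q x \<in> carrier Y" "q x \<ominus>\<^bsub>Y\<^esub> x \<in> U" "q x \<ominus>\<^bsub>Y\<^esub> y \<in> U"
      using qS[OF xy(1)] qS[OF xy(2)] by auto
    then have "(x \<ominus>\<^bsub>Y\<^esub> q x) \<oplus>\<^bsub>Y\<^esub> (q x \<ominus>\<^bsub>Y\<^esub> y) \<in> U"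
      using U(3,5) neg_diff[of "q x" x] xy by metis
    then show "x \<ominus>\<^bsub>Y\<^esub> y \<in> U" using diff_add_diff q(1) xy by simp
  next
    assume d: "x \<ominus>\<^bsub>Y\<^esub> y \<in> U"
    then have d': "y \<ominus>\<^bsub>Y\<^esub> x \<in> U" using U(5) neg_diff xy by metis
    have "z \<ominus>\<^bsub>Y\<^esub> y \<in> U \<longleftrightarrow> z \<ominus>\<^bsub>Y\<^esub> x \<in> U" if "z \<in> carrier Y" for z
      using U(3)[OF _ d, of "z \<ominus>\<^bsub>Y\<^esub> x"] U(3)[OF _ d', of "z \<ominus>\<^bsub>Y\<^esub> y"] that xy
      by (auto simp: diff_add_diff)
    then have "?S x = ?S y" by auto
    then show "q x = q y" unfolding q_def by (rule arg_cong)
  qed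
  note im = image_module[OF assms this]
  show ?thesis
    by (rule exI[of _ "image_module q Y"], rule exI[of _ q]) (use im in simp)
qed

section \<open>Finite generation\<close>

lemma fin_gen_surj:
  assumes "fin_gen X" "p \<in> rhom X Y" "p ` carrier X = carrier Y" "right_module X" "right_module Y"
  shows "fin_gen Y"
proof -
  obtain S where S: "finite S" "S \<subseteq> carrier X" "\<And>U. rsubmodule U X \<Longrightarrow> S \<subseteq> U \<Longrightarrow> U = carrier X"
    using assms(1) unfolding fin_gen_def by auto
  have "U = carrier Y" if U: "rsubmodule U Y" "p ` S \<subseteq> U" for U
  proof -
    have "{x \<in> carrier X. p x \<in> U} = carrier X"
      using S(2) U(2) by (intro S(3) rsubmodule_preimage[OF assms(2,4,5) U(1)]) auto
    then have "p ` carrier X \<subseteq> U" by auto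
    then show ?thesis using assms(3) rsubmodule_subset[OF U(1)] by auto
  qed
  then show ?thesis
    unfolding fin_gen_def using S(1,2) assms(3) by (intro exI[of _ "p ` S"]) auto
qed

lemma fin_gen_dsum:
  assumes "finite I" "\<And>i. i \<in> I \<Longrightarrow> right_module (N i)" "\<And>i. i \<in> I \<Longrightarrow> fin_gen (N i)"
  shows "fin_gen (dsum I N)"
proof -
  obtain S where S: "\<And>i. i \<in> I \<Longrightarrow> finite (S i)" "\<And>i. i \<in> I \<Longrightarrow> S i \<subseteq> carrier (N i)"
    "\<And>i U. i \<in> I \<Longrightarrow> rsubmodule U (N i) \<Longrightarrow> S i \<subseteq> U \<Longrightarrow> U = carrier (N i)"
    using assms(3) unfolding fin_gen_def by metis
  let ?T = "\<Union>i\<in>I. dinj I N i ` S i"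
  have "U = carrier (dsum I N)" if U: "rsubmodule U (dsum I N)" "?T \<subseteq> U" for U
  proof (rule dsum_generated[OF assms(1,2) U(1)])
    fix i x assume i: "i \<in> I" and x: "x \<in> carrier (N i)"
    have "{x \<in> carrier (N i). dinj I N i x \<in> U} = carrier (N i)"
    proof (rule S(3)[OF i])
      show "rsubmodule {x \<in> carrier (N i). dinj I N i x \<in> U} (N i)"
        using dinj_rhom[where I=I and N=N, OF assms(2) i] assms(2)[OF i] right_module_dsum[OF assms(2)] U(1)
        by (rule rsubmodule_preimage)
      show "S i \<subseteq> {x \<in> carrier (N i). dinj I N i x \<in> U}"
        using S(2)[OF i] U(2) i by blast
    qed
    then show "dinj I N i x \<in> U" using x by auto
  qed
  moreover have "?T \<subseteq> carrier (dsum I N)"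
  proof
    fix y assume "y \<in> ?T"
    then obtain i x where i: "i \<in> I" and x: "x \<in> S i" and y: "y = dinj I N i x" by auto
    have "x \<in> carrier (N i)" using S(2)[OF i] x by auto
    then show "y \<in> carrier (dsum I N)"
      using rhom_closed[OF dinj_rhom[where I=I and N=N, OF assms(2) i]] y by simp
  qed
  ultimately show ?thesis
    unfolding fin_gen_def using S(1) assms(1) by (intro exI[of _ ?T]) auto
qed

lemma modA_right_module: "M \<in> modA \<Longrightarrow> right_module M"
  by (simp add: modA_def)

lemma modA_fin_gen: "M \<in> modA \<Longrightarrow> fin_gen M"
  by (simp add: modA_def)

lemma modA_surj:
  "\<lbrakk>X \<in> modA; p \<in> rhom X Y; p ` carrier X = carrier Y; right_module Y\<rbrakk> \<Longrightarrow> Y \<in> modA"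
  using fin_gen_surj by (auto simp: modA_def)

section \<open>Generation and the trace\<close>

text \<open>This form mentions neither sums of maps nor a number of copies of \<open>X\<close>, so
  its closure properties follow by taking preimages of submodules. For members of
  \<open>modA\<close> it amounts to membership in \<open>Fac X\<close>, by
  \<open>Fac_eq\<close>.\<close>

definition generates :: "('a::ring_1, 'x) module \<Rightarrow> ('a, 'm) module \<Rightarrow> bool" where
  "generates X Y \<longleftrightarrow>
     (\<forall>U. rsubmodule U Y \<and> (\<forall>h\<in>rhom X Y. h ` carrier X \<subseteq> U) \<longrightarrow> U = carrier Y)"

lemma generatesD:
  "\<lbrakk>generates X Y; rsubmodule U Y; \<And>h x. h \<in> rhom X Y \<Longrightarrow> x \<in> carrier X \<Longrightarrow> h x \<in> U\<rbrakk> \<Longrightarrow> U = carrier Y"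
  unfolding generates_def by blast

lemma generates_surj:
  assumes "p \<in> rhom X Y" "p ` carrier X = carrier Y"
  shows "generates X Y"
  unfolding generates_def using assms rsubmodule_subset[of _ Y] by (metis subset_antisym)

lemma generates_trans:
  assumes "generates X Y" "generates Y Z" "right_module Y" "right_module Z"
  shows "generates X Z"
  unfolding generates_def
proof (intro allI impI)
  fix U assume U: "rsubmodule U Z \<and> (\<forall>h\<in>rhom X Z. h ` carrier X \<subseteq> U)"
  show "U = carrier Z"
  proof (rule generatesD[OF assms(2)])
    fix h y assume h: "h \<in> rhom Y Z" and y: "y \<in> carrier Y"
    have "{y \<in> carrier Y. h y \<in> U} = carrier Y"
    proof (rule generatesD[OF assms(1)])
      fix g x assume g: "g \<in> rhom X Y" and x: "x \<in> carrier X"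
      show "g x \<in> {y \<in> carrier Y. h y \<in> U}"
        using bspec[OF conjunct2[OF U] rhom_comp[OF g h]] rhom_closed[OF g x] x by auto
    qed (rule rsubmodule_preimage[OF h assms(3,4)], use U in auto)
    then show "h y \<in> U" using y by auto
  qed (use U in auto)
qed

lemma generates_refl: "generates X X"
  by (rule generates_surj[OF rhom_id]) auto

lemma generates_iso: "X \<cong>\<^sub>m Y \<Longrightarrow> generates X Y"
  using rmod_iso_surj generates_surj by blast

text \<open>The kernel of a map from \<open>Y\<close> to \<open>Z\<close> is a submodule of
  \<open>Y\<close> that contains every image of \<open>X\<close>.\<close>

lemma generates_Hom_zero:
  assumes "generates X Y" "Hom_zero X Z" "right_module Y" "right_module Z"
  shows "Hom_zero Y Z"
  unfolding Hom_zero_def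
proof (intro ballI)
  fix h y assume h: "h \<in> rhom Y Z" and y: "y \<in> carrier Y"
  have "rker Y Z h = carrier Y"
  proof (rule generatesD[OF assms(1) rsubmodule_rker[OF h assms(3,4)]])
    fix g x assume g: "g \<in> rhom X Y" and x: "x \<in> carrier X"
    show "g x \<in> rker Y Z h"
      using rhom_comp[OF g h] assms(2) rhom_closed[OF g x] x by (auto simp: Hom_zero_def rker_def)
  qed
  then show "h y = \<zero>\<^bsub>Z\<^esub>" using y by (auto simp: rker_def)
qed

lemma generates_dsum:
  assumes "finite I" "\<And>i. i \<in> I \<Longrightarrow> right_module (N i)" "\<And>i. i \<in> I \<Longrightarrow> generates X (N i)"
  shows "generates X (dsum I N)"
  unfolding generates_def
proof (intro allI impI)
  fix U assume U: "rsubmodule U (dsum I N) \<and> (\<forall>h\<in>rhom X (dsum I N). h ` carrier X \<subseteq> U)"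
  show "U = carrier (dsum I N)"
  proof (rule dsum_generated[OF assms(1,2)])
    fix i x assume i: "i \<in> I" and x: "x \<in> carrier (N i)"
    note inj = dinj_rhom[where I=I and N=N, OF assms(2) i]
    have "{x \<in> carrier (N i). dinj I N i x \<in> U} = carrier (N i)"
    proof (rule generatesD[OF assms(3)[OF i]])
      fix g x assume g: "g \<in> rhom X (N i)" and x: "x \<in> carrier X"
      show "g x \<in> {x \<in> carrier (N i). dinj I N i x \<in> U}"
        using bspec[OF conjunct2[OF U] rhom_comp[OF g inj]] rhom_closed[OF g x] x by auto
    qed (rule rsubmodule_preimage[OF inj assms(2)[OF i] right_module_dsum[OF assms(2)]], use U in auto)
    then show "dinj I N i x \<in> U" using x by auto
  qed (use U in auto)
qed

lemma dsum_proj_surj: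
  assumes "\<And>i. i \<in> I \<Longrightarrow> right_module (N i)" "i \<in> I"
  shows "(\<lambda>x. x i) ` carrier (dsum I N) = carrier (N i)"
proof
  show "carrier (N i) \<subseteq> (\<lambda>x. x i) ` carrier (dsum I N)"
  proof
    fix y assume "y \<in> carrier (N i)"
    then have "dinj I N i y \<in> carrier (dsum I N)" "dinj I N i y i = y"
      using rhom_closed[OF dinj_rhom[where I=I and N=N, OF assms]] assms(2) by (auto simp: dinj_def)
    then show "y \<in> (\<lambda>x. x i) ` carrier (dsum I N)" by (metis image_eqI)
  qed
qed (use assms(2) in auto)

lemma dsum_generates:
  assumes "\<And>i. i \<in> I \<Longrightarrow> right_module (N i)" "i \<in> I"
  shows "generates (dsum I N) (N i)"
  by (rule generates_surj[OF dsum_proj[OF assms(2)] dsum_proj_surj[OF assms]])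

lemma generates_image:
  assumes "generates X S" "i \<in> rhom S E" "right_module S" "right_module E"
  shows "generates X (rsub E (i ` carrier S))"
proof -
  have "i \<in> rhom S (rsub E (i ` carrier S))" by (rule rhom_rsub_cod[OF assms(2)]) auto
  then have "generates S (rsub E (i ` carrier S))" by (rule generates_surj) auto
  then show ?thesis
    by (rule generates_trans[OF assms(1) _ assms(3) right_module_rsub[OF assms(4)
            rsubmodule_range[OF assms(2-4)]]])
qed

text \<open>The images of the powers of \<open>X\<close> form a directed family, so a finitely generated module which they
  cover is the image of one power.\<close>

lemma generates_cover:
  assumes "generates X Y" "right_module X" "right_module Y" "fin_gen Y"
  shows "\<exists>n::nat. \<exists>p\<in>rhom (dsum {..<n} (\<lambda>_. X)) Y. p ` carrier (dsum {..<n} (\<lambda>_. X)) = carrier Y"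
proof -
  interpret X: right_module X by fact
  interpret Y: right_module Y by fact
  let ?P = "\<lambda>n::nat. dsum {..<n} (\<lambda>_. X)"
  have P: "right_module (?P n)" for n using assms(2) by (intro right_module_dsum)
  define C where "C = {V. \<exists>n. \<exists>p\<in>rhom (?P n) Y. V = p ` carrier (?P n)}"
  have Csub: "rsubmodule V Y" if "V \<in> C" for V
    using that rsubmodule_range[OF _ P assms(3)] unfolding C_def by auto
  have C1: "h ` carrier X \<in> C" if h: "h \<in> rhom X Y" for h
  proof -
    have "(\<lambda>x. h (x 0)) \<in> rhom (?P 1) Y" by (rule rhom_comp[OF dsum_proj[where N="\<lambda>_. X"] h]) auto
    moreover have "(\<lambda>x. h (x 0)) ` carrier (?P 1) = h ` carrier X"
      using dsum_proj_surj[of "{..<1::nat}" "\<lambda>_. X" 0] assms(2) by (metis image_image lessThan_iff less_one)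
    ultimately show ?thesis unfolding C_def by blast
  qed
  have dir: "\<exists>W\<in>C. V \<subseteq> W \<and> V' \<subseteq> W" if V: "V \<in> C" "V' \<in> C" for V V'
  proof -
    obtain n p where p: "p \<in> rhom (?P n) Y" "V = p ` carrier (?P n)" using V C_def by auto
    obtain m q where q: "q \<in> rhom (?P m) Y" "V' = q ` carrier (?P m)" using V C_def by auto
    let ?l = "\<lambda>x. \<lambda>i\<in>{..<n}. x i" and ?r = "\<lambda>x. \<lambda>i\<in>{..<m}. x (n + i)"
    have l: "?l \<in> rhom (?P (n + m)) (?P n)" by (rule dsum_tuple) (rule dsum_proj[where N="\<lambda>_. X"], simp)
    have r: "?r \<in> rhom (?P (n + m)) (?P m)"
    proof (rule dsum_tuple)
      fix i assume "i \<in> {..<m}"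
      then show "(\<lambda>x. x (n + i)) \<in> rhom (?P (n + m)) X"
        using dsum_proj[of "n + i" "{..<n+m}" "\<lambda>_. X"] by simp
    qed
    \<comment> \<open>The two maps are combined on \<open>n + m\<close> copies: \<open>p\<close>
      acts on the first \<open>n\<close> coordinates and \<open>q\<close> on the last
      \<open>m\<close>. Padding a tuple with zeros on either side shows that both images are
      contained in the image of \<open>?w\<close>.\<close>
    let ?w = "\<lambda>x. p (?l x) \<oplus>\<^bsub>Y\<^esub> q (?r x)"
    have w: "?w \<in> rhom (?P (n + m)) Y" by (rule rhom_add[OF rhom_comp[OF l p(1)] rhom_comp[OF r q(1)] assms(3)])
    have "V \<subseteq> ?w ` carrier (?P (n + m))"
    proof
      fix y assume "y \<in> V"
      then obtain x where x: "x \<in> carrier (?P n)" "y = p x" using p by auto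
      let ?x = "\<lambda>i\<in>{..<n+m}. if i < n then x i else \<zero>\<^bsub>X\<^esub>"
      have "?l ?x = x" using x by (simp add: fun_eq_iff PiE_iff extensional_def)
      moreover have "?r ?x = \<zero>\<^bsub>?P m\<^esub>" by (auto intro!: restrict_ext)
      ultimately have wx: "?w ?x = y"
        using rhom_closed[OF p(1) x(1)] x(2) rhom_zero[OF q(1) P assms(3)]
        by (simp del: dsum_simps)
      have cx: "?x \<in> carrier (?P (n + m))" using x(1) by (auto simp: PiE_iff)
      show "y \<in> ?w ` carrier (?P (n + m))" by (rule image_eqI[where f="?w", OF wx[symmetric] cx])
    qed
    moreover have "V' \<subseteq> ?w ` carrier (?P (n + m))"
    proof
      fix y assume "y \<in> V'"
      then obtain x where x: "x \<in> carrier (?P m)" "y = q x" using q by auto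
      let ?x = "\<lambda>i\<in>{..<n+m}. if i < n then \<zero>\<^bsub>X\<^esub> else x (i - n)"
      have "?r ?x = x" using x by (simp add: fun_eq_iff PiE_iff extensional_def)
      moreover have "?l ?x = \<zero>\<^bsub>?P n\<^esub>" by (auto intro!: restrict_ext)
      ultimately have wx: "?w ?x = y"
        using rhom_closed[OF q(1) x(1)] x(2) rhom_zero[OF p(1) P assms(3)]
        by (simp del: dsum_simps)
      have cx: "?x \<in> carrier (?P (n + m))" using x(1) by (auto simp: PiE_iff)
      show "y \<in> ?w ` carrier (?P (n + m))" by (rule image_eqI[where f="?w", OF wx[symmetric] cx])
    qed
    ultimately show ?thesis using w unfolding C_def by blast
  qed
  have ne: "C \<noteq> {}" using C1[OF rhom_const_zero[OF assms(3)]] by auto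
  have "rsubmodule (\<Union>C) Y"
  proof (rule Y.rsubmoduleI)
    show "\<Union>C \<subseteq> carrier Y" using rsubmodule_subset[OF Csub] by auto
    show "\<zero>\<^bsub>Y\<^esub> \<in> \<Union>C" using rsubmodule_zero[OF Csub] ne by auto
    show "x \<oplus>\<^bsub>Y\<^esub> y \<in> \<Union>C" if xy: "x \<in> \<Union>C" "y \<in> \<Union>C" for x y
    proof -
      obtain W where "W \<in> C" "x \<in> W" "y \<in> W" using xy dir by blast
      then show ?thesis using rsubmodule_add[OF Csub] by blast
    qed
    show "a \<odot>\<^bsub>Y\<^esub> x \<in> \<Union>C" if "x \<in> \<Union>C" for a x
      using that rsubmodule_smult[OF Csub] by blast
  qed
  then have all: "\<Union>C = carrier Y"
    using C1 by (intro generatesD[OF assms(1)]) auto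
  obtain S where S: "finite S" "S \<subseteq> carrier Y" "\<And>U. rsubmodule U Y \<Longrightarrow> S \<subseteq> U \<Longrightarrow> U = carrier Y"
    using assms(4) unfolding fin_gen_def by auto
  have "\<exists>V\<in>C. T \<subseteq> V" if "finite T" "T \<subseteq> carrier Y" for T
    using that
  proof (induction T rule: finite_induct)
    case empty
    then show ?case using ne by auto
  next
    case (insert x T)
    then obtain V where "V \<in> C" "T \<subseteq> V" by auto
    moreover obtain V' where "V' \<in> C" "x \<in> V'" using insert.prems all by blast
    ultimately show ?case using dir[of V V'] by blast
  qed
  then obtain V where "V \<in> C" "S \<subseteq> V" using S by blast
  then have "V = carrier Y" using S(3) Csub by blast
  then show ?thesis using \<open>V \<in> C\<close> unfolding C_def by blast
qed

text \<open>A power of \<open>X\<close> is generated by \<open>X\<close>, so one inclusion is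
  transitivity. The other rests on the finite generation of \<open>Y\<close>, which lets a single
  power suffice.\<close>

lemma Fac_eq:
  fixes X :: "('a::ring_1, 'x) module"
  assumes "right_module X"
  shows "Fac X = {Y \<in> modA. generates X Y}"
proof -
  have "generates X Y" if "Y \<in> modA" "p \<in> rhom (dsum {..<n::nat} (\<lambda>_. X)) Y"
    "p ` carrier (dsum {..<n} (\<lambda>_. X)) = carrier Y" for n p and Y :: "('a, 'm) module"
  proof (rule generates_trans)
    show "generates X (dsum {..<n} (\<lambda>_. X))"
      using assms generates_refl by (intro generates_dsum) auto
    show "generates (dsum {..<n} (\<lambda>_. X)) Y" by (rule generates_surj[OF that(2,3)])
  qed (use that assms in \<open>auto intro: right_module_dsum modA_right_module simp del: dsum_simps\<close>)
  then show ?thesis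
    using generates_cover[OF _ assms modA_right_module modA_fin_gen]
    unfolding Fac_def by (auto simp del: dsum_simps)
qed

text \<open>As an intersection the trace needs no sums of images, and its minimality has the shape
  that \<open>generates\<close> asks for.\<close>

definition trace :: "('a::ring_1, 'x) module \<Rightarrow> ('a, 'm) module \<Rightarrow> 'm set" where
  "trace X Y = \<Inter>{U. rsubmodule U Y \<and> (\<forall>h\<in>rhom X Y. h ` carrier X \<subseteq> U)}"

lemma trace_contains: "\<lbrakk>h \<in> rhom X Y; x \<in> carrier X\<rbrakk> \<Longrightarrow> h x \<in> trace X Y"
  unfolding trace_def by blast

lemma rsubmodule_trace:
  assumes "right_module Y"
  shows "rsubmodule (trace X Y) Y"
  unfolding trace_def
proof (rule rsubmodule_Inter[OF assms])
  have "carrier Y \<in> {U. rsubmodule U Y \<and> (\<forall>h\<in>rhom X Y. h ` carrier X \<subseteq> U)}"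
    using rsubmodule_carrier[OF assms] rhom_closed[of _ X Y] by auto
  then show "{U. rsubmodule U Y \<and> (\<forall>h\<in>rhom X Y. h ` carrier X \<subseteq> U)} \<noteq> {}" by blast
qed simp

text \<open>Every map from \<open>X\<close> to \<open>Y\<close> already lands in the trace. A
  submodule of the trace that contains all these images is therefore one of the submodules being
  intersected, and contains the trace.\<close>

lemma generates_trace:
  assumes "right_module Y"
  shows "generates X (rsub Y (trace X Y))"
  unfolding generates_def
proof (intro allI impI)
  note tr = rsubmodule_trace[OF assms, of X]
  fix U assume U: "rsubmodule U (rsub Y (trace X Y)) \<and>
    (\<forall>h\<in>rhom X (rsub Y (trace X Y)). h ` carrier X \<subseteq> U)"
  then have "rsubmodule U Y" "U \<subseteq> trace X Y" using rsubmodule_rsub[OF tr assms] by auto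
  moreover have "h ` carrier X \<subseteq> U" if h: "h \<in> rhom X Y" for h
    using bspec[OF conjunct2[OF U] rhom_rsub_cod[OF h]] trace_contains[OF h] by auto
  ultimately show "U = carrier (rsub Y (trace X Y))" unfolding trace_def by auto
qed

section \<open>Finite dimension and cardinality\<close>

text \<open>Over a finite field, one plus the product of all \<open>[:- a, 1:]\<close> is
  non-constant and takes the value 1 everywhere, so it has no root.\<close>

lemma infinite_alg_closed_field: "infinite (UNIV :: 'k::alg_closed_field set)"
proof
  assume fin: "finite (UNIV :: 'k set)"
  define p :: "'k poly" where "p = (\<Prod>a\<in>UNIV. [:- a, 1:])"
  have "degree p = (\<Sum>a\<in>(UNIV :: 'k set). degree [:- a, 1:])"
    unfolding p_def by (rule degree_prod_eq_sum_degree) auto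
  then have "degree p > 0" using fin by (simp add: finite_UNIV_card_ge_0)
  then have "degree (p + 1) > 0" by (simp add: degree_add_eq_left)
  then obtain x where "poly (p + 1) x = 0" using alg_closed_imp_poly_has_root by blast
  moreover have "poly p x = 0" unfolding p_def using fin by (simp add: poly_prod)
  ultimately show False by simp
qed

text \<open>Finiteness comes from \<open>V \<subseteq> span T\<close> and not from the ambient
  space, which in the application consists of all sequences in the algebra.\<close>

lemma (in vector_space) dim_less_dim:
  assumes "finite T" "subspace U" "subspace V" "U \<subset> V" "V \<subseteq> span T"
  shows "dim U < dim V"
proof -
  obtain B where B: "B \<subseteq> U" "independent B" "U \<subseteq> span B" "card B = dim U" by (rule basis_exists)
  obtain C where C: "B \<subseteq> C" "C \<subseteq> V" "independent C" "V \<subseteq> span C"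
    using maximal_independent_subset_extend[of B V] B assms(4) by blast
  have "finite C" using independent_span_bound[OF assms(1) C(3)] C(2) assms(5) by auto
  moreover have "B \<noteq> C" using C(4) span_minimal[OF B(1) assms(2)] assms(4) by auto
  ultimately have "card B < card C" using C(1) by (simp add: psubset_card_mono psubsetI)
  moreover have "card C = dim V" by (rule basis_card_eq_dim) (use C in auto)
  ultimately show ?thesis using B(4) by simp
qed

text \<open>An infinite field surjects onto its square, so the coefficient of a further spanning
  vector can be absorbed into the single parameter.\<close>

lemma (in vector_space) span_finite_subset_range:
  assumes "infinite (UNIV :: 'a set)" "finite T"
  shows "\<exists>g :: 'a \<Rightarrow> 'b. span T \<subseteq> range g"
  using assms(2)
proof (induction T rule: finite_induct)
  case empty
  show ?case by (rule exI[of _ "\<lambda>_. 0"]) auto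
next
  case (insert b T)
  then obtain g :: "'a \<Rightarrow> 'b" where g: "span T \<subseteq> range g" by auto
  obtain h :: "'a \<Rightarrow> 'a \<times> 'a" where h: "surj h"
    using card_of_Times_same_infinite[OF assms(1)] ordIso_symmetric card_of_ordIso
    unfolding UNIV_Times_UNIV by (metis bij_betw_imp_surj_on)
  have "x \<in> range (\<lambda>c. g (fst (h c)) + scale (snd (h c)) b)" if x: "x \<in> span (insert b T)" for x
  proof -
    obtain k where "x - scale k b \<in> span T" using x unfolding span_insert by auto
    then obtain c where "g c = x - scale k b" using g by auto
    moreover obtain d where "h d = (c, k)" using h by (metis surjD)
    ultimately have "x = g (fst (h d)) + scale (snd (h d)) b" by simp
    then show ?thesis by blast
  qed
  then show ?case by (intro exI[of _ "\<lambda>c. g (fst (h c)) + scale (snd (h c)) b"]) auto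
qed

abbreviation (input) fun_scale :: "('k \<Rightarrow> 'a \<Rightarrow> 'a) \<Rightarrow> 'k \<Rightarrow> ('i \<Rightarrow> 'a) \<Rightarrow> 'i \<Rightarrow> 'a" where
  "fun_scale scale c f \<equiv> \<lambda>i. scale c (f i)"

lemma vector_space_fun:
  assumes "vector_space scale"
  shows "vector_space (fun_scale scale)"
proof -
  interpret vector_space scale by fact
  show ?thesis
    by unfold_locales (auto simp: fun_eq_iff scale_right_distrib scale_left_distrib)
qed

text \<open>Tuples of length \<open>n\<close> are encoded as sequences that vanish from
  \<open>n\<close> on: a \<open>vector_space\<close> occupies a whole type, which the carrier of
  \<open>dsum {..<n}\<close> does not.\<close>

lemma fd_algebra_tuples_span:
  fixes scale :: "'k::field \<Rightarrow> 'a::ring_1 \<Rightarrow> 'a" and n :: nat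
  assumes "fd_algebra scale"
  shows "\<exists>T. finite T \<and> {f. \<forall>i\<ge>n. f i = 0} \<subseteq> module.span (fun_scale scale) T"
proof -
  interpret vector_space scale using assms by (simp add: fd_algebra_def)
  interpret F: vector_space "fun_scale scale :: 'k \<Rightarrow> (nat \<Rightarrow> 'a) \<Rightarrow> nat \<Rightarrow> 'a"
    by (rule vector_space_fun) unfold_locales
  obtain B where B: "finite B" "span B = UNIV" using assms by (auto simp: fd_algebra_def)
  let ?e = "\<lambda>i a (j::nat). if j = i then a else (0::'a)"
  let ?T = "\<Union>i<n. ?e i ` B"
  have e: "?e i a \<in> F.span ?T" if i: "i < n" for i a
  proof -
    have "a \<in> span B" using B by simp
    then show ?thesis
    proof (induction rule: span_induct_alt)
      case base
      have "?e i 0 = 0" by (auto simp: fun_eq_iff)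
      then show ?case using F.span_zero[of ?T] by simp
    next
      case (step c x y)
      have "?e i (scale c x + y) = fun_scale scale c (?e i x) + ?e i y"
        by (auto simp: fun_eq_iff)
      moreover have "?e i x \<in> F.span ?T" by (rule F.span_base) (use step(1) i in auto)
      ultimately show ?case using F.span_add[OF F.span_scale step(2), of "?e i x" c] by simp
    qed
  qed
  have "f \<in> F.span ?T" if "m \<le> n" "\<forall>i\<ge>m. f i = 0" for m f
    using that
  proof (induction m arbitrary: f)
    case 0
    then have "f = 0" by (auto simp: fun_eq_iff)
    then show ?case using F.span_zero[of ?T] by (simp only:)
  next
    case (Suc m)
    have "f(m := 0) \<in> F.span ?T" using Suc.prems by (intro Suc.IH) (auto simp: not_less_eq_eq le_Suc_eq)
    moreover have "f = f(m := 0) + ?e m (f m)" by (auto simp: fun_eq_iff)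
    ultimately show ?case using F.span_add[of "f(m := 0)" ?T "?e m (f m)"] e[of m "f m"] Suc.prems by simp
  qed
  then show ?thesis using B(1) by (intro exI[of _ ?T]) auto
qed

section \<open>The regular module and free covers\<close>

lemma regular_module_simps [simp]:
  "carrier regular_module = UNIV" "\<zero>\<^bsub>regular_module\<^esub> = 0"
  "x \<oplus>\<^bsub>regular_module\<^esub> y = x + y" "a \<odot>\<^bsub>regular_module\<^esub> x = x * a"
  by (simp_all add: regular_module_def)

lemma right_module_regular: "right_module regular_module"
  by (rule right_moduleI) (auto simp: algebra_simps)

lemma fin_gen_regular: "fin_gen regular_module"
  unfolding fin_gen_def
proof (intro exI[of _ "{1}"] conjI allI impI)
  fix U :: "'a set" assume U: "rsubmodule U regular_module \<and> {1} \<subseteq> U"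
  then have "x \<in> U" for x using rsubmodule_smult[of U regular_module 1 x] by simp
  then show "U = carrier regular_module" by auto
qed auto

lemma regular_module_rhom:
  assumes "right_module Y" "y \<in> carrier Y"
  shows "(\<lambda>a. a \<odot>\<^bsub>Y\<^esub> y) \<in> rhom regular_module Y"
proof -
  interpret right_module Y by fact
  show ?thesis
    using assms(2) by (intro rhomI) (auto simp: smult_closed smult_l_distr smult_assoc)
qed

lemma generates_regular:
  assumes "right_module Y"
  shows "generates regular_module Y"
  unfolding generates_def
proof (intro allI impI)
  fix U assume U: "rsubmodule U Y \<and> (\<forall>h\<in>rhom regular_module Y. h ` carrier regular_module \<subseteq> U)"
  have "y \<in> U" if y: "y \<in> carrier Y" for y
    using bspec[OF conjunct2[OF U] regular_module_rhom[OF assms y]]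
      right_module.smult_one[OF assms y] by (metis image_subset_iff regular_module_simps(1) UNIV_I)
  then show "U = carrier Y" using U rsubmodule_subset by blast
qed

lemma free_cover:
  assumes "right_module Y" "fin_gen Y"
  shows "\<exists>n::nat. \<exists>p\<in>rhom (dsum {..<n} (\<lambda>_. regular_module)) Y.
    p ` carrier (dsum {..<n} (\<lambda>_. regular_module)) = carrier Y"
  by (rule generates_cover[OF generates_regular right_module_regular]) (use assms in auto)

text \<open>The rank of \<open>U\<close> is the dimension of its preimage under a free cover of
  \<open>X\<close>, taken among sequences vanishing from \<open>n\<close> on. Preimages under a
  surjection preserve strict inclusion, and the spanning set of the sequences bounds the dimension.
  This rank stands in for the dimension of \<open>U\<close>.\<close>

lemma submodule_rank:
  fixes scale :: "'k::field \<Rightarrow> 'a::ring_1 \<Rightarrow> 'a" and X :: "('a, 'm) module"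
  assumes "fd_algebra scale" "X \<in> modA"
  shows "\<exists>(rk :: 'm set \<Rightarrow> nat) d. \<forall>U. rsubmodule U X \<longrightarrow> rk U \<le> d \<and>
    (\<forall>V. rsubmodule V X \<longrightarrow> U \<subset> V \<longrightarrow> rk U < rk V)"
proof -
  have X: "right_module X" "fin_gen X" using assms(2) by (auto simp: modA_def)
  interpret X: right_module X by fact
  interpret A: vector_space scale using assms(1) by (simp add: fd_algebra_def)
  interpret F: vector_space "fun_scale scale :: 'k \<Rightarrow> (nat \<Rightarrow> 'a) \<Rightarrow> nat \<Rightarrow> 'a"
    by (rule vector_space_fun) unfold_locales
  have mult: "x * scale c 1 = scale c x" for c x
    using assms(1) by (simp add: fd_algebra_def)
  obtain n p where p: "p \<in> rhom (dsum {..<n::nat} (\<lambda>_. regular_module)) X"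
    "p ` carrier (dsum {..<n} (\<lambda>_. regular_module)) = carrier X"
    using free_cover[OF X] by metis
  obtain T where T: "finite T" "{f. \<forall>i\<ge>n. f i = 0} \<subseteq> F.span T"
    using fd_algebra_tuples_span[OF assms(1), of n] by auto
  let ?P = "dsum {..<n} (\<lambda>_. regular_module) :: ('a, nat \<Rightarrow> 'a) module"
  let ?R = "\<lambda>f :: nat \<Rightarrow> 'a. restrict f {..<n}"
  have P: "right_module ?P" using right_module_regular by (rule right_module_dsum)
  have R: "?R f \<in> carrier ?P" "?R (f + g) = ?R f \<oplus>\<^bsub>?P\<^esub> ?R g"
    "?R (fun_scale scale c f) = scale c 1 \<odot>\<^bsub>?P\<^esub> ?R f" "?R 0 = \<zero>\<^bsub>?P\<^esub>" for f g c
    by (auto simp: mult intro!: restrict_ext)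
  define S where "S U = {f. (\<forall>i\<ge>n. f i = 0) \<and> p (?R f) \<in> U}" for U
  have sub: "F.subspace (S U)" if "rsubmodule U X" for U
    unfolding F.subspace_def S_def
    using rsubmoduleD[OF that] rhom_zero[OF p(1) P X(1)]
    by (auto simp: R(2-4) rhom_plus[OF p(1) R(1) R(1)] rhom_smult[OF p(1) R(1)]
        simp del: dsum_simps restrict_apply)
  have strict: "S U \<subset> S V" if V: "rsubmodule V X" "U \<subset> V" for U V
  proof -
    obtain v where v: "v \<in> V" "v \<notin> U" using V by auto
    then obtain z where z: "z \<in> carrier ?P" "v = p z" using rsubmodule_subset[OF V(1)] p(2) by blast
    let ?f = "\<lambda>i. if i < n then z i else 0"
    have "?R ?f = z" using z(1) by (auto simp: fun_eq_iff PiE_iff extensional_def)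
    then have "?f \<in> S V" "?f \<notin> S U" using v z(2) by (auto simp: S_def)
    moreover have "S U \<subseteq> S V" using V(2) by (auto simp: S_def)
    ultimately show ?thesis by blast
  qed
  have "S U \<subseteq> F.span T" for U using T(2) by (auto simp: S_def)
  then show ?thesis
    using F.dim_less_dim[OF T(1) sub sub strict] F.dim_le_card[OF _ T(1)]
    by (intro exI[of _ "\<lambda>U. F.dim (S U)"] exI[of _ "card T"]) blast
qed

text \<open>Among the finite subsets of \<open>U\<close> there is one whose generated submodule has
  greatest rank. Adding a further element of \<open>U\<close> cannot enlarge that submodule, so it
  is \<open>U\<close>.\<close>

lemma modA_rsub:
  fixes scale :: "'k::field \<Rightarrow> 'a::ring_1 \<Rightarrow> 'a" and X :: "('a::ring_1, 'm) module"
  assumes "fd_algebra scale" "X \<in> modA" "rsubmodule U X"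
  shows "rsub X U \<in> modA"
proof -
  have X: "right_module X" using assms(2) by (simp add: modA_def)
  obtain rk :: "'m set \<Rightarrow> nat" and d where rk: "\<And>U. rsubmodule U X \<Longrightarrow> rk U \<le> d"
    "\<And>U V. rsubmodule U X \<Longrightarrow> rsubmodule V X \<Longrightarrow> U \<subset> V \<Longrightarrow> rk U < rk V"
    using submodule_rank[OF assms(1,2)] by metis
  define gen where "gen S = \<Inter>{V. rsubmodule V X \<and> S \<subseteq> V}" for S
  have gen: "rsubmodule (gen S) X" "S \<subseteq> gen S" if "S \<subseteq> carrier X" for S
    unfolding gen_def using that rsubmodule_carrier[OF X]
    by (auto intro!: rsubmodule_Inter[OF X])
  have gen_min: "gen S \<subseteq> V" if "rsubmodule V X" "S \<subseteq> V" for S V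
    using that by (auto simp: gen_def)
  have U: "U \<subseteq> carrier X" by (rule rsubmodule_subset[OF assms(3)])
  let ?Q = "\<lambda>S. finite S \<and> S \<subseteq> U"
  obtain S where S: "?Q S" "\<And>S'. ?Q S' \<Longrightarrow> rk (gen S') \<le> rk (gen S)"
  proof -
    have "\<forall>S. ?Q S \<longrightarrow> rk (gen S) < Suc d"
      using rk(1) gen(1) U by (meson subset_trans less_Suc_eq_le)
    then show thesis using that ex_has_greatest_nat[of ?Q "{}" "\<lambda>S. rk (gen S)" "Suc d"] by auto
  qed
  have "gen S = U"
  proof (rule ccontr)
    assume "gen S \<noteq> U"
    then obtain x where x: "x \<in> U" "x \<notin> gen S" using gen_min[OF assms(3)] S(1) by blast
    then have sub: "insert x S \<subseteq> carrier X" "S \<subseteq> carrier X" using S(1) U by auto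
    have "gen S \<subseteq> gen (insert x S)"
      using gen[OF sub(1)] by (intro gen_min) auto
    then have "gen S \<subset> gen (insert x S)" using x gen(2)[OF sub(1)] by auto
    then have "rk (gen S) < rk (gen (insert x S))" using rk(2) gen(1) sub by blast
    then show False using S(2)[of "insert x S"] S(1) x by auto
  qed
  then have "V = U" if "rsubmodule V X" "V \<subseteq> U" "S \<subseteq> V" for V
    using gen_min[OF that(1,3)] that(2) by auto
  then have "fin_gen (rsub X U)"
    unfolding fin_gen_def using S(1) by (intro exI[of _ S]) (auto simp: rsubmodule_rsub[OF assms(3) X])
  then show ?thesis using right_module_rsub[OF X assms(3)] by (simp add: modA_def)
qed

text \<open>Multiples of a non-zero element by distinct scalars are distinct, since non-zero scalars
  are invertible. This is what bounds the size of \<open>'m\<close> from below.\<close>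

lemma range_of_field:
  fixes scale :: "'k::field \<Rightarrow> 'a::ring_1 \<Rightarrow> 'a" and X :: "('a, 'm) module"
  assumes "fd_algebra scale" "right_module X" "\<not> zero_module X"
  shows "\<exists>e :: 'k \<Rightarrow> 'm. inj e"
proof -
  interpret X: right_module X by fact
  interpret A: vector_space scale using assms(1) by (simp add: fd_algebra_def)
  have mult: "scale b 1 * scale c 1 = scale (b * c) 1" for b c
    using assms(1) by (simp add: fd_algebra_def)
  obtain x where x: "x \<in> carrier X" "x \<noteq> \<zero>\<^bsub>X\<^esub>"
    using assms(3) X.zero_closed by (auto simp: zero_module_def)
  have "b = c" if eq: "scale b 1 \<odot>\<^bsub>X\<^esub> x = scale c 1 \<odot>\<^bsub>X\<^esub> x" for b c
  proof (rule ccontr)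
    assume "b \<noteq> c"
    have "scale (b - c) 1 = scale b 1 + (- scale c 1)" by (simp add: A.scale_left_diff_distrib)
    then have "scale (b - c) 1 \<odot>\<^bsub>X\<^esub> x = \<zero>\<^bsub>X\<^esub>"
      using x(1) eq by (simp only: X.smult_l_distr X.smult_neg_left) (simp add: X.smult_closed X.r_neg)
    then have "scale ((b - c) * inverse (b - c)) 1 \<odot>\<^bsub>X\<^esub> x = \<zero>\<^bsub>X\<^esub>"
      using x(1) by (simp only: mult[symmetric] X.smult_assoc X.smult_zero_right)
    then show False using \<open>b \<noteq> c\<close> x by (simp add: X.smult_one)
  qed
  then show ?thesis by (intro exI[of _ "\<lambda>c. scale c 1 \<odot>\<^bsub>X\<^esub> x"] injI)
qed

lemma projectiveD:
  fixes P X Y :: "('a::ring_1, 'm) module"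
  assumes "projective P" "X \<in> modA" "Y \<in> modA" "p \<in> rhom X Y" "h \<in> rhom P Y"
    and "p ` carrier X = carrier Y"
  shows "\<exists>h'\<in>rhom P X. \<forall>x\<in>carrier P. p (h' x) = h x"
  using assms unfolding projective_def by meson

text \<open>A free module of finite rank has at most as many elements as the field, so it can be realised on
  the type \<open>'m\<close>, where projectivity can be applied to it.\<close>

lemma projective_dual_basis:
  fixes scale :: "'k::alg_closed_field \<Rightarrow> 'a::ring_1 \<Rightarrow> 'a" and X P :: "('a, 'm) module"
  assumes "fd_algebra scale" "right_module X" "\<not> zero_module X" "projective P"
  shows "\<exists>n::nat. \<exists>q\<in>rhom (dsum {..<n} (\<lambda>_. regular_module)) P.
    \<exists>s\<in>rhom P (dsum {..<n} (\<lambda>_. regular_module)). \<forall>x\<in>carrier P. q (s x) = x"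
proof -
  have PP: "right_module P" "fin_gen P" "P \<in> modA" using assms(4) by (auto simp: projective_def modA_def)
  obtain n q where q: "q \<in> rhom (dsum {..<n::nat} (\<lambda>_. regular_module)) P"
    "q ` carrier (dsum {..<n} (\<lambda>_. regular_module)) = carrier P"
    using free_cover[OF PP(1,2)] by metis
  let ?F = "dsum {..<n} (\<lambda>_. regular_module) :: ('a, nat \<Rightarrow> 'a) module"
  have F: "right_module ?F" using right_module_regular by (rule right_module_dsum)
  have Fg: "fin_gen ?F" using right_module_regular fin_gen_regular by (intro fin_gen_dsum) auto
  have "vector_space scale" using assms(1) by (simp add: fd_algebra_def)
  then interpret V: vector_space "fun_scale scale :: 'k \<Rightarrow> (nat \<Rightarrow> 'a) \<Rightarrow> nat \<Rightarrow> 'a"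
    by (rule vector_space_fun)
  obtain T where T: "finite T" "{f. \<forall>i\<ge>n. f i = 0} \<subseteq> V.span T"
    using fd_algebra_tuples_span[OF assms(1), of n] by auto
  obtain g :: "'k \<Rightarrow> nat \<Rightarrow> 'a" where g: "V.span T \<subseteq> range g"
    using V.span_finite_subset_range[OF infinite_alg_closed_field T(1)] by auto
  have "z \<in> range (\<lambda>c. restrict (g c) {..<n})" if z: "z \<in> carrier ?F" for z
  proof -
    have "(\<lambda>i. if i < n then z i else 0) \<in> {f. \<forall>i\<ge>n. f i = 0}" by simp
    then have "(\<lambda>i. if i < n then z i else 0) \<in> range g" using g T(2) by (meson subsetD)
    then obtain c where c: "g c = (\<lambda>i. if i < n then z i else 0)" by auto
    have "restrict (g c) {..<n} = z" using z unfolding c by (auto simp: fun_eq_iff PiE_iff extensional_def)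
    then show ?thesis by blast
  qed
  \<comment> \<open>The field surjects onto a set containing the free module. Choosing preimages
    injects the free module into the field, and the field is then embedded into
    \<open>'m\<close>.\<close>
  then obtain u :: "(nat \<Rightarrow> 'a) \<Rightarrow> 'k" where u: "inj_on u (carrier ?F)"
    using subset_image_inj[of "carrier ?F" "\<lambda>c. restrict (g c) {..<n}" UNIV]
    by (metis inj_on_inv_into subsetI)
  obtain e' :: "'k \<Rightarrow> 'm" where "inj e'" using range_of_field[OF assms(1-3)] by auto
  then have e: "inj_on (e' \<circ> u) (carrier ?F)" (is "inj_on ?e _")
    using u by (meson comp_inj_on inj_on_subset subset_UNIV)
  interpret F: right_module ?F by fact
  have cong: "?e x = ?e y \<longleftrightarrow> x \<ominus>\<^bsub>?F\<^esub> y \<in> {\<zero>\<^bsub>?F\<^esub>}" if "x \<in> carrier ?F" "y \<in> carrier ?F" for x y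
    using right_module_diff_zero_iff[OF F that] inj_on_eq_iff[OF e that] by simp
  note im = image_module[OF F rsubmodule_zero_set[OF F], of ?e, OF cong]
  let ?G = "image_module ?e ?F"
  have bij: "bij_betw ?e (carrier ?F) (carrier ?G)" using e im(2) by (simp add: bij_betw_def)
  let ?i = "inv_into (carrier ?F) ?e"
  have i: "?i \<in> rhom ?G ?F" by (rule rhom_inv_into[OF im(1) bij F])
  have G: "?G \<in> modA" using fin_gen_surj[OF Fg im(1,2) F im(3)] im(3) by (simp add: modA_def)
  have qi: "(\<lambda>x. q (?i x)) \<in> rhom ?G P" by (rule rhom_comp[OF i q(1)])
  have "(\<lambda>x. q (?i x)) ` carrier ?G = q ` (?i ` carrier ?G)" by (rule image_image[symmetric])
  also have "?i ` carrier ?G = carrier ?F"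
    using bij_betw_inv_into[OF bij] by (simp add: bij_betw_def)
  finally have "(\<lambda>x. q (?i x)) ` carrier ?G = carrier P" by (simp only: q(2))
  \<comment> \<open>Lifting the identity of \<open>P\<close> along the copied cover splits it;
    \<open>?i\<close> leads from the copy back to the free module.\<close>
  then obtain h where h: "h \<in> rhom P ?G" "\<forall>x\<in>carrier P. q (?i (h x)) = x"
    using projectiveD[OF assms(4) G PP(3) qi rhom_id] by auto
  show ?thesis
    using q(1) rhom_comp[OF h(1) i] h(2) by (intro exI[of _ n] bexI[of _ q] bexI[of _ "\<lambda>x. ?i (h x)"])
qed

section \<open>The Auslander--Reiten translate and lifting\<close>

text \<open>A submodule \<open>W\<close> maximal among those containing \<open>U\<close> but not
  \<open>u0\<close> is a complement of the line through \<open>u0\<close>, and the functional reads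
  off the coefficient of \<open>u0\<close>. Zorn's lemma is used because the space in question, all
  functions on the carrier of a module, need not have finite dimension.\<close>

lemma linear_functional_separates:
  fixes H :: "('k::field, 'v) module"
  assumes "right_module H" "rsubmodule U H" "u0 \<in> carrier H" "u0 \<notin> U"
  shows "\<exists>\<phi>\<in>rhom H regular_module. (\<forall>u\<in>U. \<phi> u = 0) \<and> \<phi> u0 = 1"
proof -
  interpret right_module H by fact
  let ?C = "{W. rsubmodule W H \<and> U \<subseteq> W \<and> u0 \<notin> W}"
  have "\<exists>W\<in>?C. \<forall>V\<in>?C. W \<subseteq> V \<longrightarrow> V = W"
  proof (rule subset_Zorn_nonempty)
    show "?C \<noteq> {}" using assms by auto
    fix \<C> assume ne: "\<C> \<noteq> {}" and ch: "subset.chain ?C \<C>"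
    have sub: "rsubmodule W H" if "W \<in> \<C>" for W using ch that by (auto simp: subset.chain_def)
    note D = rsubmoduleD[OF sub]
    have "rsubmodule (\<Union>\<C>) H"
    proof (rule rsubmoduleI)
      show "\<Union>\<C> \<subseteq> carrier H" using D(1) by auto
      show "\<zero>\<^bsub>H\<^esub> \<in> \<Union>\<C>" using D(2) ne by auto
      show "x \<oplus>\<^bsub>H\<^esub> y \<in> \<Union>\<C>" if xy: "x \<in> \<Union>\<C>" "y \<in> \<Union>\<C>" for x y
      proof -
        obtain V W where V: "V \<in> \<C>" "x \<in> V" "W \<in> \<C>" "y \<in> W" using xy by auto
        moreover have "V \<subseteq> W \<or> W \<subseteq> V" using ch V(1,3) unfolding subset.chain_def by blast
        ultimately show ?thesis using D(3)[of V x y] D(3)[of W x y] by auto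
      qed
      show "a \<odot>\<^bsub>H\<^esub> x \<in> \<Union>\<C>" if "x \<in> \<Union>\<C>" for a x using that D(4) by auto
    qed
    then show "\<Union>\<C> \<in> ?C" using ne ch by (auto simp: subset.chain_def)
  qed
  then obtain W where W: "rsubmodule W H" "U \<subseteq> W" "u0 \<notin> W"
    and max: "\<And>V. rsubmodule V H \<Longrightarrow> U \<subseteq> V \<Longrightarrow> u0 \<notin> V \<Longrightarrow> W \<subseteq> V \<Longrightarrow> V = W"
    by auto
  note WD = rsubmoduleD[OF W(1)]
  have Wc: "w \<in> carrier H" if "w \<in> W" for w using WD(1) that by auto
  have ex: "\<exists>c. \<exists>w\<in>W. u = w \<oplus>\<^bsub>H\<^esub> c \<odot>\<^bsub>H\<^esub> u0" if u: "u \<in> carrier H" for u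
  proof (cases "u \<in> W")
    case True
    then show ?thesis using assms(3) Wc by (intro exI[of _ 0] bexI[of _ u]) auto
  next
    case False
    let ?V = "{w \<oplus>\<^bsub>H\<^esub> a \<odot>\<^bsub>H\<^esub> u | w a. w \<in> W}"
    have WV: "W \<subseteq> ?V"
    proof
      fix w assume "w \<in> W"
      then have "w = w \<oplus>\<^bsub>H\<^esub> 0 \<odot>\<^bsub>H\<^esub> u" using u Wc by simp
      then show "w \<in> ?V" using \<open>w \<in> W\<close> by blast
    qed
    have "u = \<zero>\<^bsub>H\<^esub> \<oplus>\<^bsub>H\<^esub> 1 \<odot>\<^bsub>H\<^esub> u" using u by (simp add: smult_one)
    then have uV: "u \<in> ?V" using WD(2) by blast
    have "rsubmodule ?V H"
    proof (rule rsubmoduleI)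
      show "?V \<subseteq> carrier H" using u Wc smult_closed by auto
      show "\<zero>\<^bsub>H\<^esub> \<in> ?V" using WV WD(2) by blast
      fix x assume "x \<in> ?V"
      then obtain w a where w: "w \<in> W" "x = w \<oplus>\<^bsub>H\<^esub> a \<odot>\<^bsub>H\<^esub> u" by auto
      have "b \<odot>\<^bsub>H\<^esub> x = b \<odot>\<^bsub>H\<^esub> w \<oplus>\<^bsub>H\<^esub> (a * b) \<odot>\<^bsub>H\<^esub> u" for b
        using w u Wc by (simp add: smult_r_distr smult_assoc smult_closed)
      then show "b \<odot>\<^bsub>H\<^esub> x \<in> ?V" for b using WD(4)[OF w(1)] by blast
      fix y assume "y \<in> ?V"
      then obtain w' a' where w': "w' \<in> W" "y = w' \<oplus>\<^bsub>H\<^esub> a' \<odot>\<^bsub>H\<^esub> u" by auto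
      have "x \<oplus>\<^bsub>H\<^esub> y = (w \<oplus>\<^bsub>H\<^esub> w') \<oplus>\<^bsub>H\<^esub> (a + a') \<odot>\<^bsub>H\<^esub> u"
        using w w' u Wc smult_closed by (simp add: smult_l_distr a_ac)
      then show "x \<oplus>\<^bsub>H\<^esub> y \<in> ?V" using WD(3)[OF w(1) w'(1)] by blast
    qed
    \<comment> \<open>Maximality applies because \<open>?V\<close> contains \<open>W\<close> and
      also \<open>u\<close>, which is not in \<open>W\<close>. The resulting equation for
      \<open>u0\<close> is then solved for \<open>u\<close>; its coefficient \<open>a\<close> is
      non-zero since \<open>u0\<close> is not in \<open>W\<close>.\<close>
    then have "u0 \<in> ?V" using max[of ?V] WV uV False W(2) by blast
    then obtain w a where w: "w \<in> W" "u0 = w \<oplus>\<^bsub>H\<^esub> a \<odot>\<^bsub>H\<^esub> u" by auto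
    have a: "a \<noteq> 0" using w W(3) u Wc by auto
    let ?b = "inverse a"
    have "(- ?b) \<odot>\<^bsub>H\<^esub> w \<oplus>\<^bsub>H\<^esub> ?b \<odot>\<^bsub>H\<^esub> u0 = (- ?b) \<odot>\<^bsub>H\<^esub> w \<oplus>\<^bsub>H\<^esub> (?b \<odot>\<^bsub>H\<^esub> w \<oplus>\<^bsub>H\<^esub> (a * ?b) \<odot>\<^bsub>H\<^esub> u)"
      using w(2) Wc[OF w(1)] u smult_closed by (simp add: smult_r_distr flip: smult_assoc)
    also have "\<dots> = u"
      using a Wc[OF w(1)] u smult_closed by (simp add: smult_one smult_neg_left r_neg1)
    finally show ?thesis using WD(4)[OF w(1)] by metis
  qed
  have uniq: "c = d" if eq: "w \<oplus>\<^bsub>H\<^esub> c \<odot>\<^bsub>H\<^esub> u0 = v \<oplus>\<^bsub>H\<^esub> d \<odot>\<^bsub>H\<^esub> u0" and wv: "w \<in> W" "v \<in> W" for c d w v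
  proof (rule ccontr)
    assume cd: "c \<noteq> d"
    have m: "(c - d) \<odot>\<^bsub>H\<^esub> u0 = c \<odot>\<^bsub>H\<^esub> u0 \<ominus>\<^bsub>H\<^esub> d \<odot>\<^bsub>H\<^esub> u0"
      using smult_l_distr[OF assms(3), of c "- d"] smult_neg_left[OF assms(3)] by (simp add: a_minus_def)
    have "\<ominus>\<^bsub>H\<^esub> w \<oplus>\<^bsub>H\<^esub> v = \<ominus>\<^bsub>H\<^esub> w \<oplus>\<^bsub>H\<^esub> ((v \<oplus>\<^bsub>H\<^esub> d \<odot>\<^bsub>H\<^esub> u0) \<ominus>\<^bsub>H\<^esub> d \<odot>\<^bsub>H\<^esub> u0)"
      using wv Wc assms(3) smult_closed by (simp add: a_minus_def a_assoc r_neg)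
    also have "\<dots> = c \<odot>\<^bsub>H\<^esub> u0 \<ominus>\<^bsub>H\<^esub> d \<odot>\<^bsub>H\<^esub> u0"
      using wv Wc assms(3) smult_closed by (simp add: a_minus_def a_assoc r_neg1 flip: eq)
    finally have "(c - d) \<odot>\<^bsub>H\<^esub> u0 \<in> W" using m wv WD(3,5) by metis
    from WD(4)[OF this, of "inverse (c - d)"] cd W(3) assms(3) show False
      by (simp add: smult_one flip: smult_assoc)
  qed
  define \<phi> where "\<phi> u = (THE c. \<exists>w\<in>W. u = w \<oplus>\<^bsub>H\<^esub> c \<odot>\<^bsub>H\<^esub> u0)" for u
  have \<phi>: "\<phi> u = c" if "w \<in> W" "u = w \<oplus>\<^bsub>H\<^esub> c \<odot>\<^bsub>H\<^esub> u0" for u w c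
    unfolding \<phi>_def using that uniq by (intro the_equality) blast+
  have "\<phi> \<in> rhom H regular_module"
  proof (rule rhomI)
    fix x assume "x \<in> carrier H"
    then obtain w c where w: "w \<in> W" "x = w \<oplus>\<^bsub>H\<^esub> c \<odot>\<^bsub>H\<^esub> u0" using ex by blast
    have "a \<odot>\<^bsub>H\<^esub> x = a \<odot>\<^bsub>H\<^esub> w \<oplus>\<^bsub>H\<^esub> (c * a) \<odot>\<^bsub>H\<^esub> u0" for a
      using w assms(3) Wc by (simp add: smult_r_distr smult_assoc smult_closed)
    then show "\<phi> (a \<odot>\<^bsub>H\<^esub> x) = a \<odot>\<^bsub>regular_module\<^esub> \<phi> x" for a
      using \<phi>[OF WD(4)[OF w(1)], of "a \<odot>\<^bsub>H\<^esub> x" a "c * a"] \<phi>[OF w] by simp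
    fix y assume "y \<in> carrier H"
    then obtain v d where v: "v \<in> W" "y = v \<oplus>\<^bsub>H\<^esub> d \<odot>\<^bsub>H\<^esub> u0" using ex by blast
    have "x \<oplus>\<^bsub>H\<^esub> y = (w \<oplus>\<^bsub>H\<^esub> v) \<oplus>\<^bsub>H\<^esub> (c + d) \<odot>\<^bsub>H\<^esub> u0"
      using w v assms(3) Wc smult_closed by (simp add: smult_l_distr a_ac)
    then show "\<phi> (x \<oplus>\<^bsub>H\<^esub> y) = \<phi> x \<oplus>\<^bsub>regular_module\<^esub> \<phi> y"
      using \<phi>[OF WD(3)[OF w(1) v(1)]] \<phi>[OF w] \<phi>[OF v] by simp
  qed simp
  moreover have "\<phi> u = 0" if "u \<in> U" for u
    using that W(2) Wc assms(3) by (intro \<phi>[of u]) auto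
  moreover have "\<phi> u0 = 1"
    by (rule \<phi>[OF WD(2)]) (use assms(3) in \<open>simp add: smult_one\<close>)
  ultimately show ?thesis by blast
qed

text \<open>The underlying vector space is presented as a right module over the field, so that
  \<open>dsum\<close>, \<open>rhom\<close> and the separation by functionals apply to it.\<close>

definition restrict_scalars :: "('k \<Rightarrow> 'a::ring_1 \<Rightarrow> 'a) \<Rightarrow> ('a, 'm) module \<Rightarrow> ('k, 'm) module" where
  "restrict_scalars scale K = \<lparr>
     carrier = carrier K, mult = undefined, one = undefined,
     zero = \<zero>\<^bsub>K\<^esub>, add = (\<oplus>\<^bsub>K\<^esub>), smult = (\<lambda>c x. scale c 1 \<odot>\<^bsub>K\<^esub> x)\<rparr>"

lemma restrict_scalars_simps [simp]:
  "carrier (restrict_scalars scale K) = carrier K" "\<zero>\<^bsub>restrict_scalars scale K\<^esub> = \<zero>\<^bsub>K\<^esub>"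
  "x \<oplus>\<^bsub>restrict_scalars scale K\<^esub> y = x \<oplus>\<^bsub>K\<^esub> y"
  "c \<odot>\<^bsub>restrict_scalars scale K\<^esub> x = scale c 1 \<odot>\<^bsub>K\<^esub> x"
  by (simp_all add: restrict_scalars_def)

lemma right_module_restrict_scalars:
  assumes "fd_algebra scale" "right_module K"
  shows "right_module (restrict_scalars scale K)"
proof -
  interpret right_module K by fact
  interpret vector_space scale using assms(1) by (simp add: fd_algebra_def)
  have mult: "scale (b * c) 1 = scale b 1 * scale c 1" for b c
    using assms(1) by (simp add: fd_algebra_def)
  show ?thesis
    by (rule right_moduleI)
      (auto simp: scale_left_distrib mult smult_l_distr smult_r_distr smult_assoc smult_closed smult_one a_ac)
qed

section \<open>The dual over the algebra and the transpose\<close>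

lemma A_dual_simps [simp]:
  "carrier (A_dual P) = rhom P regular_module \<inter> extensional (carrier P)"
  "\<zero>\<^bsub>A_dual P\<^esub> = (\<lambda>x\<in>carrier P. 0)"
  "g \<oplus>\<^bsub>A_dual P\<^esub> h = (\<lambda>x\<in>carrier P. g x + h x)"
  "a \<odot>\<^bsub>A_dual P\<^esub> h = (\<lambda>x\<in>carrier P. a * h x)"
  by (simp_all add: A_dual_def)

lemma A_dualI:
  assumes "h \<in> rhom P regular_module" "right_module P"
  shows "(\<lambda>x\<in>carrier P. h x) \<in> carrier (A_dual P)"
proof -
  interpret right_module P by fact
  show ?thesis using rhomD[OF assms(1)] by (auto simp: smult_closed intro!: rhomI)
qed

lemma A_dual_smult_closed:
  assumes "h \<in> carrier (A_dual P)" "right_module P"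
  shows "a \<odot>\<^bsub>A_dual P\<^esub> h \<in> carrier (A_dual P)"
proof -
  have "h \<in> rhom P regular_module" using assms(1) by simp
  then have "(\<lambda>x. a * h x) \<in> rhom P regular_module"
    by (intro rhomI) (simp_all add: rhomD distrib_left mult.assoc)
  from A_dualI[OF this assms(2)] show ?thesis by simp
qed

text \<open>The dual is a left module, so \<open>right_module\<close> does not describe it; the
  additive group is set up here, and scalars are treated by
  \<open>A_dual_smult_closed\<close>.\<close>

lemma abelian_group_A_dual:
  assumes "right_module P"
  shows "abelian_group (A_dual P)"
proof (rule abelian_groupI)
  interpret right_module P by fact
  show "\<zero>\<^bsub>A_dual P\<^esub> \<in> carrier (A_dual P)"
    using A_dualI[OF rhom_const_zero[OF right_module_regular] assms] by simp
  fix f assume f: "f \<in> carrier (A_dual P)"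
  then have fe: "(\<lambda>x\<in>carrier P. f x) = f" by (auto simp: extensional_restrict)
  show "\<zero>\<^bsub>A_dual P\<^esub> \<oplus>\<^bsub>A_dual P\<^esub> f = f"
    by (subst (2) fe[symmetric]) (auto intro!: restrict_ext)
  show "\<exists>g\<in>carrier (A_dual P). g \<oplus>\<^bsub>A_dual P\<^esub> f = \<zero>\<^bsub>A_dual P\<^esub>"
    using A_dual_smult_closed[OF f assms, of "- 1"]
    by (rule bexI[rotated]) (auto intro!: restrict_ext)
  fix g assume g: "g \<in> carrier (A_dual P)"
  show "f \<oplus>\<^bsub>A_dual P\<^esub> g \<in> carrier (A_dual P)"
    using A_dualI[OF rhom_add[OF _ _ right_module_regular] assms, of f g] f g by simp
  show "f \<oplus>\<^bsub>A_dual P\<^esub> g = g \<oplus>\<^bsub>A_dual P\<^esub> f"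
    by (auto intro!: restrict_ext)
  fix h assume "h \<in> carrier (A_dual P)"
  show "f \<oplus>\<^bsub>A_dual P\<^esub> g \<oplus>\<^bsub>A_dual P\<^esub> h = f \<oplus>\<^bsub>A_dual P\<^esub> (g \<oplus>\<^bsub>A_dual P\<^esub> h)"
    by (auto intro!: restrict_ext)
qed

text \<open>This is the image of \<open>Hom(f,A)\<close>, whose cokernel is the transpose;
  \<open>cls\<close> denotes a class in that cokernel.\<close>

definition pullbacks ::
    "('a::ring_1, 'm) module \<Rightarrow> ('a, 'm) module \<Rightarrow> ('m \<Rightarrow> 'm) \<Rightarrow> ('m \<Rightarrow> 'a) set" where
  "pullbacks P1 P0 f = (\<lambda>h. compose (carrier P1) h f) ` carrier (A_dual P0)"

abbreviation cls ::
    "('a::ring_1, 'm) module \<Rightarrow> ('a, 'm) module \<Rightarrow> ('m \<Rightarrow> 'm) \<Rightarrow> ('m \<Rightarrow> 'a) \<Rightarrow> ('m \<Rightarrow> 'a) set" where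
  "cls P1 P0 f \<alpha> \<equiv> pullbacks P1 P0 f +>\<^bsub>A_dual P1\<^esub> \<alpha>"

context
  fixes P1 P0 :: "('a::ring_1, 'm) module" and f
  assumes P: "right_module P1" "right_module P0" and f: "f \<in> rhom P1 P0"
begin

lemma pullbacks_closed:
  shows pullbacks_subset: "pullbacks P1 P0 f \<subseteq> carrier (A_dual P1)"
    and pullbacks_smult: "v \<in> pullbacks P1 P0 f \<Longrightarrow> a \<odot>\<^bsub>A_dual P1\<^esub> v \<in> pullbacks P1 P0 f"
    and pullbacks_add: "v \<in> pullbacks P1 P0 f \<Longrightarrow> w \<in> pullbacks P1 P0 f \<Longrightarrow> v \<oplus>\<^bsub>A_dual P1\<^esub> w \<in> pullbacks P1 P0 f"
    and pullbacks_zero: "\<zero>\<^bsub>A_dual P1\<^esub> \<in> pullbacks P1 P0 f"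
proof -
  interpret D0: abelian_group "A_dual P0" by (rule abelian_group_A_dual) (rule P)
  have c: "compose (carrier P1) h f = (\<lambda>x\<in>carrier P1. h (f x))" for h :: "'m \<Rightarrow> 'a"
    by (simp add: compose_def)
  show "pullbacks P1 P0 f \<subseteq> carrier (A_dual P1)"
  proof
    fix v assume "v \<in> pullbacks P1 P0 f"
    then obtain h where v: "v = (\<lambda>x\<in>carrier P1. h (f x))"
      and "h \<in> rhom P0 regular_module \<inter> extensional (carrier P0)"
      unfolding pullbacks_def c A_dual_simps by (rule imageE)
    then have h: "h \<in> rhom P0 regular_module" by simp
    show "v \<in> carrier (A_dual P1)" unfolding v by (rule A_dualI[OF rhom_comp[OF f h] P(1)])
  qed
  show "a \<odot>\<^bsub>A_dual P1\<^esub> v \<in> pullbacks P1 P0 f" if "v \<in> pullbacks P1 P0 f"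
  proof -
    from that obtain h where h: "v = (\<lambda>x\<in>carrier P1. h (f x))" "h \<in> carrier (A_dual P0)"
      unfolding pullbacks_def c by (rule imageE)
    have "a \<odot>\<^bsub>A_dual P1\<^esub> v = (\<lambda>x\<in>carrier P1. (a \<odot>\<^bsub>A_dual P0\<^esub> h) (f x))"
      using h(1) rhom_closed[OF f] by (auto intro!: restrict_ext)
    then show ?thesis using A_dual_smult_closed[OF h(2) P(2), of a] unfolding pullbacks_def c by (rule image_eqI)
  qed
  show "v \<oplus>\<^bsub>A_dual P1\<^esub> w \<in> pullbacks P1 P0 f" if vw: "v \<in> pullbacks P1 P0 f" "w \<in> pullbacks P1 P0 f"
  proof -
    from vw(1) obtain h where h: "v = (\<lambda>x\<in>carrier P1. h (f x))" "h \<in> carrier (A_dual P0)"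
      unfolding pullbacks_def c by (rule imageE)
    from vw(2) obtain g where g: "w = (\<lambda>x\<in>carrier P1. g (f x))" "g \<in> carrier (A_dual P0)"
      unfolding pullbacks_def c by (rule imageE)
    have "v \<oplus>\<^bsub>A_dual P1\<^esub> w = (\<lambda>x\<in>carrier P1. (h \<oplus>\<^bsub>A_dual P0\<^esub> g) (f x))"
      using h(1) g(1) rhom_closed[OF f] by (auto intro!: restrict_ext)
    then show ?thesis using D0.a_closed[OF h(2) g(2)] unfolding pullbacks_def c by (rule image_eqI)
  qed
  have "\<zero>\<^bsub>A_dual P1\<^esub> = (\<lambda>x\<in>carrier P1. \<zero>\<^bsub>A_dual P0\<^esub> (f x))"
    using rhom_closed[OF f] by (auto intro!: restrict_ext)
  then show "\<zero>\<^bsub>A_dual P1\<^esub> \<in> pullbacks P1 P0 f"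
    using D0.zero_closed unfolding pullbacks_def c by (rule image_eqI)
qed

lemma abelian_subgroup_pullbacks: "abelian_subgroup (pullbacks P1 P0 f) (A_dual P1)"
proof -
  interpret D: abelian_group "A_dual P1" by (rule abelian_group_A_dual) (rule P)
  have inv: "\<ominus>\<^bsub>A_dual P1\<^esub> v = (- 1) \<odot>\<^bsub>A_dual P1\<^esub> v" if "v \<in> carrier (A_dual P1)" for v
    using that A_dual_smult_closed[OF that P(1), of "- 1"]
    by (intro D.minus_equality) (auto intro!: restrict_ext)
  have "subgroup (pullbacks P1 P0 f) (add_monoid (A_dual P1))"
    using pullbacks_closed inv
    by (intro D.add.subgroupI) (auto simp: subset_iff simp del: A_dual_simps)
  then show ?thesis
    by (intro abelian_subgroupI3 additive_subgroup.intro D.abelian_group_axioms)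
qed

lemma transpose_module_eq: "transpose_module P1 f P0 = quot_module (A_dual P1) (pullbacks P1 P0 f)"
  by (simp add: transpose_module_def pullbacks_def)

lemma transpose_module_simps:
  shows transpose_carrier: "carrier (transpose_module P1 f P0) = cls P1 P0 f ` carrier (A_dual P1)"
    and transpose_add: "\<alpha> \<in> carrier (A_dual P1) \<Longrightarrow> \<beta> \<in> carrier (A_dual P1) \<Longrightarrow>
      cls P1 P0 f \<alpha> \<oplus>\<^bsub>transpose_module P1 f P0\<^esub> cls P1 P0 f \<beta> = cls P1 P0 f (\<alpha> \<oplus>\<^bsub>A_dual P1\<^esub> \<beta>)"
    and transpose_smult: "\<alpha> \<in> carrier (A_dual P1) \<Longrightarrow>
      a \<odot>\<^bsub>transpose_module P1 f P0\<^esub> cls P1 P0 f \<alpha> = cls P1 P0 f (a \<odot>\<^bsub>A_dual P1\<^esub> \<alpha>)"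
    and cls_mem: "\<alpha> \<in> carrier (A_dual P1) \<Longrightarrow> \<alpha> \<in> cls P1 P0 f \<alpha>"
    and cls_memD: "\<beta> \<in> cls P1 P0 f \<alpha> \<Longrightarrow> \<exists>v\<in>pullbacks P1 P0 f. \<beta> = v \<oplus>\<^bsub>A_dual P1\<^esub> \<alpha>"
proof -
  interpret abelian_subgroup "pullbacks P1 P0 f" "A_dual P1" by (rule abelian_subgroup_pullbacks)
  show "carrier (transpose_module P1 f P0) = cls P1 P0 f ` carrier (A_dual P1)"
    by (auto simp: transpose_module_eq quot_module_def A_RCOSETS_def' simp del: A_dual_simps)
  show "cls P1 P0 f \<alpha> \<oplus>\<^bsub>transpose_module P1 f P0\<^esub> cls P1 P0 f \<beta> = cls P1 P0 f (\<alpha> \<oplus>\<^bsub>A_dual P1\<^esub> \<beta>)"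
    if "\<alpha> \<in> carrier (A_dual P1)" "\<beta> \<in> carrier (A_dual P1)"
    using a_rcos_sum[OF that] by (simp add: transpose_module_eq quot_module_def del: A_dual_simps)
  show mem: "\<alpha> \<in> cls P1 P0 f \<alpha>" if "\<alpha> \<in> carrier (A_dual P1)" for \<alpha>
    using that by (rule a_rcos_self)
  show memD: "\<exists>v\<in>pullbacks P1 P0 f. \<beta> = v \<oplus>\<^bsub>A_dual P1\<^esub> \<alpha>" if "\<beta> \<in> cls P1 P0 f \<alpha>" for \<alpha> \<beta>
    using that by (auto simp: a_r_coset_def' simp del: A_dual_simps)
  show "a \<odot>\<^bsub>transpose_module P1 f P0\<^esub> cls P1 P0 f \<alpha> = cls P1 P0 f (a \<odot>\<^bsub>A_dual P1\<^esub> \<alpha>)"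
    if \<alpha>: "\<alpha> \<in> carrier (A_dual P1)"
  proof -
    \<comment> \<open>\<open>quot_module\<close> defines a scalar multiple as a union over all
      representatives. The cosets in this union all coincide, and the union is over a non-empty set,
      so it is a single coset.\<close>
    have eq: "cls P1 P0 f (a \<odot>\<^bsub>A_dual P1\<^esub> \<beta>) = cls P1 P0 f (a \<odot>\<^bsub>A_dual P1\<^esub> \<alpha>)" if \<beta>: "\<beta> \<in> cls P1 P0 f \<alpha>" for \<beta>
    proof -
      obtain v where v: "v \<in> pullbacks P1 P0 f" "\<beta> = v \<oplus>\<^bsub>A_dual P1\<^esub> \<alpha>" using memD[OF \<beta>] by auto
      have "a \<odot>\<^bsub>A_dual P1\<^esub> \<beta> = a \<odot>\<^bsub>A_dual P1\<^esub> v \<oplus>\<^bsub>A_dual P1\<^esub> a \<odot>\<^bsub>A_dual P1\<^esub> \<alpha>"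
        unfolding v(2) by (auto simp: distrib_left intro!: restrict_ext)
      then have "a \<odot>\<^bsub>A_dual P1\<^esub> \<beta> \<in> cls P1 P0 f (a \<odot>\<^bsub>A_dual P1\<^esub> \<alpha>)"
        using pullbacks_smult[OF v(1), of a] unfolding a_r_coset_def' by blast
      then show ?thesis
        using a_repr_independence[OF _ A_dual_smult_closed[OF \<alpha> P(1)] a_subgroup] by metis
    qed
    have "(\<Union>\<beta>\<in>cls P1 P0 f \<alpha>. cls P1 P0 f (a \<odot>\<^bsub>A_dual P1\<^esub> \<beta>)) = (\<Union>\<beta>\<in>cls P1 P0 f \<alpha>. cls P1 P0 f (a \<odot>\<^bsub>A_dual P1\<^esub> \<alpha>))"
      by (rule SUP_cong[OF refl eq])
    also have "\<dots> = cls P1 P0 f (a \<odot>\<^bsub>A_dual P1\<^esub> \<alpha>)"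
      using mem[OF \<alpha>] by (intro UN_constant_eq[of \<alpha>]) simp_all
    finally show ?thesis
      by (simp add: transpose_module_eq quot_module_def del: A_dual_simps)
  qed
qed

end

lemma k_dual_simps [simp]:
  "carrier (k_dual scale X) = {\<phi> \<in> extensional (carrier X).
       (\<forall>x\<in>carrier X. \<forall>y\<in>carrier X. \<phi> (x \<oplus>\<^bsub>X\<^esub> y) = \<phi> x + \<phi> y) \<and>
       (\<forall>c. \<forall>x\<in>carrier X. \<phi> (scale c 1 \<odot>\<^bsub>X\<^esub> x) = c * \<phi> x)}"
  "\<zero>\<^bsub>k_dual scale X\<^esub> = (\<lambda>x\<in>carrier X. 0)"
  "\<phi> \<oplus>\<^bsub>k_dual scale X\<^esub> \<psi> = (\<lambda>x\<in>carrier X. \<phi> x + \<psi> x)"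
  "a \<odot>\<^bsub>k_dual scale X\<^esub> \<phi> = (\<lambda>x\<in>carrier X. \<phi> (a \<odot>\<^bsub>X\<^esub> x))"
  by (simp_all add: k_dual_def)

text \<open>If \<open>Hom(f,K)\<close> were not surjective, a functional \<open>\<phi>\<close> vanishing on its image would give the non-zero
  map \<open>y \<mapsto> (\<alpha> \<mapsto> \<phi>(\<alpha>(-) y))\<close> from \<open>K\<close> to \<open>\<tau>M\<close>; it is non-zero because the maps \<open>\<alpha>(-) y\<close> span
  \<open>Hom(P1,K)\<close> by the dual basis of \<open>P1\<close>.\<close>

lemma Hom_zero_translate_imp_extends:
  fixes scale :: "'k::alg_closed_field \<Rightarrow> 'a::ring_1 \<Rightarrow> 'a" and M K P1 P0 :: "('a, 'm) module"
  assumes A: "fd_algebra scale" and M: "right_module M" "\<not> zero_module M"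
    and P: "projective P1" "right_module P0" and f: "f \<in> rhom P1 P0"
    and hom: "Hom_zero M (k_dual scale (transpose_module P1 f P0))"
    and K: "right_module K" "generates M K" and w: "w \<in> rhom P1 K"
  shows "\<exists>u\<in>rhom P0 K. \<forall>x\<in>carrier P1. u (f x) = w x"
proof (rule ccontr)
  assume neg: "\<not> ?thesis"
  have P1: "right_module P1" using P(1) by (simp add: projective_def modA_def)
  interpret K: right_module K by fact
  let ?D = "A_dual P1" and ?T = "transpose_module P1 f P0"
  let ?N = "k_dual scale ?T"
  let ?Kk = "restrict_scalars scale K"
  \<comment> \<open>All functions from the carrier of \<open>P1\<close> to \<open>K\<close> form the
    ambient vector space. Homomorphisms enter it as restricted functions, and \<open>U\<close> is
    the image of \<open>Hom(f,K)\<close>; thus the functional is obtained without making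
    \<open>Hom(P1,K)\<close> a module.\<close>
  let ?H = "dsum (carrier P1) (\<lambda>_. ?Kk)"
  have Kk: "right_module ?Kk" by (rule right_module_restrict_scalars[OF A K(1)])
  have H: "right_module ?H" using Kk by (rule right_module_dsum)
  interpret H: right_module ?H by (rule H)
  \<comment> \<open>Scalars are central in the algebra, so a scalar multiple of a homomorphism into
    \<open>K\<close> is again one; \<open>U\<close> is a subspace for this reason.\<close>
  have central: "scale c 1 * a = a * scale c 1" for c a using A by (simp add: fd_algebra_def)
  let ?r = "\<lambda>u. \<lambda>x\<in>carrier P1. u x"
  define U where "U = {?r (\<lambda>x. u (f x)) | u. u \<in> rhom P0 K}"
  have UI: "z \<in> U" if "u \<in> rhom P0 K" "z = ?r (\<lambda>x. u (f x))" for z u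
    unfolding U_def using that by blast
  have U: "rsubmodule U ?H"
  proof (rule H.rsubmoduleI)
    show "U \<subseteq> carrier ?H" using rhom_closed[OF f] rhom_closed[of _ P0 K] by (auto simp: U_def)
    show "\<zero>\<^bsub>?H\<^esub> \<in> U"
      by (rule UI[OF rhom_const_zero[OF K(1)]]) simp
  next
    fix x y assume "x \<in> U" "y \<in> U"
    then obtain u v where uv: "u \<in> rhom P0 K" "v \<in> rhom P0 K" "x = ?r (\<lambda>x. u (f x))" "y = ?r (\<lambda>x. v (f x))"
      unfolding U_def by auto
    show "x \<oplus>\<^bsub>?H\<^esub> y \<in> U"
      by (rule UI[OF rhom_add[OF uv(1,2) K(1)]]) (auto simp: uv(3,4) intro!: restrict_ext)
  next
    fix c x assume "x \<in> U"
    then obtain u where u: "u \<in> rhom P0 K" "x = ?r (\<lambda>x. u (f x))" unfolding U_def by auto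
    have "(\<lambda>z. scale c 1 \<odot>\<^bsub>K\<^esub> u z) \<in> rhom P0 K"
      using rhomD[OF u(1)]
      by (intro rhomI) (simp_all add: K.smult_closed K.smult_r_distr central flip: K.smult_assoc)
    then show "c \<odot>\<^bsub>?H\<^esub> x \<in> U"
      by (rule UI) (auto simp: u(2) intro!: restrict_ext)
  qed
  have wH: "?r w \<in> carrier ?H" using rhom_closed[OF w] by simp
  have "?r w \<notin> U"
  proof
    assume "?r w \<in> U"
    then obtain u where u: "u \<in> rhom P0 K" "?r w = ?r (\<lambda>x. u (f x))" unfolding U_def by auto
    have "\<forall>x\<in>carrier P1. u (f x) = w x" using fun_cong[OF u(2)] by (metis restrict_apply')
    then show False using neg u(1) by blast
  qed
  then obtain \<phi> where \<phi>: "\<phi> \<in> rhom ?H regular_module" "\<And>u. u \<in> U \<Longrightarrow> \<phi> u = 0" "\<phi> (?r w) = 1"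
    using linear_functional_separates[OF H U wH] by auto
  note \<phi>_add = rhom_plus[OF \<phi>(1), unfolded regular_module_simps]
    and \<phi>_smult = rhom_smult[OF \<phi>(1), unfolded regular_module_simps]
  define ev where "ev \<alpha> y = ?r (\<lambda>x. \<alpha> x \<odot>\<^bsub>K\<^esub> y)" for \<alpha> :: "'m \<Rightarrow> 'a" and y
  have ev: "ev \<alpha> y \<in> carrier ?H" if "y \<in> carrier K" for \<alpha> y
    using that by (simp add: ev_def K.smult_closed)
  have ev_add: "ev (\<alpha> \<oplus>\<^bsub>?D\<^esub> \<beta>) y = ev \<alpha> y \<oplus>\<^bsub>?H\<^esub> ev \<beta> y" if "y \<in> carrier K" for \<alpha> \<beta> y
    using that by (auto simp: ev_def K.smult_l_distr intro!: restrict_ext)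
  have ev_plus: "ev \<alpha> (y \<oplus>\<^bsub>K\<^esub> z) = ev \<alpha> y \<oplus>\<^bsub>?H\<^esub> ev \<alpha> z" if "y \<in> carrier K" "z \<in> carrier K" for \<alpha> y z
    using that by (auto simp: ev_def K.smult_r_distr intro!: restrict_ext)
  have ev_smult: "ev \<alpha> (a \<odot>\<^bsub>K\<^esub> y) = ev (a \<odot>\<^bsub>?D\<^esub> \<alpha>) y" if "y \<in> carrier K" for \<alpha> a y
    using that by (auto simp: ev_def simp flip: K.smult_assoc intro!: restrict_ext)
  have ev_scale: "ev (scale c 1 \<odot>\<^bsub>?D\<^esub> \<alpha>) y = c \<odot>\<^bsub>?H\<^esub> ev \<alpha> y" if "y \<in> carrier K" for \<alpha> c y
    using that by (auto simp: ev_def central simp flip: K.smult_assoc intro!: restrict_ext)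
  have ev_zero: "ev \<alpha> \<zero>\<^bsub>K\<^esub> = \<zero>\<^bsub>?H\<^esub>" for \<alpha>
    by (auto simp: ev_def intro!: restrict_ext)
  \<comment> \<open>If \<open>v\<close> is \<beta> composed with \<open>f\<close>, then
    \<open>ev v y\<close> is the map \<open>z \<mapsto> \<beta> z \<odot> y\<close> composed with
    \<open>f\<close> and lies in \<open>U\<close>. Hence \<phi> descends to classes in the
    transpose, and \<open>h\<close> does not depend on the chosen representatives.\<close>
  have ev_pb: "\<phi> (ev v y) = 0" if v: "v \<in> pullbacks P1 P0 f" and y: "y \<in> carrier K" for v y
  proof -
    obtain \<beta> where \<beta>: "\<beta> \<in> rhom P0 regular_module" "v = compose (carrier P1) \<beta> f"
      using v by (auto simp: pullbacks_def)
    have "ev v y \<in> U"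
      by (rule UI[OF rhom_comp[OF \<beta>(1) regular_module_rhom[OF K(1) y]]])
        (auto simp: ev_def \<beta>(2) compose_def intro!: restrict_ext)
    then show ?thesis by (rule \<phi>(2))
  qed
  note pb = P1 P(2) f
  define h where "h y = (\<lambda>C\<in>carrier ?T. \<phi> (ev (SOME \<alpha>. \<alpha> \<in> C) y))" for y
  have h: "h y (cls P1 P0 f \<alpha>) = \<phi> (ev \<alpha> y)" if \<alpha>: "\<alpha> \<in> carrier ?D" and y: "y \<in> carrier K" for \<alpha> y
  proof -
    have "cls P1 P0 f \<alpha> \<in> carrier ?T" using \<alpha> unfolding transpose_carrier[OF pb] by (rule imageI)
    moreover have "(SOME \<beta>. \<beta> \<in> cls P1 P0 f \<alpha>) \<in> cls P1 P0 f \<alpha>"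
      by (rule someI[where P="\<lambda>\<beta>. \<beta> \<in> cls P1 P0 f \<alpha>"]) (rule cls_mem[OF pb \<alpha>])
    then obtain v where "v \<in> pullbacks P1 P0 f" "(SOME \<beta>. \<beta> \<in> cls P1 P0 f \<alpha>) = v \<oplus>\<^bsub>?D\<^esub> \<alpha>"
      using cls_memD[OF pb] by meson
    ultimately show ?thesis
      using \<phi>_add[OF ev[OF y] ev[OF y]] ev_pb[OF _ y] ev_add[OF y] by (simp add: h_def del: A_dual_simps dsum_simps)
  qed
  have ex: "\<exists>\<alpha>\<in>carrier ?D. C = cls P1 P0 f \<alpha>" if "C \<in> carrier ?T" for C
    using that unfolding transpose_carrier[OF pb] by (rule imageE) (rule bexI)
  interpret D: abelian_group ?D by (rule abelian_group_A_dual[OF P1])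
  note sm = A_dual_smult_closed[OF _ P1]
  have hN: "h \<in> rhom K ?N"
  proof (rule rhomI)
    fix y assume y: "y \<in> carrier K"
    have "h y (C \<oplus>\<^bsub>?T\<^esub> C') = h y C + h y C'" if C: "C \<in> carrier ?T" "C' \<in> carrier ?T" for C C'
    proof -
      obtain \<alpha> \<beta> where \<alpha>: "\<alpha> \<in> carrier ?D" "C = cls P1 P0 f \<alpha>" "\<beta> \<in> carrier ?D" "C' = cls P1 P0 f \<beta>"
        using ex C by meson
      show ?thesis
        unfolding \<alpha>(2,4) transpose_add[OF pb \<alpha>(1,3)] h[OF \<alpha>(1) y] h[OF \<alpha>(3) y]
          h[OF D.a_closed[OF \<alpha>(1,3)] y] ev_add[OF y] \<phi>_add[OF ev[OF y] ev[OF y]] ..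
    qed
    moreover have "h y (scale c 1 \<odot>\<^bsub>?T\<^esub> C) = c * h y C" if C: "C \<in> carrier ?T" for c C
    proof -
      obtain \<alpha> where \<alpha>: "\<alpha> \<in> carrier ?D" "C = cls P1 P0 f \<alpha>" using ex[OF C] by auto
      show ?thesis
        unfolding \<alpha>(2) transpose_smult[OF pb \<alpha>(1)] h[OF \<alpha>(1) y] h[OF sm[OF \<alpha>(1)] y]
          ev_scale[OF y] \<phi>_smult[OF ev[OF y]] by (rule mult.commute)
    qed
    ultimately show "h y \<in> carrier ?N" by (auto simp: h_def)
    show "h (a \<odot>\<^bsub>K\<^esub> y) = a \<odot>\<^bsub>?N\<^esub> h y" for a
    proof (rule extensionalityI[of _ "carrier ?T"])
      fix C assume C: "C \<in> carrier ?T"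
      then obtain \<alpha> where \<alpha>: "\<alpha> \<in> carrier ?D" "C = cls P1 P0 f \<alpha>" using ex by meson
      have "h (a \<odot>\<^bsub>K\<^esub> y) C = h y (a \<odot>\<^bsub>?T\<^esub> C)"
        unfolding \<alpha>(2) transpose_smult[OF pb \<alpha>(1)] h[OF \<alpha>(1) K.smult_closed[OF y]] h[OF sm[OF \<alpha>(1)] y]
          ev_smult[OF y] ..
      then show "h (a \<odot>\<^bsub>K\<^esub> y) C = (a \<odot>\<^bsub>?N\<^esub> h y) C" using C by simp
    qed (simp_all add: h_def)
    fix z assume z: "z \<in> carrier K"
    show "h (y \<oplus>\<^bsub>K\<^esub> z) = h y \<oplus>\<^bsub>?N\<^esub> h z"
    proof (rule extensionalityI[of _ "carrier ?T"])
      fix C assume C: "C \<in> carrier ?T"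
      then obtain \<alpha> where \<alpha>: "\<alpha> \<in> carrier ?D" "C = cls P1 P0 f \<alpha>" using ex by meson
      have "h (y \<oplus>\<^bsub>K\<^esub> z) C = h y C + h z C"
        unfolding \<alpha>(2) h[OF \<alpha>(1) K.a_closed[OF y z]] h[OF \<alpha>(1) y] h[OF \<alpha>(1) z] ev_plus[OF y z]
          \<phi>_add[OF ev[OF y] ev[OF z]] ..
      then show "h (y \<oplus>\<^bsub>K\<^esub> z) C = (h y \<oplus>\<^bsub>?N\<^esub> h z) C" using C by simp
    qed (simp_all add: h_def)
  qed
  \<comment> \<open>\<open>Hom_zero\<close> is given for \<open>M\<close> only. The submodule
    \<open>?Z\<close> of \<open>K\<close> contains all images of \<open>M\<close>, which generates
    \<open>K\<close>; arguing inside \<open>K\<close> avoids establishing the module axioms for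
    \<open>?N\<close>.\<close>
  let ?Z = "{y \<in> carrier K. \<forall>\<alpha>\<in>carrier ?D. \<phi> (ev \<alpha> y) = 0}"
  have "?Z = carrier K"
  proof (rule generatesD[OF K(2)])
    have "\<phi> \<zero>\<^bsub>?H\<^esub> = 0" using rhom_zero[OF \<phi>(1) H right_module_regular] by simp
    then show "rsubmodule ?Z K"
      by (intro K.rsubmoduleI)
        (auto simp: ev_zero ev_plus ev_smult \<phi>_add ev sm K.smult_closed simp del: A_dual_simps dsum_simps)
    fix g x assume g: "g \<in> rhom M K" and x: "x \<in> carrier M"
    have gx: "g x \<in> carrier K" using rhom_closed[OF g x] .
    have z: "h (g x) = \<zero>\<^bsub>?N\<^esub>" using hom rhom_comp[OF g hN] x unfolding Hom_zero_def by fast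
    have "\<phi> (ev \<alpha> (g x)) = 0" if \<alpha>: "\<alpha> \<in> carrier ?D" for \<alpha>
    proof -
      have "cls P1 P0 f \<alpha> \<in> carrier ?T" using \<alpha> unfolding transpose_carrier[OF pb] by (rule imageI)
      then have "h (g x) (cls P1 P0 f \<alpha>) = 0" by (simp add: z)
      then show ?thesis unfolding h[OF \<alpha> gx] .
    qed
    then show "g x \<in> ?Z" using gx by blast
  qed
  then have ev0: "\<phi> (ev \<alpha> y) = 0" if "\<alpha> \<in> carrier ?D" "y \<in> carrier K" for \<alpha> y using that by blast
  obtain n :: nat and q s where q: "q \<in> rhom (dsum {..<n} (\<lambda>_. regular_module)) P1"
    and s: "s \<in> rhom P1 (dsum {..<n} (\<lambda>_. regular_module))" and qs: "\<And>x. x \<in> carrier P1 \<Longrightarrow> q (s x) = x"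
    using projective_dual_basis[OF A M P(1)] by metis
  let ?R = "\<lambda>_::nat. regular_module :: ('a, 'a) module"
  let ?F = "dsum {..<n} ?R"
  have F: "right_module ?F" using right_module_regular by (rule right_module_dsum)
  have v: "(\<lambda>z. w (q z)) \<in> rhom ?F K" by (rule rhom_comp[OF q w])
  note cut = dcut_simps[where I="{..<n}" and N="?R", OF right_module_regular rhom_closed[OF s]]
  \<comment> \<open>Since \<open>q (s x) = x\<close>, the map \<open>w\<close> is a finite sum of
    maps \<open>ev \<alpha> y\<close>, where \<alpha> is the \<open>i\<close>-th coordinate of
    \<open>s\<close> and \<open>y\<close> is the value of \<open>w\<close> at the image under
    \<open>q\<close> of the \<open>i\<close>-th unit vector. Truncation to \<open>J\<close> yields
    the partial sums.\<close>
  have "\<phi> (?r (\<lambda>x. w (q (dcut {..<n} ?R J (s x))))) = 0" if "finite J" "J \<subseteq> {..<n}" for J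
    using that
  proof (induction J rule: finite_induct)
    case empty
    have "?r (\<lambda>x. w (q (dcut {..<n} ?R {} (s x)))) = \<zero>\<^bsub>?H\<^esub>"
      using cut(2) rhom_zero[OF v F K(1)] by (auto simp del: dsum_simps(2) intro!: restrict_ext simp: dsum_simps(2)[where N="\<lambda>_. ?Kk"])
    then show ?case
      using rhom_zero[OF \<phi>(1) H right_module_regular] by (simp only: regular_module_simps)
  next
    case (insert i J)
    then have i: "i \<in> {..<n}" by simp
    have inj: "dinj {..<n} ?R i \<in> rhom regular_module ?F"
      using dinj_rhom[where I="{..<n}" and N="?R", OF right_module_regular i] .
    note vi = rhom_comp[OF inj v]
    define y where "y = w (q (dinj {..<n} ?R i 1))"
    have y: "y \<in> carrier K" using rhom_closed[OF vi, of 1] by (simp add: y_def)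
    have lin: "w (q (dinj {..<n} ?R i a)) = a \<odot>\<^bsub>K\<^esub> y" for a
      using rhom_smult[OF vi, of 1 a] by (simp add: y_def)
    define \<alpha> where "\<alpha> = ?r (\<lambda>x. s x i)"
    have \<alpha>: "\<alpha> \<in> carrier ?D"
      unfolding \<alpha>_def by (rule A_dualI[OF rhom_comp[OF s dsum_proj[where N="?R", OF i]] P1])
    let ?u = "?r (\<lambda>x. w (q (dcut {..<n} ?R J (s x))))"
    have "?u \<in> carrier ?H" using rhom_closed[OF v cut(1)] by (simp del: dsum_simps add: dsum_simps(1)[where N="\<lambda>_. ?Kk"])
    moreover have "w (q (dcut {..<n} ?R (insert i J) (s x))) =
        w (q (dcut {..<n} ?R J (s x))) \<oplus>\<^bsub>K\<^esub> s x i \<odot>\<^bsub>K\<^esub> y" if x: "x \<in> carrier P1" for x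
      unfolding cut(4)[OF x i insert.hyps(2)] lin[symmetric]
      by (rule rhom_plus[OF v cut(1)[OF x] rhom_closed[OF inj]]) simp
    then have "?r (\<lambda>x. w (q (dcut {..<n} ?R (insert i J) (s x)))) = ?u \<oplus>\<^bsub>?H\<^esub> ev \<alpha> y"
      by (auto simp: ev_def \<alpha>_def intro!: restrict_ext)
    moreover have "\<phi> ?u = 0" by (rule insert.IH) (use insert.prems in simp)
    ultimately show ?case
      using \<phi>_add[of ?u "ev \<alpha> y"] ev[OF y, of \<alpha>] ev0[OF \<alpha> y] by (simp only: add_0)
  qed
  from this[of "{..<n}"] have "\<phi> (?r (\<lambda>x. w (q (dcut {..<n} ?R {..<n} (s x))))) = 0" by simp
  moreover have "?r (\<lambda>x. w (q (dcut {..<n} ?R {..<n} (s x)))) = ?r w"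
    using cut(3) qs by (auto intro!: restrict_ext)
  ultimately show False using \<phi>(3) by simp
qed

section \<open>Factorisation through quotients and the lifting property\<close>

lemma rhom_factor:
  assumes g: "g \<in> rhom X Y" "g ` carrier X = carrier Y" and l: "l \<in> rhom X E"
    and X: "right_module X" "right_module Y" "right_module E"
    and ker: "\<And>x. x \<in> carrier X \<Longrightarrow> g x = \<zero>\<^bsub>Y\<^esub> \<Longrightarrow> l x = \<zero>\<^bsub>E\<^esub>"
  shows "\<exists>s\<in>rhom Y E. \<forall>x\<in>carrier X. s (g x) = l x"
proof -
  interpret X: right_module X by fact
  have wd: "l x = l y" if "x \<in> carrier X" "y \<in> carrier X" "g x = g y" for x y
  proof -
    have "g (x \<ominus>\<^bsub>X\<^esub> y) = \<zero>\<^bsub>Y\<^esub>"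
      using that rhom_diff[OF g(1) X(1,2)] right_module_diff_zero_iff[OF X(2)] rhom_closed[OF g(1)]
      by simp
    then have "l (x \<ominus>\<^bsub>X\<^esub> y) = \<zero>\<^bsub>E\<^esub>" using ker that by simp
    then show ?thesis
      using that rhom_diff[OF l X(1,3)] right_module_diff_zero_iff[OF X(3)] rhom_closed[OF l] by simp
  qed
  define s where "s y = l (inv_into (carrier X) g y)" for y
  have s: "s (g x) = l x" if "x \<in> carrier X" for x
    unfolding s_def using that by (intro wd) (auto simp: inv_into_into f_inv_into_f)
  have "s \<in> rhom Y E"
  proof (rule rhomI)
    fix y assume "y \<in> carrier Y"
    then obtain x where x: "x \<in> carrier X" "y = g x" using g(2) by auto
    show "s y \<in> carrier E" unfolding x(2) s[OF x(1)] by (rule rhom_closed[OF l x(1)])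
    show "s (a \<odot>\<^bsub>Y\<^esub> y) = a \<odot>\<^bsub>E\<^esub> s y" for a
      using s[OF X.smult_closed[OF x(1)]] s[OF x(1)] rhom_smult[OF g(1) x(1)] rhom_smult[OF l x(1)] x(2)
      by simp
    fix z assume "z \<in> carrier Y"
    then obtain w where w: "w \<in> carrier X" "z = g w" using g(2) by auto
    show "s (y \<oplus>\<^bsub>Y\<^esub> z) = s y \<oplus>\<^bsub>E\<^esub> s z"
      using s[OF X.a_closed[OF x(1) w(1)]] s[OF x(1)] s[OF w(1)] rhom_plus[OF g(1) x(1) w(1)]
        rhom_plus[OF l x(1) w(1)] x(2) w(2)
      by simp
  qed
  then show ?thesis using s by blast
qed

text \<open>The type of \<open>L\<close> is kept apart from that of \<open>M\<close> because the
  property is used for partial direct sums, which live on a function type.\<close>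

definition lifting :: "('a::ring_1, 'm) module \<Rightarrow> ('a, 'x) module \<Rightarrow> bool" where
  "lifting M L \<longleftrightarrow>
     (\<forall>(E :: ('a, 'm) module) (Z :: ('a, 'm) module) p h.
        E \<in> modA \<and> Z \<in> modA \<and> p \<in> rhom E Z \<and> p ` carrier E = carrier Z \<and>
        generates M (rsub E (rker E Z p)) \<and> h \<in> rhom L Z \<longrightarrow>
        (\<exists>h'\<in>rhom L E. \<forall>x\<in>carrier L. p (h' x) = h x))"

lemma liftingD:
  fixes M E Z :: "('a::ring_1, 'm) module"
  assumes "lifting M L" "E \<in> modA" "Z \<in> modA" "p \<in> rhom E Z" "p ` carrier E = carrier Z"
    and "generates M (rsub E (rker E Z p))" "h \<in> rhom L Z"
  shows "\<exists>h'\<in>rhom L E. \<forall>x\<in>carrier L. p (h' x) = h x"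
  using assms(1)[unfolded lifting_def, rule_format, of E Z p h] assms(2-) by blast

text \<open>Projectivity of \<open>P0\<close> gives \<open>l : P0 \<rightarrow> E\<close> over
  \<open>h\<close> composed with \<open>g\<close>. On the image of \<open>f\<close> it takes values
  in the kernel of \<open>p\<close>, so \<open>l\<close> composed with \<open>f\<close> extends to a
  map \<open>u\<close> from \<open>P0\<close> into that kernel. The difference of \<open>l\<close>
  and \<open>u\<close> still lies over \<open>h\<close> composed with \<open>g\<close> and vanishes
  on the kernel of \<open>g\<close>, hence descends to \<open>M\<close>.\<close>

lemma tau_rigid_imp_lifting:
  fixes scale :: "'k::alg_closed_field \<Rightarrow> 'a::ring_1 \<Rightarrow> 'a" and M :: "('a, 'm) module"
  assumes "fd_algebra scale" "M \<in> modA" "\<not> zero_module M" "tau_rigid scale M"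
  shows "lifting M M"
  unfolding lifting_def
proof (intro allI impI, elim conjE)
  fix E Z :: "('a, 'm) module" and p h
  assume E: "E \<in> modA" and Z: "Z \<in> modA" and p: "p \<in> rhom E Z" "p ` carrier E = carrier Z"
    and gen: "generates M (rsub E (rker E Z p))" and h: "h \<in> rhom M Z"
  obtain P1 f P0 g where pres: "minimal_projective_presentation P1 f P0 g M"
    and hom: "Hom_zero M (k_dual scale (transpose_module P1 f P0))"
    using assms(4) unfolding tau_rigid_def is_AR_translate_def by auto
  have P: "projective P1" "projective P0" "f \<in> rhom P1 P0" "g \<in> rhom P0 M"
    "g ` carrier P0 = carrier M" "f ` carrier P1 = rker P0 M g"
    using pres unfolding minimal_projective_presentation_def by auto
  have r: "right_module M" "right_module E" "right_module Z" "right_module P0" "right_module P1"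
    using assms(2) E Z P(1,2) by (auto simp: projective_def modA_def)
  obtain l where l: "l \<in> rhom P0 E" "\<And>x. x \<in> carrier P0 \<Longrightarrow> p (l x) = h (g x)"
    using projectiveD[OF P(2) E Z p(1) rhom_comp[OF P(4) h] p(2)] by auto
  note ker = rsubmodule_rker[OF p(1) r(2,3)]
  have gf: "f x \<in> carrier P0" "g (f x) = \<zero>\<^bsub>M\<^esub>" if "x \<in> carrier P1" for x
    using P(6) that by (auto simp: rker_def)
  have lf: "(\<lambda>x. l (f x)) \<in> rhom P1 (rsub E (rker E Z p))"
    using gf l rhom_zero[OF h r(1,3)] rhom_closed[OF l(1)]
    by (intro rhom_rsub_cod rhom_comp[OF P(3) l(1)]) (auto simp: rker_def)
  obtain u where u: "u \<in> rhom P0 (rsub E (rker E Z p))" "\<And>x. x \<in> carrier P1 \<Longrightarrow> u (f x) = l (f x)"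
    using Hom_zero_translate_imp_extends[OF assms(1) r(1) assms(3) P(1) r(4) P(3) hom
        right_module_rsub[OF r(2) ker] gen lf] by auto
  have uE: "u \<in> rhom P0 E" by (rule rhom_rsub_codD[OF u(1) rsubmodule_subset[OF ker]])
  note l' = rhom_minus[OF l(1) uE r(2)]
  have "\<exists>s\<in>rhom M E. \<forall>x\<in>carrier P0. s (g x) = l x \<ominus>\<^bsub>E\<^esub> u x"
  proof (rule rhom_factor[OF P(4,5) l' r(4,1,2)])
    fix x assume "x \<in> carrier P0" "g x = \<zero>\<^bsub>M\<^esub>"
    then have "x \<in> f ` carrier P1" unfolding P(6) by (simp add: rker_def)
    then obtain y where "y \<in> carrier P1" "x = f y" by auto
    then show "l x \<ominus>\<^bsub>E\<^esub> u x = \<zero>\<^bsub>E\<^esub>"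
      using u(2) gf(1) rhom_closed[OF l(1)] right_module_diff_zero_iff[OF r(2)] by simp
  qed
  then obtain s where s: "s \<in> rhom M E" "\<And>x. x \<in> carrier P0 \<Longrightarrow> s (g x) = l x \<ominus>\<^bsub>E\<^esub> u x" by auto
  have "p (s m) = h m" if m: "m \<in> carrier M" for m
  proof -
    obtain x where x: "x \<in> carrier P0" "m = g x" using m P(5) by auto
    interpret Z: right_module Z by (rule r)
    have "p (u x) = \<zero>\<^bsub>Z\<^esub>" using rhom_closed[OF u(1) x(1)] by (simp add: rker_def)
    then have "p (l x \<ominus>\<^bsub>E\<^esub> u x) = h (g x)"
      using rhom_diff[OF p(1) r(2,3) rhom_closed[OF l(1) x(1)] rhom_closed[OF uE x(1)]] l(2)[OF x(1)]
        rhom_closed[OF h rhom_closed[OF P(4) x(1)]] by simp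
    then show ?thesis using s(2)[OF x(1)] x(2) by simp
  qed
  then show "\<exists>h'\<in>rhom M E. \<forall>x\<in>carrier M. p (h' x) = h x" using s(1) by blast
qed

lemma lifting_retract:
  fixes M :: "('a::ring_1, 'm) module"
  assumes "lifting M L" "i \<in> rhom L' L" "r \<in> rhom L L'" "\<And>x. x \<in> carrier L' \<Longrightarrow> r (i x) = x"
  shows "lifting M L'"
  unfolding lifting_def
proof (intro allI impI, elim conjE)
  fix E Z :: "('a, 'm) module" and p h
  assume a: "E \<in> modA" "Z \<in> modA" "p \<in> rhom E Z" "p ` carrier E = carrier Z"
    "generates M (rsub E (rker E Z p))" and h: "h \<in> rhom L' Z"
  obtain g where g: "g \<in> rhom L E" "\<And>x. x \<in> carrier L \<Longrightarrow> p (g x) = h (r x)"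
    using liftingD[OF assms(1) a rhom_comp[OF assms(3) h]] by auto
  show "\<exists>h'\<in>rhom L' E. \<forall>x\<in>carrier L'. p (h' x) = h x"
    using rhom_comp[OF assms(2) g(1)] g(2) rhom_closed[OF assms(2)] assms(4)
    by (intro bexI[of _ "\<lambda>x. g (i x)"]) auto
qed

lemma lifting_iso:
  assumes "lifting M L" "L \<cong>\<^sub>m L'" "right_module L"
  shows "lifting M L'"
proof -
  obtain h g where "h \<in> rhom L L'" "g \<in> rhom L' L" "\<And>y. y \<in> carrier L' \<Longrightarrow> h (g y) = y"
    using rmod_isoE[OF assms(2,3)] by metis
  then show ?thesis using lifting_retract[OF assms(1), of g L' h] by blast
qed

section \<open>Passing to partial direct sums\<close>

lemma dsum_restrict_rhom:
  assumes "J \<subseteq> I"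
  shows "(\<lambda>x. \<lambda>i\<in>J. x i) \<in> rhom (dsum I N) (dsum J N)"
proof (rule dsum_tuple)
  fix i assume "i \<in> J"
  then show "(\<lambda>x. x i) \<in> rhom (dsum I N) (N i)" using assms by (intro dsum_proj) auto
qed

lemma dsum_extend_rhom:
  assumes "\<And>i. i \<in> I \<Longrightarrow> right_module (N i)"
  shows "(\<lambda>x. \<lambda>i\<in>I. if i \<in> J then x i else \<zero>\<^bsub>N i\<^esub>) \<in> rhom (dsum J N) (dsum I N)"
proof (rule dsum_tuple)
  fix i assume i: "i \<in> I"
  show "(\<lambda>x. if i \<in> J then x i else \<zero>\<^bsub>N i\<^esub>) \<in> rhom (dsum J N) (N i)"
    by (cases "i \<in> J") (simp_all add: dsum_proj rhom_const_zero[OF assms[OF i]])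
qed

lemma dsum_restrict_extend:
  assumes "J \<subseteq> I" "x \<in> carrier (dsum J N)"
  shows "(\<lambda>i\<in>J. (\<lambda>i\<in>I. if i \<in> J then x i else \<zero>\<^bsub>N i\<^esub>) i) = x"
  using assms by (auto simp: fun_eq_iff PiE_iff extensional_def)

lemma lifting_dsum_subset:
  assumes "lifting M (dsum I N)" "J \<subseteq> I" "\<And>i. i \<in> I \<Longrightarrow> right_module (N i)"
  shows "lifting M (dsum J N)"
proof (rule lifting_retract[OF assms(1)])
  show "(\<lambda>x. \<lambda>i\<in>I. if i \<in> J then x i else \<zero>\<^bsub>N i\<^esub>) \<in> rhom (dsum J N) (dsum I N)"
    by (rule dsum_extend_rhom[OF assms(3)])
  show "(\<lambda>x. \<lambda>i\<in>J. x i) \<in> rhom (dsum I N) (dsum J N)"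
    by (rule dsum_restrict_rhom[OF assms(2)])
  show "(\<lambda>i\<in>J. (\<lambda>i\<in>I. if i \<in> J then x i else \<zero>\<^bsub>N i\<^esub>) i) = x" if "x \<in> carrier (dsum J N)" for x
    by (rule dsum_restrict_extend[OF assms(2) that])
qed

lemma generates_dsum_subset:
  assumes "J \<subseteq> I" "\<And>i. i \<in> I \<Longrightarrow> right_module (N i)"
  shows "generates (dsum I N) (dsum J N)"
proof (rule generates_surj[OF dsum_restrict_rhom[OF assms(1)]])
  show "(\<lambda>x. \<lambda>i\<in>J. x i) ` carrier (dsum I N) = carrier (dsum J N)" (is "?r ` _ = _")
  proof
    show "?r ` carrier (dsum I N) \<subseteq> carrier (dsum J N)"
      using rhom_closed[OF dsum_restrict_rhom[OF assms(1)]] by (rule image_subsetI)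
    show "carrier (dsum J N) \<subseteq> ?r ` carrier (dsum I N)"
    proof
      fix x assume x: "x \<in> carrier (dsum J N)"
      show "x \<in> ?r ` carrier (dsum I N)"
        by (rule image_eqI[where f="?r", OF dsum_restrict_extend[OF assms(1) x, symmetric]
              rhom_closed[OF dsum_extend_rhom[where I=I and N=N, OF assms(2)] x]])
    qed
  qed
qed

lemma lifting_dsum_component:
  assumes "lifting M (dsum I N)" "i \<in> I" "\<And>i. i \<in> I \<Longrightarrow> right_module (N i)"
  shows "lifting M (N i)"
proof (rule lifting_retract[OF assms(1)])
  show "dinj I N i \<in> rhom (N i) (dsum I N)"
    by (rule dinj_rhom[OF assms(3,2)])
  show "(\<lambda>x. x i) \<in> rhom (dsum I N) (N i)"
    by (rule dsum_proj[OF assms(2)])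
  show "dinj I N i x i = x" for x
    by (simp add: dinj_def assms(2))
qed

lemma lifting_imp_Ext1_zero:
  fixes M L Q :: "('a::ring_1, 'm) module"
  assumes "lifting M L" "L \<in> modA" "Q \<in> modA" "generates M Q"
  shows "Ext1_zero L Q"
  unfolding Ext1_zero_def
proof (intro allI impI, elim conjE)
  fix E :: "('a, 'm) module" and i p
  assume E: "E \<in> modA" and ex: "short_exact Q i E p L"
  note r = modA_right_module[OF E] modA_right_module[OF assms(2)] modA_right_module[OF assms(3)]
  have "generates M (rsub E (rker E L p))"
    using generates_image[OF assms(4) _ r(3,1), of i] ex unfolding short_exact_def by metis
  moreover have "p \<in> rhom E L" "p ` carrier E = carrier L" using ex by (auto simp: short_exact_def)
  ultimately show "\<exists>s\<in>rhom L E. \<forall>y\<in>carrier L. p (s y) = y"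
    using liftingD[OF assms(1) E assms(2) _ _ _ rhom_id] by blast
qed

section \<open>Torsion pairs\<close>

lemma Hom_zeroD: "\<lbrakk>Hom_zero X Y; h \<in> rhom X Y; x \<in> carrier X\<rbrakk> \<Longrightarrow> h x = \<zero>\<^bsub>Y\<^esub>"
  unfolding Hom_zero_def by blast

lemma short_exactD:
  assumes "short_exact S i X p Q"
  shows "i \<in> rhom S X" "p \<in> rhom X Q" "inj_on i (carrier S)" "i ` carrier S = rker X Q p"
    "p ` carrier X = carrier Q"
  using assms unfolding short_exact_def by auto

text \<open>Both torsion parts have the same image in \<open>X\<close>, since the composites from
  \<open>S\<close> to \<open>Q'\<close> and from \<open>S'\<close> to \<open>Q\<close> vanish. Hence
  \<open>p\<close> and \<open>p'\<close> have equal kernels, and everything is compared through this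
  common kernel.\<close>

lemma canonical_seq_unique:
  assumes modA: "fst TF \<subseteq> modA" "snd TF \<subseteq> modA" "X \<in> modA"
    and hom: "\<And>S Q. S \<in> fst TF \<Longrightarrow> Q \<in> snd TF \<Longrightarrow> Hom_zero S Q"
    and c: "canonical_seq TF X S i p Q" "canonical_seq TF X S' i' p' Q'"
  shows "\<exists>\<alpha>\<in>rhom S S'. \<exists>\<beta>\<in>rhom Q Q'.
           bij_betw \<alpha> (carrier S) (carrier S') \<and> bij_betw \<beta> (carrier Q) (carrier Q') \<and>
           (\<forall>x\<in>carrier S. i' (\<alpha> x) = i x) \<and> (\<forall>x\<in>carrier X. \<beta> (p x) = p' x)"
proof -
  have S: "S \<in> fst TF" "Q \<in> snd TF" and S': "S' \<in> fst TF" "Q' \<in> snd TF"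
    and se: "short_exact S i X p Q" and se': "short_exact S' i' X p' Q'"
    using c by (auto simp: canonical_seq_def)
  have r: "right_module X" "right_module S" "right_module Q" "right_module S'" "right_module Q'"
    using modA S S' modA_right_module by blast+
  note se = short_exactD[OF se] and se' = short_exactD[OF se']
  have im: "i x \<in> rker X Q' p'" if "x \<in> carrier S" for x
    using Hom_zeroD[OF hom[OF S(1) S'(2)] rhom_comp[OF se(1) se'(2)] that] rhom_closed[OF se(1) that]
    by (simp add: rker_def)
  have im': "i' x \<in> rker X Q p" if "x \<in> carrier S'" for x
    using Hom_zeroD[OF hom[OF S'(1) S(2)] rhom_comp[OF se'(1) se(2)] that] rhom_closed[OF se'(1) that]
    by (simp add: rker_def)
  have eq: "rker X Q p = rker X Q' p'"
  proof
    show "rker X Q p \<subseteq> rker X Q' p'" unfolding se(4)[symmetric] using im by auto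
    show "rker X Q' p' \<subseteq> rker X Q p" unfolding se'(4)[symmetric] using im' by auto
  qed
  let ?K = "rsub X (rker X Q p)"
  have K: "right_module ?K" by (rule right_module_rsub[OF r(1) rsubmodule_rker[OF se(2) r(1,3)]])
  have i: "i \<in> rhom S ?K" "bij_betw i (carrier S) (carrier ?K)"
    using rhom_rsub_cod[OF se(1)] se(3,4) by (auto simp: bij_betw_def)
  have i': "i' \<in> rhom S' ?K" "bij_betw i' (carrier S') (carrier ?K)"
    using rhom_rsub_cod[OF se'(1)] se'(3,4) eq by (auto simp: bij_betw_def)
  let ?\<alpha> = "\<lambda>x. inv_into (carrier S') i' (i x)"
  have \<alpha>: "?\<alpha> \<in> rhom S S'" by (rule rhom_comp[OF i(1) rhom_inv_into[OF i' r(4)]])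
  have \<alpha>b: "bij_betw ?\<alpha> (carrier S) (carrier S')"
    using bij_betw_trans[OF i(2) bij_betw_inv_into[OF i'(2)]] by (simp add: comp_def)
  have \<alpha>i: "i' (?\<alpha> x) = i x" if "x \<in> carrier S" for x
    using bij_betw_inv_into_right[OF i'(2)] rhom_closed[OF i(1) that] by blast
  have ker: "p x = \<zero>\<^bsub>Q\<^esub> \<longleftrightarrow> p' x = \<zero>\<^bsub>Q'\<^esub>" if "x \<in> carrier X" for x
    using eq that by (auto simp: rker_def)
  obtain \<beta> where \<beta>: "\<beta> \<in> rhom Q Q'" "\<And>x. x \<in> carrier X \<Longrightarrow> \<beta> (p x) = p' x"
    using rhom_factor[OF se(2,5) se'(2) r(1,3,5)] ker by auto
  have "rker Q Q' \<beta> = {\<zero>\<^bsub>Q\<^esub>}"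
  proof
    show "rker Q Q' \<beta> \<subseteq> {\<zero>\<^bsub>Q\<^esub>}"
    proof
      fix y assume y: "y \<in> rker Q Q' \<beta>"
      then obtain x where "x \<in> carrier X" "y = p x" using se(5) by (auto simp: rker_def)
      then show "y \<in> {\<zero>\<^bsub>Q\<^esub>}" using y \<beta>(2) ker by (auto simp: rker_def)
    qed
    show "{\<zero>\<^bsub>Q\<^esub>} \<subseteq> rker Q Q' \<beta>"
      using rsubmodule_zero[OF rsubmodule_rker[OF \<beta>(1) r(3,5)]] by simp
  qed
  then have "inj_on \<beta> (carrier Q)" by (rule rhom_inj_onI[OF \<beta>(1) r(3,5)])
  moreover have "\<beta> ` carrier Q = p' ` carrier X"
    unfolding se(5)[symmetric] image_image using \<beta>(2) by (auto intro!: image_cong)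
  ultimately have "bij_betw \<beta> (carrier Q) (carrier Q')" using se'(5) by (simp add: bij_betw_def)
  then show ?thesis using \<alpha> \<alpha>b \<alpha>i \<beta> by blast
qed

lemma Hom_zero_iso:
  assumes "Hom_zero X Y" "Y \<cong>\<^sub>m Z" "right_module Y" "right_module Z"
  shows "Hom_zero X Z"
proof -
  obtain h g where h: "h \<in> rhom Y Z" "g \<in> rhom Z Y" "\<And>z. z \<in> carrier Z \<Longrightarrow> h (g z) = z"
    using rmod_isoE[OF assms(2,3)] by metis
  have "k x = \<zero>\<^bsub>Z\<^esub>" if "k \<in> rhom X Z" "x \<in> carrier X" for k x
    using Hom_zeroD[OF assms(1) rhom_comp[OF that(1) h(2)] that(2)] h(3)[OF rhom_closed[OF that]]
      rhom_zero[OF h(1) assms(3,4)] by simp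
  then show ?thesis by (auto simp: Hom_zero_def)
qed

section \<open>The torsion pair generated by a lifting module\<close>

locale lifting_generator =
  fixes scale :: "'k::field \<Rightarrow> 'a::ring_1 \<Rightarrow> 'a" and M :: "('a, 'm) module"
    and X :: "('a, 'x) module"
  assumes fd: "fd_algebra scale" and X: "right_module X" and M: "right_module M"
    and lift: "lifting M X" and gen: "generates M X"
begin

text \<open>A map from \<open>X\<close> to the quotient of \<open>Y\<close> by the trace lifts to a
  map from \<open>X\<close> to \<open>Y\<close>. Its image lies in the trace by definition, so the
  original map is zero.\<close>

lemma Fac_canonical_seq:
  fixes Y :: "('a, 'm) module"
  assumes "Y \<in> modA"
  shows "\<exists>S i p Q. canonical_seq (Fac X, rperp {X}) Y S i p Q"
proof -
  have Y: "right_module Y" by (rule modA_right_module[OF assms])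
  note tr = rsubmodule_trace[OF Y, of X]
  let ?S = "rsub Y (trace X Y)"
  have S: "right_module ?S" by (rule right_module_rsub[OF Y tr])
  obtain Q :: "('a, 'm) module" and q where Q: "right_module Q" "q \<in> rhom Y Q"
    "q ` carrier Y = carrier Q" "rker Y Q q = trace X Y"
    using quotient_exists[OF Y tr] by metis
  have QA: "Q \<in> modA" by (rule modA_surj[OF assms Q(2,3,1)])
  \<comment> \<open>The trace is generated by \<open>X\<close>, whereas lifting asks for kernels
    generated by \<open>M\<close>; since \<open>M\<close> generates \<open>X\<close>, transitivity
    closes the gap.\<close>
  have "generates M ?S" by (rule generates_trans[OF gen generates_trace[OF Y] X S])
  then have gM: "generates M (rsub Y (rker Y Q q))" unfolding Q(4) .
  have "h x = \<zero>\<^bsub>Q\<^esub>" if h: "h \<in> rhom X Q" and x: "x \<in> carrier X" for h x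
  proof -
    obtain h' where h': "h' \<in> rhom X Y" "\<And>x. x \<in> carrier X \<Longrightarrow> q (h' x) = h x"
      using liftingD[OF lift assms QA Q(2,3) gM h] by auto
    have "h' x \<in> rker Y Q q" using trace_contains[OF h'(1) x] unfolding Q(4) .
    then show ?thesis using h'(2)[OF x] by (simp add: rker_def)
  qed
  then have "Q \<in> rperp {X}" using QA by (simp add: rperp_def Hom_zero_def)
  moreover have "?S \<in> Fac X"
    using generates_trace[OF Y] modA_rsub[OF fd assms tr] by (simp add: Fac_eq[OF X])
  moreover have "short_exact ?S (\<lambda>x. x) Y q Q"
    using Q(2-4) rsub_inclusion[OF rsubmodule_subset[OF tr]] by (simp add: short_exact_def)
  ultimately show ?thesis
    unfolding canonical_seq_def fst_conv snd_conv by blast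
qed

lemma Fac_Hom_zero:
  fixes Y Z :: "('a, 'm) module"
  assumes "Y \<in> Fac X" "Z \<in> rperp {X}"
  shows "Hom_zero Y Z"
  by (rule generates_Hom_zero[where X=X])
    (use assms modA_right_module in \<open>auto simp: Fac_eq[OF X] rperp_def\<close>)

lemma torsion_pair_Fac: "torsion_pair (Fac X :: ('a, 'm) module set, rperp {X})"
proof -
  have F: "Fac X \<subseteq> (modA :: ('a, 'm) module set)" "rperp {X} \<subseteq> (modA :: ('a, 'm) module set)"
    by (auto simp: Fac_eq[OF X] rperp_def)
  have "replete (Fac X :: ('a, 'm) module set)"
    unfolding replete_def
    using F(1) generates_trans[OF _ generates_iso modA_right_module modA_right_module]
    by (auto simp: Fac_eq[OF X])
  moreover have "replete (rperp {X} :: ('a, 'm) module set)"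
    unfolding replete_def
    using F(2) Hom_zero_iso[OF _ _ modA_right_module modA_right_module] by (auto simp: rperp_def)
  moreover note Fac_Hom_zero Fac_canonical_seq
  moreover have "\<exists>\<alpha>\<in>rhom S S'. \<exists>\<beta>\<in>rhom Q Q'.
           bij_betw \<alpha> (carrier S) (carrier S') \<and> bij_betw \<beta> (carrier Q) (carrier Q') \<and>
           (\<forall>x\<in>carrier S. i' (\<alpha> x) = i x) \<and> (\<forall>x\<in>carrier Y. \<beta> (p x) = p' x)"
    if "Y \<in> modA" "canonical_seq (Fac X, rperp {X}) Y S i p Q"
      "canonical_seq (Fac X, rperp {X}) Y S' i' p' Q'"
    for Y S Q S' Q' :: "('a, 'm) module" and i p i' p'
    using F Fac_Hom_zero by (intro canonical_seq_unique[OF _ _ that(1) _ that(2,3)]) auto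
  ultimately show ?thesis
    unfolding torsion_pair_def fst_conv snd_conv by blast
qed

text \<open>A module without non-zero maps to \<open>rperp {X}\<close> has zero torsion-free part,
  so it equals its torsion part. This is how the smallest torsion class becomes
  \<open>Fac\<close>.\<close>

lemma lperp_rperp: "lperp (rperp {X} :: ('a, 'm) module set) = (Fac X :: ('a, 'm) module set)"
proof
  show "(Fac X :: ('a, 'm) module set) \<subseteq> lperp (rperp {X} :: ('a, 'm) module set)"
  proof
    fix Y :: "('a, 'm) module" assume Y: "Y \<in> Fac X"
    then show "Y \<in> lperp (rperp {X} :: ('a, 'm) module set)"
      using Fac_Hom_zero[of Y] by (auto simp: lperp_def Fac_def)
  qed
  show "lperp (rperp {X} :: ('a, 'm) module set) \<subseteq> (Fac X :: ('a, 'm) module set)"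
  proof
    fix Y :: "('a, 'm) module" assume Y: "Y \<in> lperp (rperp {X} :: ('a, 'm) module set)"
    then have YA: "Y \<in> modA" by (simp add: lperp_def)
    then obtain S Q :: "('a, 'm) module" and i p where c: "S \<in> Fac X" "Q \<in> rperp {X}" "short_exact S i Y p Q"
      using Fac_canonical_seq[OF YA] by (auto simp: canonical_seq_def)
    note se = short_exactD[OF c(3)]
    have "Hom_zero Y Q" using Y c(2) by (simp add: lperp_def)
    then have "rker Y Q p = carrier Y" using Hom_zeroD[OF _ se(2)] by (auto simp: rker_def)
    then have "generates S Y" using se(1,4) by (intro generates_surj) auto
    then have "generates X Y"
      using c(1) generates_trans[of X S Y] YA modA_right_module by (auto simp: Fac_eq[OF X])
    then show "Y \<in> Fac X" using YA by (simp add: Fac_eq[OF X])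
  qed
qed

end

section \<open>Indecomposable quotients\<close>

text \<open>\<open>indecomposable\<close> is phrased with external sums over \<open>{1..2}\<close>,
  while Fitting's lemma produces two complementary submodules; this result connects them.\<close>

lemma rmod_iso_internal_sum:
  assumes X: "right_module X" and U: "rsubmodule U X" and V: "rsubmodule V X"
    and int: "\<And>x. x \<in> U \<Longrightarrow> x \<in> V \<Longrightarrow> x = \<zero>\<^bsub>X\<^esub>"
    and sum: "\<And>x. x \<in> carrier X \<Longrightarrow> \<exists>u\<in>U. \<exists>v\<in>V. x = u \<oplus>\<^bsub>X\<^esub> v"
  shows "X \<cong>\<^sub>m dsum {1..2} (\<lambda>i::nat. rsub X (if i = 1 then U else V))"
proof -
  interpret X: right_module X by fact
  let ?N = "\<lambda>i::nat. rsub X (if i = 1 then U else V)"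
  let ?D = "dsum {1..2} ?N"
  have N: "right_module (?N i)" for i using right_module_rsub[OF X] U V by simp
  have D: "right_module ?D" by (rule right_module_dsum[OF N])
  have sub: "U \<subseteq> carrier X" "V \<subseteq> carrier X" using U V rsubmodule_subset by auto
  have c: "x 1 \<in> U" "x 2 \<in> V" if "x \<in> carrier ?D" for x
    using PiE_mem[OF that[unfolded dsum_simps], of 1] PiE_mem[OF that[unfolded dsum_simps], of 2] by auto
  let ?f = "\<lambda>x :: nat \<Rightarrow> _. x 1 \<oplus>\<^bsub>X\<^esub> x 2"
  have "(\<lambda>x. x i) \<in> rhom ?D X" if "i \<in> {1..2}" for i
    by (rule rhom_rsub_codD[OF dsum_proj[where N="?N", OF that]]) (use sub in auto)
  then have f: "?f \<in> rhom ?D X" by (intro rhom_add[OF _ _ X]) auto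
  have "rker ?D X ?f = {\<zero>\<^bsub>?D\<^esub>}"
  proof
    show "rker ?D X ?f \<subseteq> {\<zero>\<^bsub>?D\<^esub>}"
    proof
      fix x assume x: "x \<in> rker ?D X ?f"
      then have xD: "x \<in> carrier ?D" and x0: "x 1 \<oplus>\<^bsub>X\<^esub> x 2 = \<zero>\<^bsub>X\<^esub>"
        by (simp_all only: rker_def mem_Collect_eq)
      have x12: "x 1 \<in> carrier X" "x 2 \<in> carrier X" using c[OF xD] sub by auto
      have "x 1 = \<ominus>\<^bsub>X\<^esub> x 2" using X.minus_equality[OF x0 x12(2,1)] by simp
      then have "x 1 \<in> V" using rsubmodule_neg[OF V c(2)[OF xD]] by simp
      then have x1: "x 1 = \<zero>\<^bsub>X\<^esub>" using int c(1)[OF xD] by blast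
      then have x2: "x 2 = \<zero>\<^bsub>X\<^esub>" using x0 x12 by simp
      have "x = \<zero>\<^bsub>?D\<^esub>"
      proof (rule dsum_eqI[OF xD rsubmodule_zero[OF rsubmodule_carrier[OF D]]])
        fix i :: nat assume "i \<in> {1..2}"
        then have "i = 1 \<or> i = 2" by auto
        then show "x i = \<zero>\<^bsub>?D\<^esub> i" using x1 x2 by auto
      qed
      then show "x \<in> {\<zero>\<^bsub>?D\<^esub>}" by simp
    qed
    show "{\<zero>\<^bsub>?D\<^esub>} \<subseteq> rker ?D X ?f" using rsubmodule_zero[OF rsubmodule_rker[OF f D X]] by simp
  qed
  then have inj: "inj_on ?f (carrier ?D)" by (rule rhom_inj_onI[OF f D X])
  have surj: "?f ` carrier ?D = carrier X"
  proof
    show "?f ` carrier ?D \<subseteq> carrier X" using rhom_closed[OF f] by (rule image_subsetI)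
    show "carrier X \<subseteq> ?f ` carrier ?D"
    proof
      fix x assume "x \<in> carrier X"
      then obtain u v where uv: "u \<in> U" "v \<in> V" "x = u \<oplus>\<^bsub>X\<^esub> v" using sum by blast
      let ?x = "\<lambda>i\<in>{1..2::nat}. if i = 1 then u else v"
      have "?x \<in> carrier ?D" using uv by auto
      moreover have "x = ?f ?x" using uv by simp
      ultimately show "x \<in> ?f ` carrier ?D" by (rule image_eqI[where f="?f", rotated])
    qed
  qed
  have "?D \<cong>\<^sub>m X" unfolding rmod_iso_def using f inj surj by (auto simp: bij_betw_def simp del: dsum_simps)
  then show ?thesis by (rule rmod_iso_sym[OF _ D])
qed

text \<open>An endomorphism over \<open>e\<close> that minimises the rank of its image and maximises that of its kernel has
  the same image and kernel as its square, which also lies over \<open>e\<close>; this is Fitting's lemma without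
  iteration.\<close>

lemma indecomposable_idempotent_lift:
  fixes scale :: "'k::field \<Rightarrow> 'a::ring_1 \<Rightarrow> 'a" and X :: "('a, 'm) module"
  assumes A: "fd_algebra scale" and X: "X \<in> modA" "indecomposable X"
    and q: "q \<in> rhom X Q" "q ` carrier X = carrier Q"
    and e: "e \<in> rhom Q Q" "\<And>y. y \<in> carrier Q \<Longrightarrow> e (e y) = e y" and Q: "right_module Q"
    and lift: "h0 \<in> rhom X X" "\<And>x. x \<in> carrier X \<Longrightarrow> q (h0 x) = e (q x)"
  shows "(\<forall>y\<in>carrier Q. e y = \<zero>\<^bsub>Q\<^esub>) \<or> (\<forall>y\<in>carrier Q. e y = y)"
proof -
  have rX: "right_module X" by (rule modA_right_module[OF X(1)])
  interpret X: right_module X by (rule rX)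
  obtain rk :: "'m set \<Rightarrow> nat" and d where rk: "\<And>U. rsubmodule U X \<Longrightarrow> rk U \<le> d"
    "\<And>U V. rsubmodule U X \<Longrightarrow> rsubmodule V X \<Longrightarrow> U \<subset> V \<Longrightarrow> rk U < rk V"
    using submodule_rank[OF A X(1)] by metis
  let ?P = "\<lambda>h. h \<in> rhom X X \<and> (\<forall>x\<in>carrier X. q (h x) = e (q x))"
  let ?im = "\<lambda>h. h ` carrier X" and ?ker = "\<lambda>h. rker X X h"
  \<comment> \<open>Every rank is at most \<open>d\<close>, so the subtraction of natural numbers is
    not truncated and the measure drops whenever the image shrinks or the kernel grows.\<close>
  let ?\<mu> = "\<lambda>h. rk (?im h) + (d - rk (?ker h))"
  have "?P h0" using lift by blast
  then obtain h where h: "?P h" and min: "\<And>g. ?P g \<Longrightarrow> ?\<mu> h \<le> ?\<mu> g"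
    using ex_has_least_nat[of ?P h0 ?\<mu>] by blast
  then have hX: "h \<in> rhom X X" and qh: "\<And>x. x \<in> carrier X \<Longrightarrow> q (h x) = e (q x)" by auto
  note hc = rhom_closed[OF hX]
  have h2: "?P (\<lambda>x. h (h x))"
    using rhom_comp[OF hX hX] qh hc e(2) rhom_closed[OF q(1)] by simp
  note sub = rsubmodule_range[OF _ rX rX] rsubmodule_rker[OF _ rX rX]
  have im_le: "?im (\<lambda>x. h (h x)) \<subseteq> ?im h" using hc by auto
  have ker_le: "?ker h \<subseteq> ?ker (\<lambda>x. h (h x))"
    using rhom_zero[OF hX rX rX] by (auto simp: rker_def)
  have "?im (\<lambda>x. h (h x)) = ?im h \<and> ?ker h = ?ker (\<lambda>x. h (h x))"
  proof (rule ccontr)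
    assume neg: "\<not> ?thesis"
    have le: "rk U \<le> rk V" if "rsubmodule U X" "rsubmodule V X" "U \<subseteq> V" for U V
      using rk(2)[OF that(1,2)] that(3) by (metis less_imp_le order.refl psubsetI)
    have h2X: "(\<lambda>x. h (h x)) \<in> rhom X X" using h2 by simp
    note s = sub(1)[OF hX] sub(2)[OF hX] sub(1)[OF h2X] sub(2)[OF h2X]
    have "rk (?im (\<lambda>x. h (h x))) < rk (?im h) \<or> rk (?ker h) < rk (?ker (\<lambda>x. h (h x)))"
      using neg im_le ker_le rk(2)[OF s(3,1)] rk(2)[OF s(2,4)] by blast
    then have "?\<mu> (\<lambda>x. h (h x)) < ?\<mu> h"
      using le[OF s(3,1) im_le] le[OF s(2,4) ker_le] rk(1)[OF s(4)] by linarith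
    then show False using min[OF h2] by simp
  qed
  then have im_eq: "?im (\<lambda>x. h (h x)) = ?im h" and ker_eq: "?ker h = ?ker (\<lambda>x. h (h x))" by auto
  have int: "x = \<zero>\<^bsub>X\<^esub>" if "x \<in> ?im h" "x \<in> ?ker h" for x
  proof -
    from that(1) obtain y where y: "y \<in> carrier X" "x = h y" by auto
    then have "y \<in> ?ker (\<lambda>x. h (h x))" using that(2) by (simp add: rker_def)
    then have "y \<in> ?ker h" using ker_eq by simp
    then show ?thesis using y by (simp add: rker_def)
  qed
  have sum: "\<exists>u\<in>?im h. \<exists>v\<in>?ker h. x = u \<oplus>\<^bsub>X\<^esub> v" if x: "x \<in> carrier X" for x
  proof -
    have "h x \<in> ?im (\<lambda>x. h (h x))" using im_eq x by auto
    then obtain z where z: "z \<in> carrier X" "h x = h (h z)" by auto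
    have "x \<ominus>\<^bsub>X\<^esub> h z \<in> ?ker h"
      using rhom_diff[OF hX rX rX x hc[OF z(1)]] z(2) hc x z(1) right_module_diff_zero_iff[OF rX]
      by (simp add: rker_def)
    moreover have "x = h z \<oplus>\<^bsub>X\<^esub> (x \<ominus>\<^bsub>X\<^esub> h z)"
      using x hc[OF z(1)] by (simp add: a_minus_def X.a_ac X.r_neg2 X.r_neg1 X.r_neg)
    ultimately show ?thesis using z(1) by blast
  qed
  let ?N = "\<lambda>i::nat. rsub X (if i = 1 then ?im h else ?ker h)"
  have iso: "X \<cong>\<^sub>m dsum {1..2} ?N"
    by (rule rmod_iso_internal_sum[OF rX sub(1)[OF hX] sub(2)[OF hX] int sum])
  have N: "?N 1 \<in> modA" "?N 2 \<in> modA"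
    using modA_rsub[OF A X(1)] sub(1)[OF hX] sub(2)[OF hX] by auto
  have "zero_module (?N 1) \<or> zero_module (?N 2)"
    using X(2)[unfolded indecomposable_def, THEN conjunct2, rule_format, of ?N] N iso by blast
  then show ?thesis
  proof
    assume "zero_module (?N 1)"
    then have h0: "h x = \<zero>\<^bsub>X\<^esub>" if "x \<in> carrier X" for x using that by (auto simp: zero_module_def)
    have "e y = \<zero>\<^bsub>Q\<^esub>" if "y \<in> carrier Q" for y
    proof -
      obtain x where "x \<in> carrier X" "y = q x" using \<open>y \<in> carrier Q\<close> q(2) by auto
      then show ?thesis using qh[of x] h0 rhom_zero[OF q(1) rX Q] by simp
    qed
    then show ?thesis by blast
  next
    assume "zero_module (?N 2)"
    then have k: "?ker h = {\<zero>\<^bsub>X\<^esub>}" by (simp add: zero_module_def)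
    \<comment> \<open>With zero kernel, \<open>sum\<close> makes \<open>h\<close> surjective. Every
      \<open>y\<close> in \<open>Q\<close> is then a value of \<open>e\<close>, and idempotence
      gives the claim.\<close>
    have "e y = y" if "y \<in> carrier Q" for y
    proof -
      obtain x where x: "x \<in> carrier X" "y = q x" using \<open>y \<in> carrier Q\<close> q(2) by auto
      obtain z where "z \<in> carrier X" "x = h z" using sum[OF x(1)] k hc by auto
      then have "y = e (q z)" "q z \<in> carrier Q" using x(2) qh[of z] rhom_closed[OF q(1)] by auto
      then show ?thesis using e(2) by simp
    qed
    then show ?thesis by blast
  qed
qed

text \<open>A decomposition of \<open>Q\<close> gives the idempotent that projects onto the first
  summand. Composed with \<open>q\<close> it lifts along \<open>q\<close> to an endomorphism of
  \<open>X\<close>, so it must be zero or the identity, which makes the first or the second summand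
  vanish.\<close>

lemma indecomposable_quotient:
  fixes scale :: "'k::field \<Rightarrow> 'a::ring_1 \<Rightarrow> 'a" and M X Q :: "('a, 'm) module"
  assumes A: "fd_algebra scale" and X: "X \<in> modA" "indecomposable X" and lift: "lifting M X"
    and q: "q \<in> rhom X Q" "q ` carrier X = carrier Q" and Q: "Q \<in> modA" "\<not> zero_module Q"
    and gen: "generates M (rsub X (rker X Q q))"
  shows "indecomposable Q"
  unfolding indecomposable_def
proof (intro conjI allI impI Q(2), elim conjE)
  fix N :: "nat \<Rightarrow> ('a, 'm) module"
  assume N: "N 1 \<in> modA" "N 2 \<in> modA" and iso: "Q \<cong>\<^sub>m dsum {1..2} N"
  have rQ: "right_module Q" by (rule modA_right_module[OF Q(1)])
  have rN: "right_module (N i)" if "i \<in> {1..2}" for i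
  proof -
    have "i = 1 \<or> i = 2" using that by auto
    then show ?thesis using N modA_right_module by auto
  qed
  let ?D = "dsum {1..2} N"
  have D: "right_module ?D" by (rule right_module_dsum[OF rN])
  have i: "(1::nat) \<in> {1..2}" "(2::nat) \<in> {1..2}" by auto
  note inj1 = dinj_rhom[where I="{1..2}" and N=N, OF rN i(1)]
  note inj2 = dinj_rhom[where I="{1..2}" and N=N, OF rN i(2)]
  obtain f g where f: "f \<in> rhom Q ?D" and g: "g \<in> rhom ?D Q"
    and gf: "\<And>y. y \<in> carrier Q \<Longrightarrow> g (f y) = y" and fg: "\<And>z. z \<in> carrier ?D \<Longrightarrow> f (g z) = z"
    using rmod_isoE[OF iso rQ] by metis
  define e where "e y = g (dinj {1..2} N 1 (f y 1))" for y
  have f1: "(\<lambda>y. f y 1) \<in> rhom Q (N 1)" by (rule rhom_comp[OF f dsum_proj[where N=N, OF i(1)]])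
  have e: "e \<in> rhom Q Q" unfolding e_def by (rule rhom_comp[OF rhom_comp[OF f1 inj1] g])
  have fe: "f (e y) = dinj {1..2} N 1 (f y 1)" if "y \<in> carrier Q" for y
    unfolding e_def by (rule fg[OF rhom_closed[OF inj1 rhom_closed[OF f1 that]]])
  have ee: "e (e y) = e y" if "y \<in> carrier Q" for y
    using fe[OF that] by (simp add: e_def[of "e y"]) (simp add: dinj_def e_def)
  obtain h where h: "h \<in> rhom X X" "\<And>x. x \<in> carrier X \<Longrightarrow> q (h x) = e (q x)"
    using liftingD[OF lift X(1) Q(1) q gen rhom_comp[OF q(1) e]] by auto
  from indecomposable_idempotent_lift[OF A X q e ee rQ h]
  show "zero_module (N 1) \<or> zero_module (N 2)"
  proof
    assume e0: "\<forall>y\<in>carrier Q. e y = \<zero>\<^bsub>Q\<^esub>"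
    have "a = \<zero>\<^bsub>N 1\<^esub>" if a: "a \<in> carrier (N 1)" for a
    proof -
      let ?z = "dinj {1..2} N 1 a"
      have z: "?z \<in> carrier ?D" by (rule rhom_closed[OF inj1 a])
      have z1: "?z 1 = a" by (simp add: dinj_def)
      \<comment> \<open>An element coming from the first summand is fixed by the projection.\<close>
      have "e (g ?z) = g ?z" unfolding e_def fg[OF z] z1 ..
      then have "g ?z = \<zero>\<^bsub>Q\<^esub>" using e0 rhom_closed[OF g z] by metis
      then have "?z = \<zero>\<^bsub>?D\<^esub>" using fg[OF z] rhom_zero[OF f rQ D] by metis
      then have "?z 1 = \<zero>\<^bsub>?D\<^esub> 1" by (rule fun_cong)
      then show ?thesis unfolding z1 by simp
    qed
    then have "zero_module (N 1)" by (rule zero_moduleI[OF rN[OF i(1)]])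
    then show ?thesis ..
  next
    assume e1: "\<forall>y\<in>carrier Q. e y = y"
    have "a = \<zero>\<^bsub>N 2\<^esub>" if a: "a \<in> carrier (N 2)" for a
    proof -
      let ?z = "dinj {1..2} N 2 a"
      have z: "?z \<in> carrier ?D" by (rule rhom_closed[OF inj2 a])
      have z1: "?z 1 = \<zero>\<^bsub>N 1\<^esub>" "?z 2 = a" by (simp_all add: dinj_def)
      \<comment> \<open>An element coming from the second summand has first coordinate zero, so the
        projection kills it.\<close>
      have "e (g ?z) = g (dinj {1..2} N 1 \<zero>\<^bsub>N 1\<^esub>)" unfolding e_def fg[OF z] z1 ..
      also have "\<dots> = \<zero>\<^bsub>Q\<^esub>"
        using rhom_zero[OF inj1 rN[OF i(1)] D] rhom_zero[OF g D rQ] by metis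
      finally have "g ?z = \<zero>\<^bsub>Q\<^esub>" using e1 rhom_closed[OF g z] by metis
      then have "?z = \<zero>\<^bsub>?D\<^esub>" using fg[OF z] rhom_zero[OF f rQ D] by metis
      then have "?z 2 = \<zero>\<^bsub>?D\<^esub> 2" by (rule fun_cong)
      then show ?thesis unfolding z1 by simp
    qed
    then have "zero_module (N 2)" by (rule zero_moduleI[OF rN[OF i(2)]])
    then show ?thesis ..
  qed
qed

section \<open>Admissible decompositions\<close>

lemma tfree_canonical_seq:
  assumes "\<exists>S i p Q. canonical_seq TF X S i p Q"
  shows "\<exists>S i p. canonical_seq TF X S i p (tfree TF X)"
proof -
  have "\<exists>Q. \<exists>S i p. canonical_seq TF X S i p Q" using assms by blast
  then show ?thesis unfolding tfree_def by (rule someI_ex)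
qed

text \<open>The common setting of both claims: \<open>L\<close> is the family of block sums for the
  first and the family of the given indecomposable summands for the second. Indecomposability is
  therefore not part of it.\<close>

locale admissible_sum =
  fixes scale :: "'k::field \<Rightarrow> 'a::ring_1 \<Rightarrow> 'a" and M :: "('a, 'm) module"
    and r :: nat and L :: "nat \<Rightarrow> ('a, 'm) module"
  assumes fd: "fd_algebra scale" and M: "right_module M" and liftM: "lifting M M"
    and iso: "M \<cong>\<^sub>m dsum {1..r} L" and r: "1 \<le> r"
    and L: "\<And>j. j \<in> {1..r} \<Longrightarrow> L j \<in> modA"
    and adm: "\<And>k. k \<in> {1..r} \<Longrightarrow> L k \<notin> Fac (dsum {k + 1..r} L)"
begin

abbreviation tail :: "nat \<Rightarrow> ('a, nat \<Rightarrow> 'm) module" where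
  "tail k \<equiv> dsum {k..r} L"

lemma rL: "j \<in> {1..r} \<Longrightarrow> right_module (L j)"
  using L modA_right_module by blast

lemma right_module_tail: "1 \<le> k \<Longrightarrow> right_module (tail k)"
  using rL by (intro right_module_dsum) auto

lemma generates_tail: "1 \<le> k \<Longrightarrow> generates M (tail k)"
  using generates_trans[OF generates_iso[OF iso] generates_dsum_subset[of "{k..r}" "{1..r}" L]]
    rL right_module_tail by auto

lemma tail_generates_tail: "1 \<le> k \<Longrightarrow> k \<le> l \<Longrightarrow> generates (tail k) (tail l)"
  using rL by (intro generates_dsum_subset) auto

lemma tail_generates: "1 \<le> k \<Longrightarrow> k \<le> j \<Longrightarrow> j \<le> r \<Longrightarrow> generates (tail k) (L j)"
  using rL by (intro dsum_generates) auto

lemma lifting_tail: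
  assumes "1 \<le> k"
  shows "lifting M (tail k)"
proof -
  have "lifting M (tail 1)" by (rule lifting_iso[OF liftM iso M])
  then show ?thesis by (rule lifting_dsum_subset) (use assms rL in auto)
qed

lemma lifting_L:
  assumes "j \<in> {1..r}"
  shows "lifting M (L j)"
  by (rule lifting_dsum_component[OF lifting_tail[of j]]) (use assms rL in auto)

lemma lifting_generator_tail: "1 \<le> k \<Longrightarrow> lifting_generator scale M (tail k)"
  by (intro lifting_generator.intro fd M right_module_tail lifting_tail generates_tail)

lemma Fac_tail: "1 \<le> k \<Longrightarrow> Fac (tail k) = {Y \<in> modA. generates (tail k) Y}"
  by (rule Fac_eq[OF right_module_tail])

lemma Fac_tail_mono:
  assumes "1 \<le> k" "k \<le> l"
  shows "(Fac (tail l) :: ('a, 'm) module set) \<subseteq> Fac (tail k)"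
  using generates_trans[OF tail_generates_tail[OF assms]] right_module_tail[of l] modA_right_module assms
  by (auto simp: Fac_tail simp del: dsum_simps)

lemma rperp_tail_mono:
  assumes "1 \<le> k" "k \<le> l"
  shows "(rperp {tail k} :: ('a, 'm) module set) \<subseteq> rperp {tail l}"
proof
  fix Z :: "('a, 'm) module" assume Z: "Z \<in> rperp {tail k}"
  have "Hom_zero (tail l) Z"
    by (rule generates_Hom_zero[OF tail_generates_tail[OF assms]])
      (use Z assms right_module_tail modA_right_module in \<open>auto simp: rperp_def\<close>)
  then show "Z \<in> rperp {tail l}" using Z by (simp add: rperp_def)
qed

lemma L_not_in_Fac:
  assumes "k \<in> {1..r}" "k < l"
  shows "L k \<notin> Fac (tail l)"
  using adm[OF assms(1)] Fac_tail_mono[of "k + 1" l] assms by auto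

lemma L_in_Fac: "1 \<le> k \<Longrightarrow> k \<le> j \<Longrightarrow> j \<le> r \<Longrightarrow> L j \<in> Fac (tail k)"
  using tail_generates L by (simp add: Fac_tail)

text \<open>A zero module is generated by every module, including the empty sum that is the tail
  beyond \<open>r\<close>. So admissibility excludes it even for the last index.\<close>

lemma L_nonzero:
  assumes "k \<in> {1..r}"
  shows "\<not> zero_module (L k)"
proof
  assume z: "zero_module (L k)"
  have "generates (tail (k + 1)) (L k)"
    unfolding generates_def
  proof (intro allI impI)
    fix U assume "rsubmodule U (L k) \<and> (\<forall>h\<in>rhom (tail (k + 1)) (L k). h ` carrier (tail (k + 1)) \<subseteq> U)"
    then show "U = carrier (L k)"
      using z rsubmodule_zero[of U "L k"] rsubmodule_subset[of U "L k"] by (auto simp: zero_module_def)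
  qed
  then show False using adm[OF assms] L[OF assms] by (simp add: Fac_tail)
qed

text \<open>A map out of a finite direct sum vanishes as soon as it vanishes on each summand.
  \<open>T_induces\<close> speaks of the set of summands, \<open>Fac_family\<close> of their
  sum.\<close>

lemma rperp_tail:
  assumes "k \<in> {1..r}"
  shows "(rperp {L j | j. j \<in> {1..r} \<and> k \<le> j} :: ('a, 'm) module set) = rperp {tail k}"
proof (intro subset_antisym subsetI)
  fix Z :: "('a, 'm) module" assume Z: "Z \<in> rperp {tail k}"
  have "Hom_zero (L j) Z" if "j \<in> {1..r}" "k \<le> j" for j
    by (rule generates_Hom_zero[OF tail_generates])
      (use Z that assms rL modA_right_module in \<open>auto simp: rperp_def\<close>)
  then show "Z \<in> rperp {L j | j. j \<in> {1..r} \<and> k \<le> j}" using Z by (auto simp: rperp_def)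
next
  fix Z :: "('a, 'm) module" assume Z: "Z \<in> rperp {L j | j. j \<in> {1..r} \<and> k \<le> j}"
  have ZA: "Z \<in> modA" and rZ: "right_module Z" using Z modA_right_module by (auto simp: rperp_def)
  have T: "right_module (tail k)" using right_module_tail assms by simp
  have "h x = \<zero>\<^bsub>Z\<^esub>" if h: "h \<in> rhom (tail k) Z" and x: "x \<in> carrier (tail k)" for h x
  proof -
    have rLk: "right_module (L j)" if "j \<in> {k..r}" for j using that assms rL by simp
    have "rker (tail k) Z h = carrier (tail k)"
    proof (rule dsum_generated[OF _ rLk rsubmodule_rker[OF h T rZ]])
      fix j x assume j: "j \<in> {k..r}" and x: "x \<in> carrier (L j)"
      note inj = dinj_rhom[where I="{k..r}" and N=L, OF rLk j]
      have "L j \<in> {L j | j. j \<in> {1..r} \<and> k \<le> j}" using j assms by auto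
      then have "Hom_zero (L j) Z" using Z unfolding rperp_def by blast
      then have "h (dinj {k..r} L j x) = \<zero>\<^bsub>Z\<^esub>" by (rule Hom_zeroD[OF _ rhom_comp[OF inj h] x])
      then show "dinj {k..r} L j x \<in> rker (tail k) Z h"
        using rhom_closed[OF inj x] by (simp add: rker_def del: dsum_simps)
    qed simp_all
    then show ?thesis using x by (auto simp: rker_def)
  qed
  then show "Z \<in> rperp {tail k}" using ZA by (simp add: rperp_def Hom_zero_def del: dsum_simps)
qed

section \<open>The nested family and membership in the dagger category\<close>

lemma T_induces_Fac_family: "T_induces {1..r} L (Fac_family r L)"
  unfolding T_induces_def
proof (intro conjI ballI)
  show "L \<in> Gr {1..r}" using L by (simp add: Gr_def)
  show "nested_family {1..r} (Fac_family r L)"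
    unfolding nested_family_def
  proof (intro conjI ballI impI)
    fix k assume k: "k \<in> {1..r}"
    then show "torsion_pair (Fac_family r L k)"
      unfolding Fac_family_def by (intro lifting_generator.torsion_pair_Fac[OF lifting_generator_tail]) simp
    fix l assume l: "l \<in> {1..r}" "k < l"
    have "Fac (tail l) \<noteq> (Fac (tail k) :: ('a, 'm) module set)"
      using L_not_in_Fac[OF k l(2)] L_in_Fac[of k k] k by auto
    then show "fst (Fac_family r L l) \<subset> fst (Fac_family r L k)"
      using Fac_tail_mono[of k l] k l by (simp add: Fac_family_def psubset_eq)
  qed
  fix k assume k: "k \<in> {1..r}"
  then show "Fac_family r L k = (Tors {L j |j. j \<in> {1..r} \<and> k \<le> j}, rperp {L j |j. j \<in> {1..r} \<and> k \<le> j})"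
    unfolding Fac_family_def Tors_def rperp_tail[OF k]
    using lifting_generator.lperp_rperp[OF lifting_generator_tail, of k] by simp
qed

lemma calM_Fac_family: "L \<in> calM {1..r} (Fac_family r L)"
  using L L_nonzero L_in_Fac L_not_in_Fac by (simp add: calM_def Gr_def Fac_family_def)

text \<open>The torsion-free classes grow with the index, so their intersection above
  \<open>k\<close> is the one at \<open>k + 1\<close>. At \<open>k = r\<close> no index remains;
  that case is treated in \<open>frakF_quotient\<close>.\<close>

lemma tf_above_Fac_family:
  assumes "k \<in> {1..<r}"
  shows "tf_above {1..r} (Fac_family r L) k = rperp {tail (k + 1)}"
proof -
  have "(rperp {tail (k + 1)} :: ('a, 'm) module set) \<subseteq> modA" unfolding rperp_def by blast
  moreover have "rperp {tail (k + 1)} \<subseteq> (rperp {tail j} :: ('a, 'm) module set)" if "k < j" for j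
    using that by (intro rperp_tail_mono) auto
  moreover have "k + 1 \<in> {j \<in> {1..r}. k < j}" using assms by simp
  ultimately show ?thesis
    unfolding tf_above_def Fac_family_def snd_conv by blast
qed

text \<open>For the vanishing of \<open>Ext\<close> it suffices that the torsion-free part is a
  quotient of \<open>L k\<close> in \<open>modA\<close>, for then \<open>M\<close> generates
  it.\<close>

lemma frakF_quotient:
  assumes "k \<in> {1..r}"
  shows "frakF {1..r} (Fac_family r L) L k \<in> modA \<and>
    (\<exists>p\<in>rhom (L k) (frakF {1..r} (Fac_family r L) L k).
       p ` carrier (L k) = carrier (frakF {1..r} (Fac_family r L) L k))"
proof -
  let ?A = "tf_above {1..r} (Fac_family r L) k"
  let ?TF = "(lperp ?A, ?A) :: ('a, 'm) mod_class_pair"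
  have "\<exists>S i p Q. canonical_seq ?TF (L k) S i p Q"
  proof (cases "k < r")
    case True
    then have k: "k \<in> {1..<r}" using assms by simp
    have lg: "lifting_generator scale M (tail (k + 1))" by (rule lifting_generator_tail) simp
    show ?thesis
      unfolding tf_above_Fac_family[OF k] lifting_generator.lperp_rperp[OF lg]
      by (rule lifting_generator.Fac_canonical_seq[OF lg L[OF assms]])
  next
    case False
    then have k: "k = r" using assms by simp
    \<comment> \<open>The empty intersection is all of \<open>modA\<close>, so the torsion part is
      the zero submodule and the quotient map is the identity of \<open>L k\<close>.\<close>
    then have A: "?A = modA" by (auto simp: tf_above_def)
    note rk = rL[OF assms]
    let ?S = "rsub (L k) {\<zero>\<^bsub>L k\<^esub>}"
    note z = rsubmodule_zero_set[OF rk]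
    have S: "right_module ?S" by (rule right_module_rsub[OF rk z])
    have "Hom_zero ?S Y" if "Y \<in> modA" for Y :: "('a, 'm) module"
      using rhom_zero[OF _ S modA_right_module[OF that]] by (simp add: Hom_zero_def)
    then have "?S \<in> lperp (modA :: ('a, 'm) module set)" using modA_rsub[OF fd L[OF assms] z] by (simp add: lperp_def)
    moreover have "short_exact ?S (\<lambda>x. x) (L k) (\<lambda>x. x) (L k)"
      using rsub_inclusion[OF rsubmodule_subset[OF z]] rhom_id rsubmodule_zero[OF rsubmodule_carrier[OF rk]]
      by (auto simp: short_exact_def rker_def)
    ultimately have "canonical_seq ?TF (L k) ?S (\<lambda>x. x) (\<lambda>x. x) (L k)"
      using L[OF assms] unfolding A by (simp add: canonical_seq_def)
    then show ?thesis by blast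
  qed
  then obtain S i p where c: "canonical_seq ?TF (L k) S i p (frakF {1..r} (Fac_family r L) L k)"
    using tfree_canonical_seq unfolding frakF_def by blast
  have "?A \<subseteq> modA" by (auto simp: tf_above_def)
  then show ?thesis using c unfolding canonical_seq_def short_exact_def by auto
qed

lemma generates_L: "k \<in> {1..r} \<Longrightarrow> generates M (L k)"
  by (rule generates_trans[OF generates_tail[of k] tail_generates[of k k]])
    (use rL right_module_tail in auto)

lemma generates_quotient:
  assumes "k \<in> {1..r}" "p \<in> rhom (L k) Q" "p ` carrier (L k) = carrier Q" "right_module Q"
  shows "generates M Q"
  by (rule generates_trans[OF generates_L generates_surj]) (use assms rL in auto)

lemma calM_dagger_Fac_family: "L \<in> calM_dagger {1..r} (Fac_family r L)"
  unfolding calM_dagger_def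
proof (intro CollectI conjI ballI impI)
  show "L \<in> calM {1..r} (Fac_family r L)" by (rule calM_Fac_family)
  show "\<not> (\<forall>k\<in>{1..r}. zero_module (L k))" using L_nonzero r by auto
  fix k j assume k: "k \<in> {1..r}" and j: "j \<in> {1..r}"
  note Q = frakF_quotient[OF j]
  have "generates M (frakF {1..r} (Fac_family r L) L j)"
    using Q generates_quotient[OF j] modA_right_module by blast
  then show "Ext1_zero (L k) (frakF {1..r} (Fac_family r L) L j)"
    using Q by (intro lifting_imp_Ext1_zero[OF lifting_L[OF k] L[OF k]]) auto
qed

section \<open>The torsion-free parts as a stratifying system\<close>

lemma tf_parts_seq:
  assumes "k \<in> {1..<r}"
  obtains S :: "('a, 'm) module" and i p where "S \<in> Fac (tail (k + 1))" "tf_parts r L k \<in> rperp {tail (k + 1)}"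
    "short_exact S i (L k) p (tf_parts r L k)"
proof -
  have "\<exists>S i p. canonical_seq (Fac_family r L (k + 1)) (L k) S i p (tf_parts r L k)"
    using tfree_canonical_seq[OF lifting_generator.Fac_canonical_seq[OF lifting_generator_tail L]] assms
    by (simp add: tf_parts_def Fac_family_def)
  then show thesis using that by (auto simp: canonical_seq_def Fac_family_def)
qed

text \<open>One description covers the convention at \<open>k = r\<close> too, where the map is the
  identity with zero kernel and \<open>tail (r + 1)\<close> is the empty sum. The range of
  \<open>j\<close> serves three uses: \<open>j = 1\<close> gives generation by \<open>M\<close>,
  \<open>j = k + 1\<close> leads to non-vanishing, and the values between enter the argument for
  \<open>Ext\<close>.\<close>

lemma tf_parts_quotient:
  assumes k: "k \<in> {1..r}"
  obtains p where "tf_parts r L k \<in> modA" "p \<in> rhom (L k) (tf_parts r L k)"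
    "p ` carrier (L k) = carrier (tf_parts r L k)"
    "Hom_zero (tail (k + 1)) (tf_parts r L k)"
    "\<And>j. 1 \<le> j \<Longrightarrow> j \<le> k + 1 \<Longrightarrow> generates (tail j) (rsub (L k) (rker (L k) (tf_parts r L k) p))"
proof (cases "k = r")
  case True
  then have Q: "tf_parts r L k = L k" by (simp add: tf_parts_def)
  have "generates (tail j) (rsub (L k) {\<zero>\<^bsub>L k\<^esub>})" for j
    unfolding generates_def using rsubmodule_zero rsubmodule_subset by fastforce
  moreover have "rker (L k) (L k) (\<lambda>x. x) = {\<zero>\<^bsub>L k\<^esub>}"
    using rsubmodule_zero[OF rsubmodule_carrier[OF rL[OF k]]] by (auto simp: rker_def)
  moreover have "Hom_zero (tail (k + 1)) (L k)"
  proof -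
    have "x = \<zero>\<^bsub>tail (k + 1)\<^esub>" if "x \<in> carrier (tail (k + 1))" for x
      using that True by (auto simp: fun_eq_iff)
    then show ?thesis
      using rhom_zero[OF _ right_module_tail rL[OF k], of _ "k + 1"] unfolding Hom_zero_def by fastforce
  qed
  ultimately show thesis
    using L[OF k] rhom_id[of "L k"] by (intro that[of "\<lambda>x. x"]) (simp_all add: Q del: dsum_simps)
next
  case False
  then have kr: "k \<in> {1..<r}" using k by simp
  obtain S :: "('a, 'm) module" and i p where S: "S \<in> Fac (tail (k + 1))" and Q: "tf_parts r L k \<in> rperp {tail (k + 1)}"
    and se: "short_exact S i (L k) p (tf_parts r L k)"
    using tf_parts_seq[OF kr] by blast
  note se = short_exactD[OF se]
  have rS: "right_module S" using S modA_right_module[of S] by (simp add: Fac_tail)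
  show thesis
  proof (rule that[OF _ se(2,5)])
    fix j assume j: "1 \<le> j" "j \<le> k + 1"
    have "S \<in> Fac (tail j)" using S Fac_tail_mono[OF j] by auto
    then have "generates (tail j) S" using j by (simp add: Fac_tail)
    from generates_image[OF this se(1) rS rL[OF k]]
    show "generates (tail j) (rsub (L k) (rker (L k) (tf_parts r L k) p))" unfolding se(4) .
  qed (use Q in \<open>auto simp: rperp_def simp del: dsum_simps\<close>)
qed

lemma tf_parts_modA: "k \<in> {1..r} \<Longrightarrow> tf_parts r L k \<in> modA"
  using tf_parts_quotient by metis

text \<open>If the torsion-free part vanished, \<open>L k\<close> would coincide with its torsion
  part and be generated by the later summands, against admissibility.\<close>

lemma tf_parts_nonzero:
  assumes k: "k \<in> {1..r}"
  shows "\<not> zero_module (tf_parts r L k)"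
proof
  assume z: "zero_module (tf_parts r L k)"
  obtain p where p: "p \<in> rhom (L k) (tf_parts r L k)"
    and gen: "\<And>j. 1 \<le> j \<Longrightarrow> j \<le> k + 1 \<Longrightarrow> generates (tail j) (rsub (L k) (rker (L k) (tf_parts r L k) p))"
    using tf_parts_quotient[OF k] by metis
  have "rker (L k) (tf_parts r L k) p = carrier (L k)"
    using z rhom_closed[OF p] by (auto simp: rker_def zero_module_def)
  then have "generates (tail (k + 1)) (rsub (L k) (carrier (L k)))" using gen[of "k + 1"] by simp
  then have "generates (tail (k + 1)) (L k)" by (simp add: rsub_def)
  then show False using adm[OF k] L[OF k] by (simp add: Fac_tail)
qed

text \<open>For \<open>j < k\<close> the module \<open>L k\<close> is a summand of
  \<open>tail (j + 1)\<close>, which therefore generates every quotient of \<open>L k\<close> but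
  has no non-zero map to the \<open>j\<close>-th torsion-free part.\<close>

lemma Hom_zero_tf_parts:
  assumes k: "k \<in> {1..r}" and j: "j \<in> {1..r}" "j < k"
  shows "Hom_zero (tf_parts r L k) (tf_parts r L j)"
proof -
  note rQ = modA_right_module[OF tf_parts_modA]
  obtain p where p: "p \<in> rhom (L k) (tf_parts r L k)" "p ` carrier (L k) = carrier (tf_parts r L k)"
    using tf_parts_quotient[OF k] by metis
  have "Hom_zero (tail (j + 1)) (tf_parts r L j)"
    using tf_parts_quotient[OF j(1)] by metis
  moreover have "generates (tail (j + 1)) (L k)" using k j by (intro tail_generates) auto
  then have "generates (tail (j + 1)) (tf_parts r L k)"
    by (rule generates_trans[OF _ generates_surj[OF p] rL[OF k] rQ[OF k]])
  ultimately show ?thesis by (rule generates_Hom_zero[OF _ _ rQ[OF k] rQ[OF j(1)], rotated])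
qed

text \<open>A lift of \<open>L k \<rightarrow> \<Omega> k\<close> to an extension by \<open>\<Omega> j\<close> kills the torsion part of \<open>L k\<close>, because it maps it
  into \<open>\<Omega> j\<close>, to which the torsion part has no non-zero maps; so it induces a section.\<close>

lemma Ext1_zero_tf_parts:
  assumes k: "k \<in> {1..r}" and j: "j \<in> {1..r}" "j \<le> k"
  shows "Ext1_zero (tf_parts r L k) (tf_parts r L j)"
  unfolding Ext1_zero_def
proof (intro allI impI, elim conjE)
  let ?Q = "tf_parts r L k" and ?R = "tf_parts r L j"
  fix E :: "('a, 'm) module" and i p
  assume E: "E \<in> modA" and "short_exact ?R i E p ?Q"
  note se = short_exactD[OF this(2)]
  have rE: "right_module E" by (rule modA_right_module[OF E])
  note rQ = modA_right_module[OF tf_parts_modA]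
  obtain q where q: "q \<in> rhom (L k) ?Q" "q ` carrier (L k) = carrier ?Q"
    and genk: "\<And>j. 1 \<le> j \<Longrightarrow> j \<le> k + 1 \<Longrightarrow> generates (tail j) (rsub (L k) (rker (L k) ?Q q))"
    using tf_parts_quotient[OF k] by metis
  obtain q' where q': "q' \<in> rhom (L j) ?R" "q' ` carrier (L j) = carrier ?R"
    using tf_parts_quotient[OF j(1)] by metis
  have "generates M ?R" by (rule generates_quotient[OF j(1) q' rQ[OF j(1)]])
  from generates_image[OF this se(1) rQ[OF j(1)] rE]
  have gen: "generates M (rsub E (rker E ?Q p))" unfolding se(4) .
  obtain l where l: "l \<in> rhom (L k) E" and pl: "\<And>x. x \<in> carrier (L k) \<Longrightarrow> p (l x) = q x"
    using liftingD[OF lifting_L[OF k] E tf_parts_modA[OF k] se(2,5) gen q(1)] by auto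
  show "\<exists>s\<in>rhom ?Q E. \<forall>y\<in>carrier ?Q. p (s y) = y"
  proof -
    let ?K = "rker (L k) ?Q q"
    note K = rsubmodule_rker[OF q(1) rL[OF k] rQ[OF k]]
    have rK: "right_module (rsub (L k) ?K)" by (rule right_module_rsub[OF rL[OF k] K])
    have kill: "l x = \<zero>\<^bsub>E\<^esub>" if x: "x \<in> ?K" for x
    proof -
      \<comment> \<open>The lift takes values in the image of \<open>i\<close>, not in
        \<open>?R\<close> itself, so the vanishing of maps is transferred along the isomorphism onto
        that image.\<close>
      have i: "i \<in> rhom ?R (rsub E (i ` carrier ?R))" by (rule rhom_rsub_cod[OF se(1)]) simp
      have iso: "?R \<cong>\<^sub>m rsub E (i ` carrier ?R)"
        unfolding rmod_iso_def using i se(3) by (intro bexI[of _ i]) (simp_all add: bij_betw_def)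
      have rI: "right_module (rsub E (i ` carrier ?R))"
        by (rule right_module_rsub[OF rE rsubmodule_range[OF se(1) rQ[OF j(1)] rE]])
      have "Hom_zero (tail (j + 1)) ?R" using tf_parts_quotient[OF j(1)] by metis
      \<comment> \<open>Here \<open>j \<le> k\<close> is used: it puts \<open>j + 1\<close> in the
        range up to \<open>k + 1\<close> in which tails generate the torsion part of
        \<open>L k\<close>.\<close>
      moreover have "generates (tail (j + 1)) (rsub (L k) ?K)" using j by (intro genk) auto
      ultimately have "Hom_zero (rsub (L k) ?K) ?R" using generates_Hom_zero rK rQ[OF j(1)] by blast
      then have "Hom_zero (rsub (L k) ?K) (rsub E (i ` carrier ?R))"
        by (rule Hom_zero_iso[OF _ iso rQ[OF j(1)] rI])
      moreover have "l \<in> rhom (rsub (L k) ?K) (rsub E (i ` carrier ?R))"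
      proof (rule rhom_rsub_cod[OF rhom_rsub_dom[OF l rsubmodule_subset[OF K]]])
        show "l ` carrier (rsub (L k) ?K) \<subseteq> i ` carrier ?R"
          unfolding se(4) using pl rhom_closed[OF l] by (auto simp: rker_def)
      qed
      ultimately show ?thesis using Hom_zeroD[of "rsub (L k) ?K" _ l x] x by simp
    qed
    obtain s where s: "s \<in> rhom ?Q E" "\<And>x. x \<in> carrier (L k) \<Longrightarrow> s (q x) = l x"
      using rhom_factor[OF q l rL[OF k] rQ[OF k] rE] kill by (auto simp: rker_def)
    have "p (s y) = y" if "y \<in> carrier ?Q" for y
    proof -
      have "y \<in> q ` carrier (L k)" using that q(2) by simp
      then obtain x where x: "x \<in> carrier (L k)" "y = q x" by auto
      then show ?thesis using s(2) pl by simp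
    qed
    then show ?thesis using s(1) by blast
  qed
qed

lemma pre_stratifying_system_tf_parts: "pre_stratifying_system {1..r} (tf_parts r L)"
  unfolding pre_stratifying_system_def
  using tf_parts_modA tf_parts_nonzero Hom_zero_tf_parts Ext1_zero_tf_parts by blast

lemma indecomposable_tf_parts:
  assumes k: "k \<in> {1..r}" and ind: "indecomposable (L k)"
  shows "indecomposable (tf_parts r L k)"
proof -
  obtain q where q: "q \<in> rhom (L k) (tf_parts r L k)" "q ` carrier (L k) = carrier (tf_parts r L k)"
    and gen: "\<And>j. 1 \<le> j \<Longrightarrow> j \<le> k + 1 \<Longrightarrow> generates (tail j) (rsub (L k) (rker (L k) (tf_parts r L k) q))"
    using tf_parts_quotient[OF k] by metis
  have K: "right_module (rsub (L k) (rker (L k) (tf_parts r L k) q))"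
    by (rule right_module_rsub[OF rL[OF k] rsubmodule_rker[OF q(1) rL[OF k] modA_right_module[OF tf_parts_modA[OF k]]]])
  have "generates M (rsub (L k) (rker (L k) (tf_parts r L k) q))"
    by (rule generates_trans[OF generates_tail[of 1] gen[of 1] right_module_tail K]) simp_all
  then show ?thesis
    by (rule indecomposable_quotient[OF fd L[OF k] ind lifting_L[OF k] q tf_parts_modA[OF k] tf_parts_nonzero[OF k]])
qed

end

text \<open>Admissibility holds because \<open>L k\<close> has the last summand \<open>N (c (k + 1))\<close> of its block as a quotient,
  which the later blocks do not generate.\<close>

lemma admissible_sum_blocks:
  fixes scale :: "'k::field \<Rightarrow> 'a::ring_1 \<Rightarrow> 'a" and M :: "('a, 'm) module"
    and N L :: "nat \<Rightarrow> ('a, 'm) module" and c :: "nat \<Rightarrow> nat"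
  assumes fd: "fd_algebra scale" and M: "right_module M" and lift: "lifting M M"
    and N: "tf_admissible_decomposition t N M"
    and r: "1 \<le> r" and c: "c 1 = 0" "c (r + 1) = t" "\<And>i j. 1 \<le> i \<Longrightarrow> i < j \<Longrightarrow> j \<le> r + 1 \<Longrightarrow> c i < c j"
    and L: "\<And>j. j \<in> {1..r} \<Longrightarrow> L j \<in> modA"
    and iso: "\<And>j. j \<in> {1..r} \<Longrightarrow> L j \<cong>\<^sub>m dsum {c j + 1..c (j + 1)} N"
  shows "admissible_sum scale M r L"
proof -
  have dec: "\<And>j. j \<in> {1..t} \<Longrightarrow> N j \<in> modA" "M \<cong>\<^sub>m dsum {1..t} N"
    and adm: "\<And>i. i \<in> {1..t} \<Longrightarrow> N i \<notin> Fac (dsum {i<..t} N)"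
    using N by (auto simp: tf_admissible_decomposition_def indec_decomposition_def)
  have rN: "right_module (N j)" if "j \<in> {1..t}" for j using dec(1)[OF that] by (rule modA_right_module)
  have rL: "right_module (L j)" if "j \<in> {1..r}" for j using L[OF that] by (rule modA_right_module)
  have cle: "c i \<le> c j" if "1 \<le> i" "i \<le> j" "j \<le> r + 1" for i j
    using c(3)[of i j] that by (cases "i = j") auto
  \<comment> \<open>The value \<open>k = r + 1\<close> is included; both sums are then empty, as the
    admissibility of the last block requires.\<close>
  have blocks: "dsum {k..r} L \<cong>\<^sub>m dsum {c k + 1..t} N" if k: "1 \<le> k" "k \<le> r + 1" for k
  proof (rule dsum_blocks)
    show "right_module (N i)" if "i \<in> {c k + 1..t}" for i using that by (intro rN) auto
    show "right_module (L j)" if "j \<in> {k..r}" for j using that k by (intro rL) auto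
    show "L j \<cong>\<^sub>m dsum {c j + 1..c (j + 1)} N" if "j \<in> {k..r}" for j using that k by (intro iso) auto
    \<comment> \<open>The bound \<open>k \<le> l + 1\<close> admits an empty union, so the induction
      can start before the first block.\<close>
    have "{c k + 1..c (l + 1)} = (\<Union>j\<in>{k..l}. {c j + 1..c (j + 1)})" if "k \<le> l + 1" "l \<le> r" for l
      using that
    proof (induction l)
      case 0
      then have "k = 1" using k by simp
      then show ?case by simp
    next
      case (Suc l)
      show ?case
      proof (cases "k = Suc (Suc l)")
        case True
        then show ?thesis by simp
      next
        case False
        then have "k \<le> Suc l" using Suc.prems by simp
        then have "{k..Suc l} = insert (Suc l) {k..l}" by auto
        moreover have "{c k + 1..c (Suc l + 1)} = {c (Suc l) + 1..c (Suc l + 1)} \<union> {c k + 1..c (l + 1)}"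
          using cle[of k "Suc l"] cle[of "Suc l" "Suc l + 1"] k \<open>k \<le> Suc l\<close> Suc.prems by auto
        ultimately show ?thesis using Suc \<open>k \<le> Suc l\<close> by simp
      qed
    qed
    from this[of r] show "{c k + 1..t} = (\<Union>j\<in>{k..r}. {c j + 1..c (j + 1)})" using k c(2) by simp
    fix i j j'
    assume a: "j \<in> {k..r}" "j' \<in> {k..r}" "i \<in> {c j + 1..c (j + 1)}" "i \<in> {c j' + 1..c (j' + 1)}"
    have "\<not> j < j'" using cle[of "j + 1" j'] a k by auto
    moreover have "\<not> j' < j" using cle[of "j' + 1" j] a k by auto
    ultimately show "j = j'" by simp
  qed
  have D: "right_module (dsum {i..t} N)" if "1 \<le> i" for i
    using that rN by (intro right_module_dsum) auto
  show ?thesis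
  proof (rule admissible_sum.intro)
    have "dsum {1..r} L \<cong>\<^sub>m dsum {1..t} N" using blocks[of 1] c(1) by simp
    then have "dsum {1..t} N \<cong>\<^sub>m dsum {1..r} L"
      by (rule rmod_iso_sym) (rule right_module_dsum[OF rL])
    then show "M \<cong>\<^sub>m dsum {1..r} L" by (rule rmod_iso_trans[OF dec(2)])
    fix k assume k: "k \<in> {1..r}"
    let ?m = "c (k + 1)"
    have m: "c k < ?m" "?m \<le> t" using k c(3)[of k "k + 1"] cle[of "k + 1" "r + 1"] c(2) by auto
    then have mt: "?m \<in> {1..t}" by auto
    have T: "right_module (dsum {k + 1..r} L)" using rL by (intro right_module_dsum) auto
    have B: "right_module (dsum {c k + 1..?m} N)" using m rN by (intro right_module_dsum) auto
    show "L k \<notin> Fac (dsum {k + 1..r} L)"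
    proof
      assume "L k \<in> Fac (dsum {k + 1..r} L)"
      then have g: "generates (dsum {k + 1..r} L) (L k)" by (simp only: Fac_eq[OF T] mem_Collect_eq)
      have "generates (dsum {?m + 1..t} N) (dsum {k + 1..r} L)"
        by (rule generates_iso[OF rmod_iso_sym[OF blocks T]]) (use k in simp_all)
      then have "generates (dsum {?m + 1..t} N) (L k)"
        by (rule generates_trans[OF _ g T rL[OF k]])
      then have "generates (dsum {?m + 1..t} N) (dsum {c k + 1..?m} N)"
        by (rule generates_trans[OF _ generates_iso[OF iso[OF k]] rL[OF k] B])
      moreover have "generates (dsum {c k + 1..?m} N) (N ?m)" using m rN by (intro dsum_generates) auto
      ultimately have gm: "generates (dsum {?m + 1..t} N) (N ?m)"
        by (rule generates_trans[OF _ _ B rN[OF mt]])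
      have eq: "{?m + 1..t} = {?m<..t}" by auto
      have D': "right_module (dsum {?m<..t} N)" unfolding eq[symmetric] by (rule D) simp
      have "N ?m \<in> Fac (dsum {?m<..t} N)"
        using gm dec(1)[OF mt] unfolding eq Fac_eq[OF D'] by simp
      then show False using adm[OF mt] by simp
    qed
  qed (use fd M lift r L in auto)
qed

text \<open>The \<open>L j\<close> range over all members of \<open>modA\<close> isomorphic to the
  block sums, because the external sums themselves live on another type.\<close>

theorem corollary5p4:
  fixes scale :: "'k::alg_closed_field \<Rightarrow> 'a::ring_1 \<Rightarrow> 'a"
    and M :: "('a, 'm) module"
    and N :: "nat \<Rightarrow> ('a, 'm) module"
    and t :: nat
  assumes "fd_algebra scale"
    and "M \<in> modA" and "\<not> zero_module M" and "basic M" and "tau_rigid scale M"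
    and "tf_admissible_decomposition t N M"
  shows "(\<forall>(r::nat) (\<kappa> :: nat \<Rightarrow> nat) (L :: nat \<Rightarrow> ('a, 'm) module).
           1 \<le> r \<and> r \<le> t \<and>
           \<kappa> 1 = 0 \<and> \<kappa> ` {2..r} \<subseteq> {1..t-1} \<and> strict_mono_on {2..r} \<kappa> \<and>
           (\<forall>j\<in>{1..r}. L j \<in> modA) \<and>
           (\<forall>j\<in>{1..<r}. L j \<cong>\<^sub>m dsum {\<kappa> j + 1..\<kappa> (j + 1)} N) \<and>
           L r \<cong>\<^sub>m dsum {\<kappa> r + 1..t} N
           \<longrightarrow>
           M \<cong>\<^sub>m dsum {1..r} L \<and>
           T_induces {1..r} L (Fac_family r L) \<and>
           L \<in> calM_dagger {1..r} (Fac_family r L) \<and>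
           pre_stratifying_system {1..r} (tf_parts r L) \<and> card {1..r} = r)
         \<and> stratifying_system {1..t} (tf_parts t N) \<and> card {1..t} = t"
proof (intro conjI allI impI)
  note rM = modA_right_module[OF assms(2)]
  note lift = tau_rigid_imp_lifting[OF assms(1,2,3,5)]
  have dec: "\<And>j. j \<in> {1..t} \<Longrightarrow> N j \<in> modA \<and> indecomposable (N j)" "M \<cong>\<^sub>m dsum {1..t} N"
    and adm: "\<And>i. i \<in> {1..t} \<Longrightarrow> N i \<notin> Fac (dsum {i<..t} N)"
    using assms(6) by (auto simp: tf_admissible_decomposition_def indec_decomposition_def)
  have rD: "right_module (dsum {1..t} N)" using dec(1) modA_right_module by (intro right_module_dsum) auto
  \<comment> \<open>An empty decomposition would make \<open>M\<close> zero.\<close>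
  have t: "1 \<le> t"
  proof (rule ccontr)
    assume "\<not> 1 \<le> t"
    then have "zero_module (dsum {1..t} N)" by (simp add: zero_module_def restrict_def)
    then show False using zero_module_iso[OF dec(2) rM rD] assms(3) by simp
  qed
  \<comment> \<open>The second claim is the case in which every block consists of one summand; here
    the given summands themselves are taken as the family.\<close>
  have sum_N: "admissible_sum scale M t N"
  proof (rule admissible_sum.intro)
    show "N k \<notin> Fac (dsum {k + 1..t} N)" if "k \<in> {1..t}" for k
    proof -
      have "{k + 1..t} = {k<..t}" by auto
      then show ?thesis using adm[OF that] by simp
    qed
  qed (use assms(1) rM lift dec t in auto)
  then show "stratifying_system {1..t} (tf_parts t N)"
    using dec(1) unfolding stratifying_system_def
    by (blast intro: admissible_sum.pre_stratifying_system_tf_parts admissible_sum.indecomposable_tf_parts)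
  fix r :: nat and \<kappa> :: "nat \<Rightarrow> nat" and L :: "nat \<Rightarrow> ('a, 'm) module"
  assume a: "1 \<le> r \<and> r \<le> t \<and>
           \<kappa> 1 = 0 \<and> \<kappa> ` {2..r} \<subseteq> {1..t-1} \<and> strict_mono_on {2..r} \<kappa> \<and>
           (\<forall>j\<in>{1..r}. L j \<in> modA) \<and>
           (\<forall>j\<in>{1..<r}. L j \<cong>\<^sub>m dsum {\<kappa> j + 1..\<kappa> (j + 1)} N) \<and>
           L r \<cong>\<^sub>m dsum {\<kappa> r + 1..t} N"
  then have r: "1 \<le> r" and \<kappa>1: "\<kappa> 1 = 0" and \<kappa>: "strict_mono_on {2..r} \<kappa>"
    and L: "\<And>j. j \<in> {1..r} \<Longrightarrow> L j \<in> modA" and iso: "\<And>j. j \<in> {1..<r} \<Longrightarrow> L j \<cong>\<^sub>m dsum {\<kappa> j + 1..\<kappa> (j + 1)} N"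
    and iso_r: "L r \<cong>\<^sub>m dsum {\<kappa> r + 1..t} N" and im: "\<kappa> ` {2..r} \<subseteq> {1..t-1}"
    by auto
  have bounds: "1 \<le> \<kappa> j" "\<kappa> j < t" if "2 \<le> j" "j \<le> r" for j
  proof -
    have "\<kappa> j \<in> \<kappa> ` {2..r}" using that by (intro imageI) simp
    then have "\<kappa> j \<in> {1..t-1}" by (rule subsetD[OF im])
    then show "1 \<le> \<kappa> j" "\<kappa> j < t" using t by auto
  qed
  \<comment> \<open>Appending \<open>t\<close> as the value at \<open>r + 1\<close> gives the last
    block the same form as the others and makes the sequence of endpoints strictly increasing on
    \<open>{1..r + 1}\<close>.\<close>
  define c where "c j = (if j \<le> r then \<kappa> j else t)" for j
  have "admissible_sum scale M r L"
  proof (rule admissible_sum_blocks[OF assms(1) rM lift assms(6) r])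
    show "c 1 = 0" "c (r + 1) = t" using r \<kappa>1 by (simp_all add: c_def)
    show "c i < c j" if ij: "1 \<le> i" "i < j" "j \<le> r + 1" for i j
    proof (cases "i = 1")
      case True
      then show ?thesis using ij \<kappa>1 bounds(1)[of j] t by (auto simp: c_def)
    next
      case False
      then show ?thesis
        using ij bounds(2)[of i] strict_mono_onD[OF \<kappa>, of i j] by (auto simp: c_def)
    qed
    show "L j \<cong>\<^sub>m dsum {c j + 1..c (j + 1)} N" if "j \<in> {1..r}" for j
      using iso[of j] iso_r that by (cases "j = r") (auto simp: c_def)
  qed (rule L)
  then interpret admissible_sum scale M r L .
  show "M \<cong>\<^sub>m dsum {1..r} L" by (rule iso)
  show "T_induces {1..r} L (Fac_family r L)" by (rule T_induces_Fac_family)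
  show "L \<in> calM_dagger {1..r} (Fac_family r L)" by (rule calM_dagger_Fac_family)
  show "pre_stratifying_system {1..r} (tf_parts r L)" by (rule pre_stratifying_system_tf_parts)
qed simp_all

end
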